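(* For any fixed $\varepsilon>0$, $$\left(1+\varepsilon-\tfrac{\varepsilon^3}{3}\right)n\;\lesssim\; f(n,(1+\varepsilon)n).$$ Also, there exist absolute constants $\alpha_0>0$ and $\varepsilon_0>0$ such that for any fixed $0<\varepsilon<\varepsilon_0$, $$f(n,(1+\varepsilon)n)\;\lesssim\;\left(1+\varepsilon-\frac13\,\frac{\alpha_0\varepsilon^3}{\ln(1/\varepsilon)}\right)n.$$
   Context: A random 2-SAT formula $F(n,m)$ on variables $X_1,\dots,X_n$ consists of $m$ clauses, each chosen independently and uniformly at random (with replacement) from the $2^2\binom n2$ proper clauses (disjunctions of two literals on two distinct variables). $\max F$ is the maximum over truth assignments of the number of clauses satisfied, and $f(n,m)=\mathbb{E}[\max F(n,m)]$; $(1+\varepsilon)n$ is understood as $\lfloor(1+\varepsilon)n\rfloor$. Notation: $a(n)\lesssim b(n)$ means $\limsup_{n\to\infty}a(n)/b(n)\le1$; in statements involving both $n$ and a parameter $\varepsilon$, the limit in $n$ is taken first for fixed $\varepsilon$, then $\varepsilon$ is considered small. *)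

theory Defs
  imports "HOL-Probability.Probability"
begin

text \<open>
  The variables are \<open>X\<^sub>1, \<dots>, X\<^sub>n\<close>, represented by their indices. The literal \<open>(i, b)\<close> is satisfied
  when \<open>X\<^sub>i\<close> has the truth value \<open>b\<close>. A clause is the unordered collection of its literals,
  which is what makes the number of proper clauses \<open>4 * (n choose 2)\<close> (lemma below).
\<close>

type_synonym literal = "nat \<times> bool"
type_synonym clause = "literal set"

definition proper_clauses :: "nat \<Rightarrow> clause set" where
  "proper_clauses n =
     {{(i, b), (j, c)} | i j b c. i \<in> {1..n} \<and> j \<in> {1..n} \<and> i \<noteq> j}"

definition satisfies :: "(nat \<Rightarrow> bool) \<Rightarrow> clause \<Rightarrow> bool" where
  "satisfies \<sigma> C \<longleftrightarrow> (\<exists>(i, b) \<in> C. \<sigma> i = b)"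

text \<open>
  A formula is a list of clauses, so repeated clauses are counted with multiplicity. The maximum
  ranges over assignments to all indices; only the values at indices occurring in the formula
  matter, and the set of attained values is a finite nonempty subset of \<open>{..length F}\<close>.
\<close>

definition max_sat :: "clause list \<Rightarrow> nat" where
  "max_sat F = Max (range (\<lambda>\<sigma>. length (filter (satisfies \<sigma>) F)))"

text \<open>
  For \<open>n < 2\<close> there are no proper clauses and the distribution is unspecified; only large
  \<open>n\<close> is relevant below.
\<close>

definition random_2sat :: "nat \<Rightarrow> nat \<Rightarrow> clause list pmf" where
  "random_2sat n m = replicate_pmf m (pmf_of_set (proper_clauses n))"

definition expected_max_sat :: "nat \<Rightarrow> nat \<Rightarrow> real" where
  "expected_max_sat n m = measure_pmf.expectation (random_2sat n m) (\<lambda>F. real (max_sat F))"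

definition asymp_le :: "(nat \<Rightarrow> real) \<Rightarrow> (nat \<Rightarrow> real) \<Rightarrow> bool" where
  "asymp_le a b \<longleftrightarrow> limsup (\<lambda>n. ereal (a n / b n)) \<le> 1"

lemma finite_proper_clauses: "finite (proper_clauses n)"
  by (rule finite_subset[of _ "Pow ({1..n} \<times> UNIV)"]) (auto simp: proper_clauses_def)

lemma card_proper_clauses: "card (proper_clauses n) = 4 * (n choose 2)"
proof -
  let ?L = "{1..n} \<times> (UNIV :: bool set)"
  let ?A = "{C. C \<subseteq> ?L \<and> card C = 2}"
  let ?B = "(\<lambda>i. {(i, True), (i, False)}) ` {1..n}"
  have eq: "proper_clauses n = ?A - ?B"
  proof (intro equalityI subsetI)
    fix C assume "C \<in> proper_clauses n"
    then obtain i j b c where *: "C = {(i, b), (j, c)}" "i \<in> {1..n}" "j \<in> {1..n}" "i \<noteq> j"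
      unfolding proper_clauses_def by blast
    have "C \<notin> ?B"
    proof
      assume "C \<in> ?B"
      then obtain k where "C = {(k, True), (k, False)}" by blast
      then have "fst ` C = {k}" by simp
      moreover have "fst ` C = {i, j}" using *(1) by simp
      ultimately show False using *(4) by (simp add: doubleton_eq_iff)
    qed
    moreover have "card C = 2" using *(1,4) by simp
    ultimately show "C \<in> ?A - ?B" using * by simp
  next
    fix C assume C: "C \<in> ?A - ?B"
    then have C2: "C \<subseteq> ?L" "card C = 2" "C \<notin> ?B" by simp_all
    from C2(2) obtain x y where xy: "C = {x, y}" "x \<noteq> y" by (meson card_2_iff)
    obtain i b j c where ij: "x = (i, b)" "y = (j, c)" by (metis surj_pair)
    have range: "i \<in> {1..n}" "j \<in> {1..n}" using C2(1) xy(1) ij by simp_all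
    have "i \<noteq> j"
    proof
      assume "i = j"
      then have "C = {(i, True), (i, False)}"
        using xy ij by (cases b; cases c) (simp_all add: insert_commute)
      then show False using C2(3) range by blast
    qed
    then show "C \<in> proper_clauses n"
      using xy(1) ij range unfolding proper_clauses_def by blast
  qed
  have sub: "?B \<subseteq> ?A" by auto
  have "card ?A = (2 * n) choose 2"
    using n_subsets[of ?L 2] by (simp add: card_cartesian_product mult.commute)
  moreover have "card ?B = n"
    by (subst card_image) (auto simp: inj_on_def doubleton_eq_iff)
  ultimately have "card (proper_clauses n) = ((2 * n) choose 2) - n"
    unfolding eq using sub by (subst card_Diff_subset) (auto intro: finite_subset)
  also have "(2 * n) choose 2 = n * (2 * n - 1)"
    by (simp add: choose_two)
  also have "n * (2 * n - 1) - n = 4 * (n choose 2)"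
  proof -
    have "even (n * (n - 1))" by (cases n) auto
    then have "4 * (n choose 2) = 2 * (n * (n - 1))" by (auto simp: choose_two elim: evenE)
    then show ?thesis by (cases n) (simp_all add: algebra_simps)
  qed
  finally show ?thesis .
qed

end

theory Submission
  imports Defs "HOL-Real_Asymp.Real_Asymp"
begin

text \<open>
  Upper bound: with high probability, depth-first search in the implication digraph finds a path of
  \<open>M\<close> literals with \<open>M\<close> of order \<open>\<epsilon>\<^sup>2 * n\<close>. Along a path the truth values increase except at violated
  clauses, so it suffices to consider few assignments of its variables. By unit propagation, an assignment
  of \<open>M\<close> variables extends to one of the whole formula with few violations with probability at most
  \<open>exp (- 3 / 2 * \<epsilon> * M)\<close>, since a branching process with mean offspring \<open>1 + \<epsilon>\<close> started from \<open>M\<close>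
  individuals becomes extinct with probability about \<open>exp (- 2 * \<epsilon> * M)\<close>. The expected number of paths is
  about \<open>n * (1 + \<epsilon>) ^ M\<close>, and the first moment method applies. Choosing the violated clauses
  of the path costs a factor \<open>ln (1 / \<epsilon>)\<close> in the number of violations that can be excluded.

  Lower bound: assign the variables while exploring the components of the graph of the formula. Each
  clause is satisfied by its first assigned variable with probability \<open>1 / 2\<close>; otherwise it forces the second
  variable, and it is violated with probability \<open>1 / 2\<close> if that one is assigned already. So the expected
  number of violated clauses is half the expected number of independent cycles of a random graph with
  half of the edges. The \<open>i\<close>-th clause creates such a cycle with probability \<open>1 / 2\<close> times the probability
  that two random vertices are connected in the graph, which is at most about \<open>(2 * (c - 1))\<^sup>2\<close> with
  \<open>c = i / n\<close>. Summing over \<open>i\<close> gives \<open>\<epsilon> ^ 3 / 3 * n\<close>.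
\<close>

section \<open>Random subsets and random lists\<close>

text \<open>Independence is the obstacle: a list of exactly \<open>m\<close> clauses is not a
  product over clauses. A Poisson number of clauses makes them independent. In general this costs a
  factor of order \<open>m\<close>, affordable against the exponentially small probabilities of the
  upper bound; the lower bound instead uses monotonicity and a slightly larger mean. In the upper
  bound a violation gets the weight \<open>w = \<epsilon> ^ 4\<close>, so small that the extinction
  rate and (through its square root) the number of path assignments change only in lower order.
  Undoing the weight of \<open>k\<close> violations costs \<open>(1 / w) ^ (2 * k)\<close>, and
  \<open>ln (1 / w) = 4 * ln (1 / \<epsilon>)\<close> is the source of the logarithm. In the lower
  bound connectivity is needed only from above. Every vertex becomes a seed with a small probability
  \<delta>, and the density of the vertices connected to a seed replaces the giant component.
  Deleting \<open>k\<close> vertices yields an approximate recursion for the \<open>k\<close>-th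
  moment of this density, which bounds it by about \<open>2 * (c - 1)\<close>; its square bounds the
  fraction of connected pairs.\<close>

definition bexp :: "real \<Rightarrow> 'a set \<Rightarrow> ('a set \<Rightarrow> real) \<Rightarrow> real" where
  "bexp p S f = (\<Sum>B\<in>Pow S. p ^ card B * (1 - p) ^ card (S - B) * f B)"

lemma bexp_empty [simp]: "bexp p {} f = f {}"
  by (simp add: bexp_def)

lemma bexp_insert:
  assumes "finite S" "e \<notin> S"
  shows "bexp p (insert e S) f = p * bexp p S (\<lambda>B. f (insert e B)) + (1 - p) * bexp p S f"
proof -
  have disj: "Pow S \<inter> insert e ` Pow S = {}"
    using assms by auto
  have inj: "inj_on (insert e) (Pow S)"
    using assms by (auto simp: inj_on_def)
  have 1: "p ^ card (insert e B) * (1 - p) ^ card (insert e S - insert e B) * f (insert e B)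
        = p * (p ^ card B * (1 - p) ^ card (S - B) * f (insert e B))" if "B \<in> Pow S" for B
  proof -
    have "finite B" "e \<notin> B" using that assms by (auto intro: finite_subset)
    moreover have "insert e S - insert e B = S - B" using assms by auto
    ultimately show ?thesis by simp
  qed
  have 2: "p ^ card B * (1 - p) ^ card (insert e S - B) * f B
        = (1 - p) * (p ^ card B * (1 - p) ^ card (S - B) * f B)" if "B \<in> Pow S" for B
  proof -
    have "insert e S - B = insert e (S - B)" "e \<notin> S - B" using that assms by auto
    then show ?thesis using assms by simp
  qed
  have "bexp p (insert e S) f = (\<Sum>B\<in>Pow S. p ^ card B * (1 - p) ^ card (insert e S - B) * f B)
      + (\<Sum>B\<in>Pow S. p ^ card (insert e B) * (1 - p) ^ card (insert e S - insert e B) * f (insert e B))"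
    unfolding bexp_def Pow_insert using assms
    by (subst sum.union_disjoint[OF _ _ disj]) (simp_all add: sum.reindex[OF inj])
  also have "\<dots> = (\<Sum>B\<in>Pow S. (1 - p) * (p ^ card B * (1 - p) ^ card (S - B) * f B))
      + (\<Sum>B\<in>Pow S. p * (p ^ card B * (1 - p) ^ card (S - B) * f (insert e B)))"
    using 1 2 by (intro arg_cong2[of _ _ _ _ "(+)"] sum.cong refl)
  finally show ?thesis
    by (simp add: bexp_def sum_distrib_left)
qed

lemma bexp_const [simp]: "finite S \<Longrightarrow> bexp p S (\<lambda>_. c) = c"
  by (induction S rule: finite_induct) (simp_all add: bexp_insert algebra_simps)

lemma bexp_add: "bexp p S (\<lambda>B. f B + g B) = bexp p S f + bexp p S g"
  by (simp add: bexp_def algebra_simps sum.distrib)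

lemma bexp_cmult: "bexp p S (\<lambda>B. c * f B) = c * bexp p S f"
  by (simp add: bexp_def sum_distrib_left mult.left_commute)

lemma bexp_cmult_right: "bexp p S (\<lambda>B. f B * c) = bexp p S f * c"
  by (simp add: bexp_def sum_distrib_right mult.assoc)

lemma bexp_sum: "bexp p S (\<lambda>B. \<Sum>i\<in>I. f i B) = (\<Sum>i\<in>I. bexp p S (f i))"
  unfolding bexp_def by (subst sum.swap) (simp add: sum_distrib_left)

lemma bexp_mono:
  assumes "0 \<le> p" "p \<le> 1" "\<And>B. B \<subseteq> S \<Longrightarrow> f B \<le> g B"
  shows "bexp p S f \<le> bexp p S g"
  unfolding bexp_def using assms by (intro sum_mono mult_left_mono) auto

lemma bexp_nonneg:
  assumes "0 \<le> p" "p \<le> 1" "\<And>B. B \<subseteq> S \<Longrightarrow> 0 \<le> f B"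
  shows "0 \<le> bexp p S f"
  unfolding bexp_def using assms by (intro sum_nonneg mult_nonneg_nonneg) auto

lemma bexp_cong:
  assumes "\<And>B. B \<subseteq> S \<Longrightarrow> f B = g B"
  shows "bexp p S f = bexp p S g"
  unfolding bexp_def using assms by (intro sum.cong) auto

lemma bexp_union:
  assumes "finite S" "finite T" "S \<inter> T = {}"
  shows "bexp p (S \<union> T) f = bexp p S (\<lambda>A. bexp p T (\<lambda>B. f (A \<union> B)))"
  using assms
proof (induction S arbitrary: f rule: finite_induct)
  case (insert e S)
  then have "e \<notin> S \<union> T" "S \<inter> T = {}" by auto
  then show ?case
    using insert by (simp add: bexp_insert)
qed simp

lemma bexp_image:
  assumes "finite S" "inj_on h S"
  shows "bexp p (h ` S) f = bexp p S (\<lambda>B. f (h ` B))"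
  using assms
proof (induction S arbitrary: f rule: finite_induct)
  case (insert e S)
  then have "h e \<notin> h ` S" by auto
  then show ?case
    using insert by (simp add: bexp_insert)
qed simp

lemma bexp_power:
  assumes "finite S"
  shows "bexp p S (\<lambda>B. y ^ card B) = (1 - p + p * y) ^ card S"
  using assms
proof (induction S rule: finite_induct)
  case (insert e S)
  have "bexp p S (\<lambda>B. y ^ card (insert e B)) = bexp p S (\<lambda>B. y * y ^ card B)"
    using insert by (intro bexp_cong) (metis card_insert_disjoint finite_subset power_Suc subsetD)
  then show ?case
    using insert by (simp add: bexp_insert bexp_cmult algebra_simps)
qed simp

lemma bexp_disjoint:
  assumes "finite S" "Z \<subseteq> S"
  shows "bexp p S (\<lambda>B. if B \<inter> Z = {} then 1 else 0) = (1 - p) ^ card Z"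
  using assms
proof (induction S arbitrary: Z rule: finite_induct)
  case (insert e S)
  show ?case
  proof (cases "e \<in> Z")
    case True
    have "Z - {e} \<subseteq> S" "finite (Z - {e})" using insert by (auto intro: finite_subset)
    moreover have "bexp p S (\<lambda>B. if B \<inter> Z = {} then 1 else 0)
        = bexp p S (\<lambda>B. if B \<inter> (Z - {e}) = {} then 1 else 0)"
    proof (intro bexp_cong)
      fix B assume "B \<subseteq> S"
      then have "B \<inter> Z = B \<inter> (Z - {e})" using insert by auto
      then show "(if B \<inter> Z = {} then 1 else 0) = (if B \<inter> (Z - {e}) = {} then 1 else (0::real))"
        by simp
    qed
    moreover have "bexp p S (\<lambda>B. if insert e B \<inter> Z = {} then 1 else 0) = 0"
      using True insert by (simp add: bexp_const)
    moreover have "card Z = Suc (card (Z - {e}))"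
      using True \<open>finite (Z - {e})\<close> by (metis card.remove finite_Diff_insert finite.emptyI Diff_empty)
    ultimately show ?thesis
      using insert.IH[of "Z - {e}"] insert.hyps
      by (simp add: bexp_insert del: card_Diff_insert card_Diff_singleton)
  next
    case False
    then show ?thesis
      using insert by (simp add: bexp_insert subset_insert algebra_simps)
  qed
qed simp

text \<open>Negative correlation in the manner of Harris: containing \<open>E\<close> is an
  increasing event, and \<open>f\<close> is decreasing. It separates the occurrence of a path from
  the extendability of an assignment, although both concern the same clauses.\<close>

lemma bexp_superset_le:
  assumes "finite S" "E \<subseteq> S" "0 \<le> p" "p \<le> 1"
    and anti: "\<And>A B. A \<subseteq> B \<Longrightarrow> B \<subseteq> S \<Longrightarrow> f B \<le> f A"
  shows "bexp p S (\<lambda>B. if E \<subseteq> B then f B else 0) \<le> p ^ card E * bexp p S f"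
  using assms
proof (induction S arbitrary: E f rule: finite_induct)
  case (insert e S)
  have anti1: "f (insert e B) \<le> f (insert e A)" if "A \<subseteq> B" "B \<subseteq> S" for A B
    using that by (intro insert.prems) auto
  have anti2: "f B \<le> f A" if "A \<subseteq> B" "B \<subseteq> S" for A B
    using that by (intro insert.prems) auto
  show ?case
  proof (cases "e \<in> E")
    case True
    have E: "E - {e} \<subseteq> S" "finite E" using insert by (auto intro: finite_subset)
    have "bexp p S (\<lambda>B. if E \<subseteq> B then f B else 0) = bexp p S (\<lambda>_. 0)"
      using True insert by (intro bexp_cong) auto
    then have 0: "bexp p S (\<lambda>B. if E \<subseteq> B then f B else 0) = 0" using insert by simp
    have 1: "bexp p S (\<lambda>B. if E \<subseteq> insert e B then f (insert e B) else 0)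
        = bexp p S (\<lambda>B. if E - {e} \<subseteq> B then f (insert e B) else 0)"
    proof (intro bexp_cong)
      fix B assume "B \<subseteq> S"
      have "E \<subseteq> insert e B \<longleftrightarrow> E - {e} \<subseteq> B" by auto
      then show "(if E \<subseteq> insert e B then f (insert e B) else 0)
          = (if E - {e} \<subseteq> B then f (insert e B) else 0)" by simp
    qed
    have 2: "bexp p S (\<lambda>B. if E - {e} \<subseteq> B then f (insert e B) else 0)
        \<le> p ^ card (E - {e}) * bexp p S (\<lambda>B. f (insert e B))"
      by (rule insert.IH[OF E(1) insert.prems(2,3) anti1])
    have "bexp p S (\<lambda>B. f (insert e B)) \<le> bexp p S f"
      using insert.prems by (intro bexp_mono insert.prems) auto
    then have "bexp p S (\<lambda>B. f (insert e B)) 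
        \<le> p * bexp p S (\<lambda>B. f (insert e B)) + (1 - p) * bexp p S f"
      using insert.prems mult_left_mono[of "bexp p S (\<lambda>B. f (insert e B))" "bexp p S f" "1 - p"]
      by (simp add: algebra_simps)
    then have "p ^ card (E - {e}) * bexp p S (\<lambda>B. f (insert e B)) \<le>
        p ^ card (E - {e}) * bexp p (insert e S) f"
      using insert by (simp add: bexp_insert mult_left_mono)
    with 2 have "p * bexp p S (\<lambda>B. if E - {e} \<subseteq> B then f (insert e B) else 0)
        \<le> p * (p ^ card (E - {e}) * bexp p (insert e S) f)"
      using insert.prems by (intro mult_left_mono) auto
    moreover have "p ^ card E = p * p ^ card (E - {e})"
      using True E by (metis card.remove power_Suc)
    ultimately show ?thesis
      using 0 1 insert.hyps by (subst bexp_insert) (simp_all add: mult.assoc)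
  next
    case False
    have E: "E \<subseteq> S" using insert False by auto
    have 1: "bexp p S (\<lambda>B. if E \<subseteq> insert e B then f (insert e B) else 0)
        = bexp p S (\<lambda>B. if E \<subseteq> B then f (insert e B) else 0)"
      using False by (simp add: subset_insert)
    have "p * bexp p S (\<lambda>B. if E \<subseteq> B then f (insert e B) else 0)
        \<le> p * (p ^ card E * bexp p S (\<lambda>B. f (insert e B)))"
      using insert.prems by (intro mult_left_mono insert.IH[OF E insert.prems(2,3) anti1]) auto
    moreover have "(1 - p) * bexp p S (\<lambda>B. if E \<subseteq> B then f B else 0)
        \<le> (1 - p) * (p ^ card E * bexp p S f)"
      using insert.prems by (intro mult_left_mono insert.IH[OF E insert.prems(2,3) anti2]) auto
    ultimately show ?thesis
      using insert 1 by (simp add: bexp_insert algebra_simps)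
  qed
qed simp

section \<open>Averages over random lists and their Poissonization\<close>

primrec lexp :: "nat \<Rightarrow> 'a set \<Rightarrow> ('a list \<Rightarrow> real) \<Rightarrow> real" where
  "lexp 0 A f = f []"
| "lexp (Suc m) A f = (\<Sum>x\<in>A. lexp m A (\<lambda>xs. f (x # xs))) / card A"

lemma lexp_cong:
  assumes "\<And>xs. set xs \<subseteq> A \<Longrightarrow> length xs = m \<Longrightarrow> f xs = g xs"
  shows "lexp m A f = lexp m A g"
  using assms
proof (induction m arbitrary: f g)
  case (Suc m)
  have "lexp m A (\<lambda>xs. f (x # xs)) = lexp m A (\<lambda>xs. g (x # xs))" if "x \<in> A" for x
    using that by (intro Suc) auto
  then show ?case by simp
qed simp

lemma lexp_mono:
  assumes "\<And>xs. set xs \<subseteq> A \<Longrightarrow> length xs = m \<Longrightarrow> f xs \<le> g xs"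
  shows "lexp m A f \<le> lexp m A g"
  using assms
proof (induction m arbitrary: f g)
  case (Suc m)
  have "lexp m A (\<lambda>xs. f (x # xs)) \<le> lexp m A (\<lambda>xs. g (x # xs))" if "x \<in> A" for x
    using that by (intro Suc) auto
  then show ?case by (simp add: divide_right_mono sum_mono)
qed simp

lemma lexp_const [simp]:
  assumes "finite A" "A \<noteq> {}"
  shows "lexp m A (\<lambda>_. c) = c"
  using assms by (induction m) auto

lemma lexp_add: "lexp m A (\<lambda>xs. f xs + g xs) = lexp m A f + lexp m A g"
  by (induction m arbitrary: f g) (simp_all add: sum.distrib add_divide_distrib)

lemma lexp_cmult: "lexp m A (\<lambda>xs. c * f xs) = c * lexp m A f"
  by (induction m arbitrary: f) (simp_all add: sum_distrib_left [symmetric])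

lemma lexp_sum: "lexp m A (\<lambda>xs. \<Sum>i\<in>I. f i xs) = (\<Sum>i\<in>I. lexp m A (f i))"
proof (induction m arbitrary: f)
  case (Suc m)
  have "lexp (Suc m) A (\<lambda>xs. \<Sum>i\<in>I. f i xs) = (\<Sum>x\<in>A. \<Sum>i\<in>I. lexp m A (\<lambda>xs. f i (x # xs))) / card A"
    using Suc by simp
  also have "\<dots> = (\<Sum>i\<in>I. \<Sum>x\<in>A. lexp m A (\<lambda>xs. f i (x # xs))) / card A"
    by (subst sum.swap) (rule refl)
  finally show ?case
    by (simp add: sum_divide_distrib)
qed simp

lemma lexp_subset:
  assumes "finite A" "A \<noteq> {}" "B \<subseteq> A"
  shows "lexp m A (\<lambda>xs. if set xs \<subseteq> B then 1 else 0) = (card B / card A) ^ m"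
proof (induction m)
  case (Suc m)
  have "(\<Sum>x\<in>A. lexp m A (\<lambda>xs. if set (x # xs) \<subseteq> B then 1 else 0))
      = (\<Sum>x\<in>A. if x \<in> B then (card B / card A) ^ m else 0)"
  proof (rule sum.cong[OF refl])
    fix x
    show "lexp m A (\<lambda>xs. if set (x # xs) \<subseteq> B then 1 else 0)
        = (if x \<in> B then (card B / card A) ^ m else 0)"
      using Suc assms by (cases "x \<in> B") (simp_all)
  qed
  also have "\<dots> = card B * (card B / card A) ^ m"
    using assms by (simp add: sum.If_cases Int_absorb1)
  finally show ?case by simp
qed simp

text \<open>The bridge from the probability mass function to finite sums; all estimates below are
  made with \<open>lexp\<close> and \<open>bexp\<close>.\<close>

lemma replicate_pmf_expectation:
  assumes "finite A" "A \<noteq> {}"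
  shows "measure_pmf.expectation (replicate_pmf m (pmf_of_set A)) f = lexp m A f"
proof (induction m arbitrary: f)
  case (Suc m)
  have fin: "finite (set_pmf (replicate_pmf k (pmf_of_set A)))" for k
    using assms finite_lists_length_eq[of A k]
    by (simp add: set_replicate_pmf lists_eq_set conj_commute)
  have "measure_pmf.expectation (replicate_pmf (Suc m) (pmf_of_set A)) f
      = measure_pmf.expectation (pmf_of_set A)
          (\<lambda>x. measure_pmf.expectation (map_pmf ((#) x) (replicate_pmf m (pmf_of_set A))) f)"
    using assms fin[of m]
    by (simp add: map_pmf_def[symmetric] pmf_expectation_bind[of "A"] integral_pmf_of_set
        sum_divide_distrib)
  also have "\<dots> = lexp (Suc m) A f"
    using assms Suc by (simp add: integral_pmf_of_set)
  finally show ?case .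
qed simp


lemma sum_power_card_Pow:
  assumes "finite B"
  shows "(\<Sum>C\<in>Pow B. y ^ card C) = (1 + y :: real) ^ card B"
  using assms
proof (induction B rule: finite_induct)
  case (insert e S)
  have disj: "Pow S \<inter> insert e ` Pow S = {}" and inj: "inj_on (insert e) (Pow S)"
    using insert by (auto simp: inj_on_def)
  have "(\<Sum>C\<in>insert e ` Pow S. y ^ card C) = (\<Sum>C\<in>Pow S. y * y ^ card C)"
    unfolding sum.reindex[OF inj] o_def
  proof (intro sum.cong refl)
    fix C assume "C \<in> Pow S"
    then have "finite C" "e \<notin> C" using insert by (auto intro: finite_subset)
    then show "y ^ card (insert e C) = y * y ^ card C" by simp
  qed
  then show ?case
    using insert
    by (simp add: Pow_insert sum.union_disjoint[OF _ _ disj] sum_distrib_left[symmetric] algebra_simps)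
qed simp

text \<open>Exponential generating function of the lists with set \<open>B\<close>. Summed over all
  subsets of \<open>B\<close> it gives \<open>exp (r * card B)\<close>, which
  \<open>sum_power_card_Pow\<close> expands in powers of \<open>exp r - 1\<close>; subtracting the
  proper subsets isolates \<open>B\<close>.\<close>

lemma lexp_set_eq_sums:
  fixes r :: real
  assumes "finite A" "A \<noteq> {}" "B \<subseteq> A"
  shows "(\<lambda>k. (r * card A) ^ k / fact k * lexp k A (\<lambda>xs. if set xs = B then 1 else 0))
           sums ((exp r - 1) ^ card B)"
proof -
  have "finite B" using assms finite_subset by blast
  then show ?thesis using assms(3)
  proof (induction B rule: finite_psubset_induct)
    case (psubset B)
    define t where "t C k = (r * card A) ^ k / fact k * lexp k A (\<lambda>xs. if set xs = C then 1 else 0)"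
      for C k
    have "(\<lambda>k. r ^ k * card B ^ k / fact k) sums exp (r * card B)"
      using exp_converges[of "r * card B"] by (simp add: power_mult_distrib divide_inverse mult_ac)
    also have "(\<lambda>k. r ^ k * card B ^ k / fact k) = (\<lambda>k. \<Sum>C\<in>Pow B. t C k)"
    proof
      fix k
      have "(\<Sum>C\<in>Pow B. t C k)
          = (r * card A) ^ k / fact k * lexp k A (\<lambda>xs. \<Sum>C\<in>Pow B. if set xs = C then 1 else 0)"
        by (simp add: t_def sum_distrib_left lexp_sum)
      also have "(\<lambda>xs. \<Sum>C\<in>Pow B. if set xs = C then 1 else 0)
          = (\<lambda>xs. if set xs \<subseteq> B then 1 else (0::real))"
        using psubset.hyps by (simp add: fun_eq_iff)
      also have "(r * card A) ^ k / fact k * lexp k A (\<lambda>xs. if set xs \<subseteq> B then 1 else 0)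
          = r ^ k * card B ^ k / fact k"
        using assms psubset.prems
        by (simp add: lexp_subset power_mult_distrib power_divide)
      finally show "r ^ k * card B ^ k / fact k = (\<Sum>C\<in>Pow B. t C k)" by simp
    qed
    also have "(\<lambda>k. \<Sum>C\<in>Pow B. t C k) = (\<lambda>k. t B k + (\<Sum>C\<in>Pow B - {B}. t C k))"
      using psubset.hyps by (simp add: sum.remove[of "Pow B" B])
    finally have 1: "(\<lambda>k. t B k + (\<Sum>C\<in>Pow B - {B}. t C k)) sums exp (r * card B)" .
    have 2: "(\<lambda>k. \<Sum>C\<in>Pow B - {B}. t C k) sums (\<Sum>C\<in>Pow B - {B}. (exp r - 1) ^ card C)"
    proof (rule sums_sum)
      fix C assume "C \<in> Pow B - {B}"
      then have "C \<subset> B" "C \<subseteq> A" using psubset.prems by auto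
      then show "t C sums (exp r - 1) ^ card C"
        unfolding t_def by (rule psubset.IH)
    qed
    have "(\<Sum>C\<in>Pow B. (exp r - 1) ^ card C) = exp (r * card B)"
      using psubset.hyps by (simp add: sum_power_card_Pow exp_of_nat_mult[symmetric] mult.commute)
    then have "exp (r * card B) - (\<Sum>C\<in>Pow B - {B}. (exp r - 1) ^ card C) = (exp r - 1) ^ card B"
      using psubset.hyps by (simp add: sum.remove[of "Pow B" B])
    with sums_diff[OF 1 2] show ?case
      by (simp add: t_def)
  qed
qed

text \<open>Poissonization: if the length of the list is Poisson distributed, the elements of the
  alphabet occur independently of each other.\<close>

lemma lexp_poisson_sums:
  fixes r :: real
  assumes "finite A" "A \<noteq> {}"
  shows "(\<lambda>k. exp (- (r * card A)) * (r * card A) ^ k / fact k * lexp k A (\<lambda>xs. f (set xs)))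
           sums bexp (1 - exp (- r)) A f"
proof -
  define t where "t C k = (r * card A) ^ k / fact k * lexp k A (\<lambda>xs. if set xs = C then 1 else 0)"
    for C k
  have "(\<lambda>k. \<Sum>C\<in>Pow A. exp (- (r * card A)) * f C * t C k)
      sums (\<Sum>C\<in>Pow A. exp (- (r * card A)) * f C * (exp r - 1) ^ card C)"
    using lexp_set_eq_sums[OF assms] by (intro sums_sum sums_mult) (auto simp: t_def)
  also have "(\<Sum>C\<in>Pow A. exp (- (r * card A)) * f C * (exp r - 1) ^ card C) = bexp (1 - exp (- r)) A f"
    unfolding bexp_def
  proof (rule sum.cong[OF refl])
    fix C assume C: "C \<in> Pow A"
    then have fin: "finite C" using assms finite_subset by auto
    have "card A = card C + card (A - C)"
      using C assms by (metis Pow_iff card_Diff_subset card_mono fin le_add_diff_inverse)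
    then have "exp (- (r * card A)) = exp (- r) ^ card C * exp (- r) ^ card (A - C)"
      by (simp add: exp_of_nat_mult[symmetric] exp_add[symmetric] algebra_simps)
    moreover have "exp (- r) * (exp r - 1) = 1 - exp (- r)"
      by (simp add: algebra_simps exp_minus)
    ultimately show "exp (- (r * card A)) * f C * (exp r - 1) ^ card C
        = (1 - exp (- r)) ^ card C * (1 - (1 - exp (- r))) ^ card (A - C) * f C"
      by (simp add: power_mult_distrib[symmetric] mult_ac)
  qed
  also have "(\<lambda>k. \<Sum>C\<in>Pow A. exp (- (r * card A)) * f C * t C k)
      = (\<lambda>k. exp (- (r * card A)) * (r * card A) ^ k / fact k * lexp k A (\<lambda>xs. f (set xs)))"
  proof
    fix k
    have "lexp k A (\<lambda>xs. f (set xs)) = lexp k A (\<lambda>xs. \<Sum>C\<in>Pow A. f C * (if set xs = C then 1 else 0))"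
    proof (rule lexp_cong)
      fix xs assume "set xs \<subseteq> A"
      then show "f (set xs) = (\<Sum>C\<in>Pow A. f C * (if set xs = C then 1 else 0))"
        using assms by (simp add: if_distrib[of "\<lambda>x. _ * x"] cong: if_cong)
    qed
    then show "(\<Sum>C\<in>Pow A. exp (- (r * card A)) * f C * t C k)
      = exp (- (r * card A)) * (r * card A) ^ k / fact k * lexp k A (\<lambda>xs. f (set xs))"
      by (simp add: lexp_sum lexp_cmult t_def sum_distrib_left mult.left_commute mult.assoc
          mult.commute[of "f _" "_ ^ k"])
  qed
  finally show ?thesis .
qed

lemma lexp_nonneg:
  assumes "\<And>xs. set xs \<subseteq> A \<Longrightarrow> length xs = m \<Longrightarrow> 0 \<le> f xs"
  shows "0 \<le> lexp m A f"
  using assms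
proof (induction m arbitrary: f)
  case (Suc m)
  have "0 \<le> lexp m A (\<lambda>xs. f (x # xs))" if "x \<in> A" for x
    using that by (intro Suc) auto
  then show ?case by (simp add: sum_nonneg)
qed simp

text \<open>A weak Stirling bound: a Poisson variable of mean \<open>m\<close> takes the value
  \<open>m\<close> with probability at least \<open>1 / (exp 1 * m)\<close>.\<close>

lemma fact_exp_le: "m \<ge> 1 \<Longrightarrow> fact m * exp (real m) \<le> exp 1 * m * m ^ m"
proof (induction m rule: dec_induct)
  case (step m)
  have m: "real m > 0" using step by simp
  have "ln (m / (m + 1)) \<le> m / (m + 1) - 1"
    using m by (intro ln_le_minus_one) simp
  then have "1 / (m + 1) \<le> ln ((m + 1) / m)"
    using m by (simp add: ln_div field_simps)
  then have "1 \<le> (m + 1) * ln ((m + 1) / m)"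
    using m by (simp add: field_simps)
  then have "exp 1 \<le> exp ((m + 1) * ln ((m + 1) / m))" by simp
  also have "\<dots> = ((m + 1) / m) ^ (m + 1)"
    using m by (simp add: exp_of_nat_mult[of "m + 1", simplified])
  finally have e: "exp 1 * m ^ (m + 1) \<le> (m + 1) ^ (m + 1)"
    using m by (simp add: power_divide field_simps)
  have "fact (Suc m) * exp (real (Suc m)) = (m + 1) * exp 1 * (fact m * exp (real m))"
    by (simp add: exp_add)
  also have "\<dots> \<le> (m + 1) * exp 1 * (exp 1 * m * m ^ m)"
    using step.IH by (intro mult_left_mono) auto
  also have "\<dots> = (m + 1) * exp 1 * (exp 1 * m ^ (m + 1))" by simp
  also have "\<dots> \<le> (m + 1) * exp 1 * (m + 1) ^ (m + 1)"
    using e by (intro mult_left_mono) auto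
  also have "\<dots> = exp 1 * Suc m * real (Suc m) ^ Suc m" by (simp add: algebra_simps)
  finally show ?case by simp
qed simp

text \<open>Of the Poisson mixture with mean \<open>m\<close> only the term for lists of length
  \<open>m\<close> is kept. The loss of order \<open>m\<close> is harmless where the right-hand side
  is exponentially small.\<close>

lemma lexp_le_bexp:
  assumes "finite A" "A \<noteq> {}" "m \<ge> 1" "\<And>B. B \<subseteq> A \<Longrightarrow> 0 \<le> f B"
  shows "lexp m A (\<lambda>xs. f (set xs)) \<le> exp 1 * m * bexp (1 - exp (- (m / card A))) A f"
proof -
  define r where "r = m / card A"
  have rN: "r * card A = m" using assms by (simp add: r_def)
  define t where "t k = exp (- (r * card A)) * (r * card A) ^ k / fact k * lexp k A (\<lambda>xs. f (set xs))"
    for k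
  have sums: "t sums bexp (1 - exp (- r)) A f"
    unfolding t_def by (rule lexp_poisson_sums[OF assms(1,2), of r f])
  have pos: "0 \<le> t k" for k
    unfolding t_def rN using assms by (intro mult_nonneg_nonneg divide_nonneg_nonneg lexp_nonneg) auto
  have "t m \<le> bexp (1 - exp (- r)) A f"
    using sum_le_suminf[of t "{m}"] sums pos by (auto simp: sums_iff)
  then have "exp 1 * m * t m \<le> exp 1 * m * bexp (1 - exp (- r)) A f"
    by (intro mult_left_mono) auto
  moreover have "lexp m A (\<lambda>xs. f (set xs)) \<le> exp 1 * m * t m"
  proof -
    have "1 \<le> exp 1 * m * (exp (- real m) * m ^ m / fact m)"
      using fact_exp_le[OF assms(3)] by (simp add: exp_minus field_simps)
    then have "1 * lexp m A (\<lambda>xs. f (set xs))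
        \<le> (exp 1 * m * (exp (- real m) * m ^ m / fact m)) * lexp m A (\<lambda>xs. f (set xs))"
      using assms by (intro mult_right_mono lexp_nonneg) auto
    then show ?thesis by (simp add: t_def rN mult_ac)
  qed
  ultimately have "lexp m A (\<lambda>xs. f (set xs)) \<le> exp 1 * m * bexp (1 - exp (- r)) A f"
    by linarith
  then show ?thesis by (simp add: r_def)
qed

lemma lexp_set_mono:
  assumes "finite A" "A \<noteq> {}" "i \<le> k"
    and mono: "\<And>B C. B \<subseteq> C \<Longrightarrow> C \<subseteq> A \<Longrightarrow> f B \<le> f C"
  shows "lexp i A (\<lambda>xs. f (set xs)) \<le> lexp k A (\<lambda>xs. f (set xs))"
  using assms(3)
proof (induction k rule: dec_induct)
  case (step k)
  have "lexp k A (\<lambda>xs. f (set xs)) \<le> lexp k A (\<lambda>xs. f (insert x (set xs)))" if "x \<in> A" for x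
    using that by (intro lexp_mono mono) auto
  then have "(\<Sum>x\<in>A. lexp k A (\<lambda>xs. f (set xs))) \<le> (\<Sum>x\<in>A. lexp k A (\<lambda>xs. f (insert x (set xs))))"
    by (rule sum_mono)
  then have "lexp k A (\<lambda>xs. f (set xs)) \<le> lexp (Suc k) A (\<lambda>xs. f (set xs))"
    using assms by (simp add: field_simps card_gt_0_iff)
  with step.IH show ?case by simp
qed simp

text \<open>Monotone counterpart without a polynomial loss: by Chernoff, a Poisson number of mean
  \<open>l\<close> is at least \<open>i\<close> except with probability at most
  \<open>exp (l * (z - 1)) / z ^ i\<close>, and longer lists only increase \<open>f\<close>.\<close>

lemma lexp_le_bexp_mono:
  fixes l z :: real
  assumes "finite A" "A \<noteq> {}" "0 \<le> l" "0 < z" "z \<le> 1" "\<And>B. B \<subseteq> A \<Longrightarrow> 0 \<le> f B"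
    and mono: "\<And>B C. B \<subseteq> C \<Longrightarrow> C \<subseteq> A \<Longrightarrow> f B \<le> f C"
  shows "lexp i A (\<lambda>xs. f (set xs)) * (1 - exp (l * (z - 1)) / z ^ i)
           \<le> bexp (1 - exp (- (l / card A))) A f"
proof -
  define r where "r = l / card A"
  have rN: "r * card A = l" using assms by (simp add: r_def)
  define L where "L k = lexp k A (\<lambda>xs. f (set xs))" for k
  define w where "w k = exp (- l) * l ^ k / fact k" for k
  have L0: "0 \<le> L k" for k
    unfolding L_def using assms by (intro lexp_nonneg) auto
  have w0: "0 \<le> w k" for k
    unfolding w_def using assms by simp
  have sums: "(\<lambda>k. w k * L k) sums bexp (1 - exp (- r)) A f"
    using lexp_poisson_sums[OF assms(1,2), of r f] unfolding rN w_def L_def .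
  have S1: "(\<lambda>k. L i * (exp (- l) * (l ^ k / fact k) - exp (- l) / z ^ i * ((l * z) ^ k / fact k)))
      sums (L i * (exp (- l) * exp l - exp (- l) / z ^ i * exp (l * z)))"
    using exp_converges[of l] exp_converges[of "l * z"]
    by (intro sums_mult sums_diff) (simp_all add: divide_inverse mult.commute[of "inverse _"])
  \<comment> \<open>The factor \<open>1 - z ^ k / z ^ i\<close> minorizes the indicator of
    \<open>i \<le> k\<close>, which turns the Chernoff bound into a termwise comparison of
    series.\<close>
  have S2: "L i * (exp (- l) * (l ^ k / fact k) - exp (- l) / z ^ i * ((l * z) ^ k / fact k)) \<le> w k * L k" for k
  proof -
    have eq: "exp (- l) * (l ^ k / fact k) - exp (- l) / z ^ i * ((l * z) ^ k / fact k)
        = w k * (1 - z ^ k / z ^ i)"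
    proof -
      have "a * (b / c) - a / d * (b * e / c) = a * b / c * (1 - e / d)" for a b c d e :: real
        by (cases "c = 0"; cases "d = 0") (simp_all add: field_simps)
      then show ?thesis unfolding w_def power_mult_distrib by this
    qed
    show ?thesis
    proof (cases "i \<le> k")
      case True
      have "L i * (w k * (1 - z ^ k / z ^ i)) \<le> L i * (w k * 1)"
        using L0 w0 assms by (intro mult_left_mono) auto
      also have "\<dots> \<le> L k * (w k * 1)"
        using w0 lexp_set_mono[OF assms(1,2) True mono]
        by (intro mult_right_mono) (auto simp: L_def)
      finally show ?thesis unfolding eq by (simp add: mult.commute)
    next
      case False
      then have "z ^ i \<le> z ^ k" using assms by (intro power_decreasing) auto
      then have "1 - z ^ k / z ^ i \<le> 0" using assms by simp
      then have "L i * (w k * (1 - z ^ k / z ^ i)) \<le> 0"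
        using L0 w0 by (intro mult_nonneg_nonpos) auto
      also have "0 \<le> w k * L k" using L0 w0 by simp
      finally show ?thesis unfolding eq .
    qed
  qed
  have "L i * (exp (- l) * exp l - exp (- l) / z ^ i * exp (l * z)) \<le> bexp (1 - exp (- r)) A f"
    by (rule sums_le[OF S2 S1 sums])
  also have "exp (- l) * exp l - exp (- l) / z ^ i * exp (l * z) = 1 - exp (l * (z - 1)) / z ^ i"
  proof -
    have "exp (- l) * exp l = 1" "exp (l * (z - 1)) = exp (- l) * exp (l * z)"
      by (simp_all add: exp_add[symmetric] right_diff_distrib)
    then show ?thesis by simp
  qed
  finally show ?thesis by (simp add: L_def r_def)
qed

section \<open>Unit propagation\<close>

text \<open>Arbitrary variable sets are needed because unit propagation recurses on
  \<open>V - {i}\<close>.\<close>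

definition clauses_on :: "nat set \<Rightarrow> clause set" where
  "clauses_on V = {{(i, b), (j, c)} | i j b c. i \<in> V \<and> j \<in> V \<and> i \<noteq> j}"

lemma proper_clauses_eq: "proper_clauses n = clauses_on {1..n}"
  by (simp add: proper_clauses_def clauses_on_def)

lemma finite_clauses_on [simp]: "finite V \<Longrightarrow> finite (clauses_on V)"
  by (rule finite_subset[of _ "Pow (V \<times> UNIV)"]) (auto simp: clauses_on_def)

lemma clauses_on_mono: "U \<subseteq> V \<Longrightarrow> clauses_on U \<subseteq> clauses_on V"
  by (auto simp: clauses_on_def)

lemma clauses_onI: "x \<in> V \<times> UNIV \<Longrightarrow> y \<in> V \<times> UNIV \<Longrightarrow> fst x \<noteq> fst y \<Longrightarrow> {x, y} \<in> clauses_on V"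
  unfolding clauses_on_def by (cases x; cases y) auto

text \<open>Distinct clauses are counted, so the value depends only on the set of clauses and
  Poissonization applies. Repetitions can only add violations, which is the safe direction for the
  upper bound.\<close>

definition viol :: "(nat \<Rightarrow> bool) \<Rightarrow> clause set \<Rightarrow> nat" where
  "viol \<sigma> B = card {C \<in> B. \<not> satisfies \<sigma> C}"

lemma viol_mono: "A \<subseteq> B \<Longrightarrow> finite B \<Longrightarrow> viol \<sigma> A \<le> viol \<sigma> B"
  unfolding viol_def by (intro card_mono) auto

lemma viol_union:
  assumes "finite A" "finite B" "A \<inter> B = {}"
  shows "viol \<sigma> (A \<union> B) = viol \<sigma> A + viol \<sigma> B"
proof -
  have "{C \<in> A \<union> B. \<not> satisfies \<sigma> C} = {C \<in> A. \<not> satisfies \<sigma> C} \<union> {C \<in> B. \<not> satisfies \<sigma> C}"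
    by auto
  then show ?thesis
    unfolding viol_def using assms by (simp, subst card_Un_disjoint) auto
qed

definition ext :: "nat set \<Rightarrow> (nat \<Rightarrow> bool) \<Rightarrow> (nat \<Rightarrow> bool) set" where
  "ext D \<tau> = {\<sigma>. \<forall>i\<in>D. \<sigma> i = \<tau> i}"

text \<open>Penalizing each violated clause by a factor \<open>w\<close> instead of forbidding violations replaces
  the union bound over the set of violated clauses.\<close>

definition best :: "real \<Rightarrow> nat set \<Rightarrow> (nat \<Rightarrow> bool) \<Rightarrow> clause set \<Rightarrow> real" where
  "best w D \<tau> B = Max ((\<lambda>\<sigma>. w ^ viol \<sigma> B) ` ext D \<tau>)"

lemma ext_self [simp]: "\<tau> \<in> ext D \<tau>"
  by (simp add: ext_def)

lemma finite_best_range: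
  assumes "finite B"
  shows "finite ((\<lambda>\<sigma>. (w::real) ^ viol \<sigma> B) ` ext D \<tau>)"
proof (rule finite_subset)
  show "(\<lambda>\<sigma>. w ^ viol \<sigma> B) ` ext D \<tau> \<subseteq> (\<lambda>k. w ^ k) ` {..card B}"
    using assms by (auto simp: viol_def intro!: imageI card_mono)
qed simp

lemma best_ge: "finite B \<Longrightarrow> \<sigma> \<in> ext D \<tau> \<Longrightarrow> w ^ viol \<sigma> B \<le> best w D \<tau> B"
  unfolding best_def by (intro Max_ge finite_best_range) auto

lemma best_le_iff:
  assumes "finite B"
  shows "best w D \<tau> B \<le> c \<longleftrightarrow> (\<forall>\<sigma>\<in>ext D \<tau>. w ^ viol \<sigma> B \<le> c)"
  unfolding best_def using assms
  by (subst Max_le_iff) (auto intro: finite_best_range ext_self)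

lemma best_nonneg: "finite B \<Longrightarrow> 0 \<le> w \<Longrightarrow> 0 \<le> best w D \<tau> B"
  using best_ge[of B \<tau> D \<tau> w] by (meson ext_self order_trans zero_le_power)

lemma best_le_1: "finite B \<Longrightarrow> 0 \<le> w \<Longrightarrow> w \<le> 1 \<Longrightarrow> best w D \<tau> B \<le> 1"
  by (simp add: best_le_iff power_le_one)

lemma best_antimono:
  assumes "A \<subseteq> B" "finite B" "0 \<le> w" "w \<le> 1"
  shows "best w D \<tau> B \<le> best w D \<tau> A"
proof -
  have fA: "finite A" using assms finite_subset by blast
  have "w ^ viol \<sigma> B \<le> best w D \<tau> A" if "\<sigma> \<in> ext D \<tau>" for \<sigma>
    using best_ge[OF fA that, of w] power_decreasing[OF viol_mono[OF assms(1,2)] assms(3,4), of \<sigma>]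
    by linarith
  then show ?thesis using assms by (simp add: best_le_iff)
qed

text \<open>One step of unit propagation: setting the literal of \<open>i\<close> to true reduces the clauses that contain
  its negation to unit clauses. Among the unit clauses \<open>N\<close> on unassigned variables, those in \<open>J\<close>
  are obeyed and the others violated.\<close>

lemma best_step:
  fixes D V :: "nat set" and \<tau> :: "nat \<Rightarrow> bool" and i :: nat
  defines "e \<equiv> (\<lambda>x. {(i, \<not> \<tau> i), x} :: clause)"
  defines "X \<equiv> (V - D) \<times> (UNIV :: bool set)"
  defines "Y \<equiv> (\<lambda>j. (j, \<not> \<tau> j)) ` (D - {i})"
  assumes "finite V" "D \<subseteq> V" "i \<in> D" "0 \<le> w" "w \<le> 1"
    and A: "A \<subseteq> clauses_on (V - {i})" and N: "N \<subseteq> X" and P: "P \<subseteq> Y" and R: "finite R"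
  shows "best w D \<tau> (A \<union> (e ` N \<union> (e ` P \<union> R)))
    \<le> w ^ card P * (\<Sum>J | J \<subseteq> N \<and> inj_on fst J. w ^ card (N - J) *
         best w (D - {i} \<union> fst ` J) (\<lambda>j. if j \<in> D then \<tau> j else (j, True) \<in> J) A)"
proof -
  have fin: "finite A" "finite N" "finite P" "finite D"
  proof -
    show "finite D" using assms(4,5) finite_subset by blast
    then have "finite X" "finite Y" "finite (clauses_on (V - {i}))"
      using \<open>finite V\<close> by (simp_all add: X_def Y_def)
    then show "finite A" "finite N" "finite P"
      using A N P by (blast intro: finite_subset)+
  qed
  have inj_e: "inj_on e (X \<union> Y)"
    using \<open>i \<in> D\<close> unfolding e_def X_def Y_def by (auto simp: inj_on_def doubleton_eq_iff)
  have disj1: "A \<inter> (e ` N \<union> e ` P) = {}"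
  proof -
    have "(i, \<not> \<tau> i) \<notin> C" if "C \<in> A" for C
      using that A by (auto simp: clauses_on_def)
    then show ?thesis by (auto simp: e_def)
  qed
  have disj2: "e ` N \<inter> e ` P = {}"
  proof -
    have "N \<inter> P = {}" using N P by (auto simp: X_def Y_def)
    moreover have "e ` N \<inter> e ` P = e ` (N \<inter> P)"
      using inj_e N P by (intro inj_on_image_Int[symmetric, of e "X \<union> Y"]) auto
    ultimately show ?thesis by simp
  qed
  show ?thesis
    unfolding best_le_iff[OF finite_UnI[OF fin(1) finite_UnI[OF finite_imageI[OF fin(2)]
        finite_UnI[OF finite_imageI[OF fin(3)] R]]]]
  proof
    fix \<sigma> assume \<sigma>: "\<sigma> \<in> ext D \<tau>"
    \<comment> \<open>The obeyed unit clauses. Opposite literals cannot both hold, whence the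
      injectivity of \<open>fst\<close> on \<open>J\<close>.\<close>
    define J where "J = {x \<in> N. \<sigma> (fst x) = snd x}"
    have J: "J \<subseteq> N" by (simp add: J_def)
    have inj_J: "inj_on fst J"
      by (rule inj_onI) (simp add: J_def prod_eq_iff)
    have vN: "viol \<sigma> (e ` N) = card (N - J)"
    proof -
      have "{C \<in> e ` N. \<not> satisfies \<sigma> C} = e ` (N - J)"
      proof -
        have "satisfies \<sigma> (e x) \<longleftrightarrow> \<sigma> (fst x) = snd x" for x
          using \<sigma> \<open>i \<in> D\<close> by (cases x) (simp add: e_def satisfies_def ext_def)
        then show ?thesis by (auto simp: J_def)
      qed
      moreover have "inj_on e (N - J)" using inj_e N by (auto intro: inj_on_subset)
      ultimately show ?thesis by (simp add: viol_def card_image)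
    qed
    have vP: "viol \<sigma> (e ` P) = card P"
    proof -
      have "{C \<in> e ` P. \<not> satisfies \<sigma> C} = e ` P"
      proof -
        have "\<not> satisfies \<sigma> (e x)" if "x \<in> P" for x
          using \<sigma> \<open>i \<in> D\<close> that P by (cases x) (auto simp: e_def Y_def satisfies_def ext_def)
        then show ?thesis by auto
      qed
      moreover have "inj_on e P" using inj_e P by (auto intro: inj_on_subset)
      ultimately show ?thesis by (simp add: viol_def card_image)
    qed
    have "viol \<sigma> A + (card (N - J) + card P) = viol \<sigma> (A \<union> (e ` N \<union> e ` P))"
      using fin disj1 disj2 vN vP by (simp add: viol_union Int_Un_distrib)
    also have "\<dots> \<le> viol \<sigma> (A \<union> (e ` N \<union> (e ` P \<union> R)))"
      using fin R by (intro viol_mono) auto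
    finally have "w ^ viol \<sigma> (A \<union> (e ` N \<union> (e ` P \<union> R))) \<le> w ^ (viol \<sigma> A + (card (N - J) + card P))"
      using assms(7,8) by (intro power_decreasing)
    also have "\<dots> = w ^ card P * (w ^ card (N - J) * w ^ viol \<sigma> A)"
      by (simp add: power_add)
    also have "\<dots> \<le> w ^ card P * (w ^ card (N - J) *
         best w (D - {i} \<union> fst ` J) (\<lambda>j. if j \<in> D then \<tau> j else (j, True) \<in> J) A)"
    proof (intro mult_left_mono best_ge fin)
      have "fst x \<notin> D" if "x \<in> J" for x
        using that N by (auto simp: J_def X_def)
      then show "\<sigma> \<in> ext (D - {i} \<union> fst ` J) (\<lambda>j. if j \<in> D then \<tau> j else (j, True) \<in> J)"
        using \<sigma> by (auto simp: ext_def J_def)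
    qed (use \<open>0 \<le> w\<close> in auto)
    also have "\<dots> \<le> w ^ card P * (\<Sum>J | J \<subseteq> N \<and> inj_on fst J. w ^ card (N - J) *
         best w (D - {i} \<union> fst ` J) (\<lambda>j. if j \<in> D then \<tau> j else (j, True) \<in> J) A)"
      using fin assms(7,8) J inj_J
      by (intro mult_left_mono member_le_sum[of J _ "\<lambda>J. w ^ card (N - J) * best w (D - {i} \<union> fst ` J) (\<lambda>j. if j \<in> D then \<tau> j else (j, True) \<in> J) A"])
         (auto intro!: mult_nonneg_nonneg best_nonneg)
    finally show "w ^ viol \<sigma> (A \<union> (e ` N \<union> (e ` P \<union> R))) \<le> \<dots>" .
  qed
qed

lemma sum_Pow_power:
  fixes w z :: real
  assumes "finite N"
  shows "(\<Sum>J\<in>Pow N. w ^ card (N - J) * z ^ card J) = (w + z) ^ card N"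
  using prod_add[OF assms, of "\<lambda>_. z" "\<lambda>_. w"] by (simp add: mult.commute add.commute)

text \<open>The clauses of variable \<open>i\<close> are grouped by their status under \<tau>:
  \<open>X\<close> yields unit clauses on unassigned variables, \<open>Y\<close> yields violated
  clauses between queued variables, and \<open>R\<close> collects the satisfied ones. The groups are
  disjoint, so \<open>bexp\<close> can be taken over one after the other.\<close>

lemma clauses_on_split:
  fixes D V :: "nat set" and \<tau> :: "nat \<Rightarrow> bool" and i :: nat
  defines "e \<equiv> (\<lambda>x. {(i, \<not> \<tau> i), x} :: clause)"
  defines "X \<equiv> (V - D) \<times> (UNIV :: bool set)"
  defines "Y \<equiv> (\<lambda>j. (j, \<not> \<tau> j)) ` (D - {i})"
  assumes "D \<subseteq> V" "i \<in> D"
  obtains R where "clauses_on V = e ` X \<union> (e ` Y \<union> (R \<union> clauses_on (V - {i})))"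
    "e ` X \<inter> (e ` Y \<union> (R \<union> clauses_on (V - {i}))) = {}"
    "e ` Y \<inter> (R \<union> clauses_on (V - {i})) = {}" "R \<inter> clauses_on (V - {i}) = {}"
    "inj_on e X" "inj_on e Y"
proof -
  define R where "R = clauses_on V - (e ` X \<union> e ` Y \<union> clauses_on (V - {i}))"
  have inj: "inj_on e (X \<union> Y)"
    using \<open>i \<in> D\<close> unfolding e_def X_def Y_def by (auto simp: inj_on_def doubleton_eq_iff)
  have "(i, b) \<notin> C" if "C \<in> clauses_on (V - {i})" for b C
    using that by (auto simp: clauses_on_def)
  then have d: "e x \<notin> clauses_on (V - {i})" for x
    unfolding e_def by blast
  have eX: "e ` X \<subseteq> clauses_on V"
    using assms(4,5) by (auto simp: e_def X_def intro!: clauses_onI)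
  have eY: "e ` Y \<subseteq> clauses_on V"
    using assms(4,5) by (auto simp: e_def Y_def intro!: clauses_onI)
  have "clauses_on V = e ` X \<union> (e ` Y \<union> (R \<union> clauses_on (V - {i})))"
    using eX eY clauses_on_mono[of "V - {i}" V] by (auto simp: R_def)
  moreover have "e ` X \<inter> e ` Y = {}"
  proof -
    have "X \<inter> Y = {}" by (auto simp: X_def Y_def)
    moreover have "e ` X \<inter> e ` Y = e ` (X \<inter> Y)"
      using inj by (intro inj_on_image_Int[symmetric, of e "X \<union> Y"]) auto
    ultimately show ?thesis by simp
  qed
  ultimately show ?thesis
    using d inj by (intro that[of R]) (auto simp: R_def inj_on_Un)
qed

text \<open>\<open>D\<close> is the queue of the exploration. The first summand bounds the probability that
  its length ever falls below a barrier that rises by \<open>\<rho>\<close> per step. Above the barrier, each step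
  meets clauses that contradict queued literals, which gives the second summand.\<close>

lemma exploration_bound:
  fixes p w \<theta> \<rho> \<kappa> n1 n2 :: real and T0 :: nat
  assumes p: "0 \<le> p" "p \<le> 1" and w: "0 \<le> w" "w \<le> 1" and "0 \<le> \<theta>" "0 \<le> \<rho>" "0 \<le> \<kappa>"
    and \<kappa>: "\<kappa> = 1 - w - exp (- \<theta>)" and \<kappa>w: "2 * \<kappa> \<le> 1 - w"
    and drift: "\<theta> * (1 + \<rho>) \<le> 2 * p * n1 * \<kappa>"
  shows "T \<le> T0 \<Longrightarrow> finite V \<Longrightarrow> D \<subseteq> V \<Longrightarrow> n1 + T \<le> card V \<Longrightarrow> card V \<le> n2 \<Longrightarrow>
    bexp p (clauses_on V) (best w D \<tau>)
      \<le> exp (- \<theta> * (card D - (1 + \<rho> * (real T0 - real T))))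
        + exp (\<Sum>j<T. 2 * p * w * n2 - p * (1 - w) * \<rho> * (real T0 - real (Suc j)))"
proof (induction T arbitrary: V D \<tau>)
  case 0
  \<comment> \<open>With no steps left the sum in the exponent is empty and the second summand is 1,
    so the trivial bound 1 on \<open>best\<close> suffices.\<close>
  then have "bexp p (clauses_on V) (best w D \<tau>) \<le> bexp p (clauses_on V) (\<lambda>_. 1)"
    using p w by (intro bexp_mono best_le_1) (auto intro: finite_subset)
  also have "\<dots> \<le> 0 + 1" using 0 by simp
  also have "\<dots> \<le> exp (- \<theta> * (card D - (1 + \<rho> * (real T0 - real 0)))) + 1"
    by (intro add_right_mono) simp
  finally show ?case by simp
next
  case (Suc T)
  define b where "b = 1 + \<rho> * (real T0 - real (Suc T))"
  define b' where "b' = 1 + \<rho> * (real T0 - real T)"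
  define E where "E T = exp (\<Sum>j<T. 2 * p * w * n2 - p * (1 - w) * \<rho> * (real T0 - real (Suc j)))" for T
  have bb: "b' = b + \<rho>" by (simp add: b_def b'_def algebra_simps)
  have b1: "1 \<le> b" using Suc.prems \<open>0 \<le> \<rho>\<close> by (simp add: b_def)
  have finD: "finite D" using Suc.prems finite_subset by blast
  show ?case
  \<comment> \<open>At or below the barrier the first summand is at least 1. Above it the queue is
    nonempty because \<open>b\<close> is at least 1, and a step can be made.\<close>
  proof (cases "card D \<le> b")
    case True
    have "bexp p (clauses_on V) (best w D \<tau>) \<le> bexp p (clauses_on V) (\<lambda>_. 1)"
      using p w Suc.prems by (intro bexp_mono best_le_1) (auto intro: finite_subset)
    also have "\<dots> \<le> 1" using Suc.prems by simp
    also have "0 \<le> \<theta> * (b - card D)"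
      using True \<open>0 \<le> \<theta>\<close> by (intro mult_nonneg_nonneg) auto
    then have "1 \<le> exp (- \<theta> * (card D - b))"
      by (simp add: algebra_simps)
    also have "\<dots> \<le> exp (- \<theta> * (card D - b)) + E (Suc T)"
      by (simp add: E_def)
    finally show ?thesis by (simp add: b_def E_def)
  next
    case False
    define q where "q = card D"
    have q: "b < q" "q \<ge> 1" using False b1 by (auto simp: q_def)
    then obtain i where i: "i \<in> D" by (metis q_def card.empty not_one_le_zero ex_in_conv)
    define e where "e = (\<lambda>x. {(i, \<not> \<tau> i), x} :: clause)"
    define X where "X = (V - D) \<times> (UNIV :: bool set)"
    define Y where "Y = (\<lambda>j. (j, \<not> \<tau> j)) ` (D - {i})"
    obtain R where R: "clauses_on V = e ` X \<union> (e ` Y \<union> (R \<union> clauses_on (V - {i})))"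
      "e ` X \<inter> (e ` Y \<union> (R \<union> clauses_on (V - {i}))) = {}"
      "e ` Y \<inter> (R \<union> clauses_on (V - {i})) = {}" "R \<inter> clauses_on (V - {i}) = {}"
      "inj_on e X" "inj_on e Y"
      using clauses_on_split[of D V i \<tau>] Suc.prems i unfolding e_def X_def Y_def by blast
    have fin: "finite X" "finite Y" "finite R" "finite (clauses_on (V - {i}))"
    proof -
      show "finite X" "finite Y" "finite (clauses_on (V - {i}))"
        using finD Suc.prems by (simp_all add: X_def Y_def)
      have "R \<subseteq> clauses_on V" using R(1) by blast
      then show "finite R" using Suc.prems finite_clauses_on finite_subset by blast
    qed
    have cX: "card X = 2 * (card V - q)"
      using Suc.prems finD by (simp add: X_def q_def card_cartesian_product card_Diff_subset)
    have cY: "card Y = q - 1"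
      using i finD unfolding Y_def q_def by (subst card_image) (auto simp: inj_on_def)
    \<comment> \<open>The first summand of the induction hypothesis for a queue that merely loses
      \<open>i\<close>; every literal newly queued multiplies it by \<open>z\<close>.\<close>
    define a where "a = exp (- \<theta> * (q - 1 - b'))"
    define z where "z = exp (- \<theta>)"
    have step: "bexp p (clauses_on (V - {i})) (\<lambda>A. best w D \<tau> (e ` N \<union> (e ` P \<union> (R' \<union> A))))
        \<le> w ^ card P * (a * (w + z) ^ card N + E T * (w + 1) ^ card N)"
      if "N \<subseteq> X" "P \<subseteq> Y" "R' \<subseteq> R" for N P R'
    proof -
      have finN: "finite N" using that fin finite_subset by blast
      define DJ where "DJ J = D - {i} \<union> fst ` J" for J :: "(nat \<times> bool) set"
      define \<tau>J where "\<tau>J J = (\<lambda>j. if j \<in> D then \<tau> j else (j, True) \<in> J)" for J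
      let ?JJ = "{J. J \<subseteq> N \<and> inj_on fst J}"
      have "bexp p (clauses_on (V - {i})) (\<lambda>A. best w D \<tau> (e ` N \<union> (e ` P \<union> (R' \<union> A))))
        \<le> bexp p (clauses_on (V - {i})) (\<lambda>A. w ^ card P * (\<Sum>J\<in>?JJ. w ^ card (N - J) *
             best w (DJ J) (\<tau>J J) A))"
      proof (intro bexp_mono p)
        fix A assume A: "A \<subseteq> clauses_on (V - {i})"
        have "e ` N \<union> (e ` P \<union> (R' \<union> A)) = A \<union> (e ` N \<union> (e ` P \<union> R'))" by auto
        then show "best w D \<tau> (e ` N \<union> (e ` P \<union> (R' \<union> A))) \<le> w ^ card P *
            (\<Sum>J\<in>?JJ. w ^ card (N - J) * best w (DJ J) (\<tau>J J) A)"
          using best_step[where V = V and D = D and i = i and w = w and A = A and \<tau> = \<tau>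
              and N = N and P = P and R = R'] Suc.prems(2,3) i w A that finite_subset[OF that(3) fin(3)]
          unfolding e_def X_def Y_def DJ_def \<tau>J_def by simp
      qed
      also have "\<dots> = w ^ card P * (\<Sum>J\<in>?JJ. w ^ card (N - J) *
             bexp p (clauses_on (V - {i})) (best w (DJ J) (\<tau>J J)))"
        by (simp add: bexp_cmult bexp_sum)
      also have "\<dots> \<le> w ^ card P * (\<Sum>J\<in>?JJ. w ^ card (N - J) * (a * z ^ card J + E T))"
      proof (intro mult_left_mono sum_mono)
        fix J assume J: "J \<in> ?JJ"
        then have JN: "J \<subseteq> N" "finite J" using finN finite_subset by auto
        have fJ: "fst ` J \<subseteq> V - D" using JN that by (auto simp: X_def)
        have "card (DJ J) = card (D - {i}) + card (fst ` J)"
          unfolding DJ_def using fJ finD JN by (intro card_Un_disjoint) auto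
        also have "\<dots> = q - 1 + card J"
          using J i by (simp add: card_image q_def)
        finally have cD: "real (card (DJ J)) = real q - 1 + card J" using q by simp
        have "bexp p (clauses_on (V - {i})) (best w (DJ J) (\<tau>J J))
            \<le> exp (- \<theta> * (card (DJ J) - (1 + \<rho> * (real T0 - real T)))) + E T"
          unfolding E_def
        proof (rule Suc.IH)
          show "DJ J \<subseteq> V - {i}" using fJ Suc.prems i by (auto simp: DJ_def)
          have "i \<in> V" using i Suc.prems by auto
          then have "card V = Suc (card (V - {i}))"
            using Suc.prems by (intro card.remove)
          then have "real (card (V - {i})) = real (card V) - 1" by (metis add_diff_cancel_left' of_nat_Suc)
          then show "n1 + T \<le> card (V - {i})" "card (V - {i}) \<le> n2" using Suc.prems by auto
        qed (use Suc.prems in auto)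
        also have "exp (- \<theta> * (card (DJ J) - (1 + \<rho> * (real T0 - real T)))) = a * z ^ card J"
          unfolding cD b'_def[symmetric] a_def z_def exp_of_nat_mult[symmetric] exp_add[symmetric]
          using q by (simp add: algebra_simps of_nat_diff)
        finally show "bexp p (clauses_on (V - {i})) (best w (DJ J) (\<tau>J J)) \<le> a * z ^ card J + E T" .
      qed (use w in auto)
      \<comment> \<open>Dropping the injectivity condition adds nonnegative terms and leaves a
        binomial sum that factorizes over \<open>N\<close>.\<close>
      also have "\<dots> \<le> w ^ card P * (\<Sum>J\<in>Pow N. w ^ card (N - J) * (a * z ^ card J + E T))"
        using w finN by (intro mult_left_mono sum_mono2)
          (auto simp: a_def z_def E_def intro!: mult_nonneg_nonneg add_nonneg_nonneg)
      also have "(\<Sum>J\<in>Pow N. w ^ card (N - J) * (a * z ^ card J + E T))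
          = a * (\<Sum>J\<in>Pow N. w ^ card (N - J) * z ^ card J) + E T * (\<Sum>J\<in>Pow N. w ^ card (N - J) * 1 ^ card J)"
        by (simp add: sum_distrib_left sum.distrib[symmetric] algebra_simps)
      also have "\<dots> = a * (w + z) ^ card N + E T * (w + 1) ^ card N"
        using finN by (simp only: sum_Pow_power)
      finally show ?thesis .
    qed
    have "bexp p (clauses_on V) (best w D \<tau>)
        = bexp p X (\<lambda>N. bexp p Y (\<lambda>P. bexp p R (\<lambda>R'. bexp p (clauses_on (V - {i}))
            (\<lambda>A. best w D \<tau> (e ` N \<union> (e ` P \<union> (R' \<union> A)))))))"
      unfolding R(1) using fin R
      by (simp add: bexp_union bexp_image)
    also have "\<dots> \<le> bexp p X (\<lambda>N. bexp p Y (\<lambda>P. bexp p R (\<lambda>R'.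
        w ^ card P * (a * (w + z) ^ card N + E T * (w + 1) ^ card N))))"
      using p by (intro bexp_mono step) auto
    also have "\<dots> = bexp p Y (\<lambda>P. w ^ card P) *
        (a * bexp p X (\<lambda>N. (w + z) ^ card N) + E T * bexp p X (\<lambda>N. (w + 1) ^ card N))"
      using fin by (simp add: bexp_cmult bexp_cmult_right bexp_add)
    also have "\<dots> = (1 - p + p * w) ^ (q - 1) *
        (a * (1 - p + p * (w + z)) ^ card X + E T * (1 - p + p * (w + 1)) ^ card X)"
      using fin by (simp add: bexp_power cY)
    also have "\<dots> \<le> exp (- (p * (1 - w)) * (q - 1)) *
        (a * exp (- (p * \<kappa>) * card X) + E T * exp (p * w * card X))"
    proof (intro mult_mono add_mono order_refl)
      have le: "x ^ k \<le> exp (y * k)" if "0 \<le> x" "x \<le> exp y" for x y :: real and k :: nat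
        using power_mono[OF that(2,1), of k] by (simp only: exp_of_nat2_mult)
      have pw: "p * w \<le> p" using p w mult_left_le by blast
      have "1 - p + p * w \<le> exp (- (p * (1 - w)))"
        using exp_ge_add_one_self[of "- (p * (1 - w))"] by (simp add: algebra_simps)
      then have "(1 - p + p * w) ^ (q - 1) \<le> exp (- (p * (1 - w)) * (q - 1 :: nat))"
        using p w by (intro le) auto
      then show "(1 - p + p * w) ^ (q - 1) \<le> exp (- (p * (1 - w)) * (q - 1))"
        using q by (simp add: of_nat_diff)
      have "1 - p + p * (w + z) = 1 - p * \<kappa>" by (simp add: \<kappa> z_def algebra_simps)
      moreover have "1 - p * \<kappa> \<le> exp (- (p * \<kappa>))"
        using exp_ge_add_one_self[of "- (p * \<kappa>)"] by simp
      moreover have "0 \<le> 1 - p + p * (w + z)" using p w by (simp add: z_def)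
      ultimately show "(1 - p + p * (w + z)) ^ card X \<le> exp (- (p * \<kappa>) * card X)"
        by (intro le) auto
      have "1 - p + p * (w + 1) \<le> exp (p * w)"
        using exp_ge_add_one_self[of "p * w"] by (simp add: algebra_simps)
      then show "(1 - p + p * (w + 1)) ^ card X \<le> exp (p * w * card X)"
        using p w by (intro le) (auto simp: algebra_simps)
    qed (use p w in \<open>auto simp: a_def E_def z_def intro!: mult_nonneg_nonneg add_nonneg_nonneg\<close>)
    also have "\<dots> = exp (- (p * (1 - w)) * (q - 1)) * a * exp (- (p * \<kappa>) * card X)
        + exp (- (p * (1 - w)) * (q - 1)) * E T * exp (p * w * card X)"
      by (simp add: algebra_simps)
    also have "\<dots> \<le> exp (- \<theta> * (q - b)) + E (Suc T)"
    proof (intro add_mono)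
      have qV: "q \<le> card V" using Suc.prems by (simp add: q_def card_mono)
      have cX': "real (card X) = 2 * (card V - q)" using qV by (simp add: cX of_nat_diff)
      \<comment> \<open>Queued variables are missing from \<open>X\<close>, which lowers the drift
        by \<open>2 * p * \<kappa> * (q - 1)\<close>. The penalty
        \<open>p * (1 - w) * (q - 1)\<close> for contradicted queued literals makes up for it
        because \<open>2 * \<kappa> \<le> 1 - w\<close>.\<close>
      have "p * \<kappa> * (2 * (n1 - (q - 1))) \<le> p * \<kappa> * card X"
        unfolding cX' using Suc.prems p \<open>0 \<le> \<kappa>\<close> by (intro mult_left_mono) auto
      moreover have "p * (2 * \<kappa>) * (q - 1) \<le> p * (1 - w) * (q - 1)"
        using \<kappa>w p q by (intro mult_right_mono mult_left_mono) auto
      ultimately have "- (p * (1 - w)) * (q - 1) - \<theta> * (q - 1 - b') - p * \<kappa> * card X \<le> - \<theta> * (q - b)"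
        using drift q by (simp add: bb of_nat_diff algebra_simps)
      then show "exp (- (p * (1 - w)) * (q - 1)) * a * exp (- (p * \<kappa>) * card X) \<le> exp (- \<theta> * (q - b))"
        by (simp add: a_def exp_add[symmetric])
      \<comment> \<open>Above the barrier the contradictions of this step pay the negative part of
        one summand in the exponent; the positive part \<open>2 * p * w * n2\<close> comes from the
        option of violating unit clauses.\<close>
      have "\<rho> * (real T0 - real (Suc T)) \<le> q - 1" using q by (simp add: b_def)
      then have "p * (1 - w) * (\<rho> * (real T0 - real (Suc T))) \<le> p * (1 - w) * (q - 1)"
        using p w by (intro mult_left_mono) auto
      moreover have "p * w * card X \<le> p * w * (2 * n2)"
        unfolding cX' using Suc.prems p w by (intro mult_left_mono) auto
      ultimately show "exp (- (p * (1 - w)) * (q - 1)) * E T * exp (p * w * card X) \<le> E (Suc T)"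
        by (simp add: E_def exp_add[symmetric] algebra_simps)
    qed
    finally show ?thesis by (simp add: b_def E_def q_def)
  qed
qed

section \<open>Long implication paths\<close>

definition neg :: "literal \<Rightarrow> literal" where
  "neg x = (fst x, \<not> snd x)"

lemma fst_neg [simp]: "fst (neg x) = fst x"
  by (simp add: neg_def)

lemma neg_eq_iff [simp]: "neg x = neg y \<longleftrightarrow> x = y"
  by (auto simp: neg_def prod_eq_iff)

text \<open>A list of literals forms a path if each literal follows by one clause from its successor in
  the list. The list is thus in the order of the stack of the depth-first search, the end of the
  path coming first.\<close>

fun ipath :: "clause set \<Rightarrow> literal list \<Rightarrow> bool" where
  "ipath B (y # x # xs) \<longleftrightarrow> {neg x, y} \<in> B \<and> ipath B (x # xs)"
| "ipath B xs \<longleftrightarrow> True"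

definition var_list :: "nat set \<Rightarrow> nat \<Rightarrow> literal list \<Rightarrow> bool" where
  "var_list V M xs \<longleftrightarrow> length xs = M \<and> distinct (map fst xs) \<and> fst ` set xs \<subseteq> V"

definition has_path :: "nat set \<Rightarrow> nat \<Rightarrow> clause set \<Rightarrow> bool" where
  "has_path V M B \<longleftrightarrow> (\<exists>xs. var_list V M xs \<and> ipath B xs)"

lemma ipath_mono: "ipath A xs \<Longrightarrow> A \<subseteq> B \<Longrightarrow> ipath B xs"
  by (induction A xs rule: ipath.induct) auto

lemma ipath_Cons: "ipath B (y # xs) \<longleftrightarrow> (xs \<noteq> [] \<longrightarrow> {neg (hd xs), y} \<in> B) \<and> ipath B xs"
  by (cases xs) auto

text \<open>The stack \<open>stk\<close> holds the literals of the current path together with the literals to which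
  an implication has not yet been queried; \<open>U\<close> is the set of unvisited variables, \<open>S\<close> contains the
  unqueried clauses, \<open>K\<close> the clauses found, \<open>s\<close> is the number of discarded literals and \<open>N\<close>
  the number of queries. Each discarded literal has been queried against all literals over \<open>U\<close>.\<close>

definition dfs_inv where
  "dfs_inv V stk U S K s N \<longleftrightarrow>
     finite V \<and> U \<subseteq> V \<and> finite S \<and> distinct (map (fst \<circ> fst) stk) \<and> fst ` fst ` set stk \<subseteq> V - U \<and>
     (\<forall>(x, R)\<in>set stk. R \<subseteq> U \<times> UNIV \<and> (\<forall>y\<in>R. {neg x, y} \<in> S)) \<and>
     (\<forall>y\<in>U \<times> UNIV. \<forall>y'\<in>U \<times> UNIV. fst y \<noteq> fst y' \<longrightarrow> {y, y'} \<in> S) \<and>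
     ipath K (map fst stk) \<and> s + length stk + card U = card V \<and>
     2 * real s * card U + (\<Sum>(x, R)\<leftarrow>stk. 2 * real (card U) - card R) \<le> real N"

lemma dfs_invD:
  assumes "dfs_inv V stk U S K s N"
  shows "finite V" "U \<subseteq> V" "finite S" "distinct (map (fst \<circ> fst) stk)"
     "fst ` fst ` set stk \<subseteq> V - U"
     "\<forall>(x, R)\<in>set stk. R \<subseteq> U \<times> UNIV \<and> (\<forall>y\<in>R. {neg x, y} \<in> S)"
     "\<forall>y\<in>U \<times> UNIV. \<forall>y'\<in>U \<times> UNIV. fst y \<noteq> fst y' \<longrightarrow> {y, y'} \<in> S"
     "ipath K (map fst stk)" "s + length stk + card U = card V"
     "2 * real s * card U + (\<Sum>(x, R)\<leftarrow>stk. 2 * real (card U) - card R) \<le> real N"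
  using assms unfolding dfs_inv_def by simp_all

lemma dfs_inv_root:
  assumes "dfs_inv V [] U S K s N" "u \<in> U"
  shows "dfs_inv V [((u, True), (U - {u}) \<times> UNIV)] (U - {u}) S K s N"
proof -
  note inv = dfs_invD[OF assms(1)]
  have fU: "finite U" using finite_subset[OF inv(2,1)] .
  define U' where "U' = U - {u}"
  have cU: "card U = Suc (card U')" unfolding U'_def using fU assms(2) by (rule card.remove)
  have uU': "u \<notin> U'" and sub: "U' \<subseteq> U" by (auto simp: U'_def)
  define R where "R = U' \<times> (UNIV :: bool set)"
  have R: "R \<subseteq> U \<times> UNIV" "\<And>y. y \<in> R \<Longrightarrow> fst y \<noteq> u" using sub uU' by (auto simp: R_def)
  have cR: "real (card R) = 2 * real (card U')" by (simp add: R_def card_cartesian_product)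
  have neg: "{neg (u, True), y} \<in> S" if "y \<in> R" for y
  proof -
    have "neg (u, True) \<in> U \<times> UNIV" using assms(2) by (simp add: neg_def)
    moreover have "fst (neg (u, True)) \<noteq> fst y" using R(2)[OF that] by simp
    ultimately show ?thesis using inv(7) R(1) that by (metis subsetD)
  qed
  have n6: "\<forall>(x, R)\<in>set [((u, True), R)]. R \<subseteq> U' \<times> UNIV \<and> (\<forall>y\<in>R. {neg x, y} \<in> S)"
    using neg by (simp add: R_def[symmetric])
  have n7: "\<forall>y\<in>U' \<times> UNIV. \<forall>y'\<in>U' \<times> UNIV. fst y \<noteq> fst y' \<longrightarrow> {y, y'} \<in> S"
    using inv(7) R(1) unfolding R_def by (meson subsetD)
  have n9: "s + length [((u, True), R)] + card U' = card V"
    using inv(9) cU by simp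
  have n10: "2 * real s * card U' + (\<Sum>(x, R)\<leftarrow>[((u, True), R)]. 2 * real (card U') - card R) \<le> real N"
  proof -
    have "2 * real s * card U' \<le> 2 * real s * card U"
      using cU by (intro mult_left_mono) simp_all
    then show ?thesis using inv(10) cR by simp
  qed
  have n2: "U' \<subseteq> V" using inv(2) sub by (rule order_trans[rotated])
  have n5: "fst ` fst ` set [((u, True), R)] \<subseteq> V - U'"
    using assms(2) inv(2) uU' by (simp add: subsetD)
  have n4: "distinct (map (fst \<circ> fst) [((u, True), R)])" "ipath K (map fst [((u, True), R)])"
    by simp_all
  show ?thesis
    unfolding dfs_inv_def U'_def[symmetric] R_def[symmetric]
    by (intro conjI inv(1) n2 inv(3) n4 n5 n6[folded R_def] n7[folded R_def] n9 n10)
qed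

text \<open>A literal is discarded once nothing is left to query: its \<open>2 * card U\<close>
  queries move from the sum over the stack to the term of \<open>s\<close>.\<close>

lemma dfs_inv_pop:
  assumes "dfs_inv V ((x, {}) # stk) U S K s N"
  shows "dfs_inv V stk U S K (Suc s) N"
proof -
  note inv = dfs_invD[OF assms]
  have n4: "distinct (map (fst \<circ> fst) stk)" using inv(4) by simp
  have n5: "fst ` fst ` set stk \<subseteq> V - U" using inv(5) by simp
  have n6: "\<forall>(x, R)\<in>set stk. R \<subseteq> U \<times> UNIV \<and> (\<forall>y\<in>R. {neg x, y} \<in> S)" using inv(6) by simp
  have n8: "ipath K (map fst stk)" using inv(8) by (simp add: ipath_Cons)
  have n9: "Suc s + length stk + card U = card V" using inv(9) by simp
  have n10: "2 * real (Suc s) * card U + (\<Sum>(x, R)\<leftarrow>stk. 2 * real (card U) - card R) \<le> real N"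
    using inv(10) by (simp add: algebra_simps)
  show ?thesis
    unfolding dfs_inv_def by (intro conjI inv(1,2,3,7) n4 n5 n6 n8 n9 n10)
qed

text \<open>The clause \<open>{neg x, y}\<close> has one variable on the stack and one in
  \<open>U\<close>, and the variables on the stack are distinct. Hence a query leaves the pending
  queries of the other stack entries unanswered.\<close>

lemma dfs_query_fresh:
  assumes "dfs_inv V ((x, R) # stk) U S K s N" "y \<in> R" "(x', R') \<in> set stk" "y' \<in> R'"
  shows "{neg x', y'} \<noteq> {neg x, y}"
proof
  note inv = dfs_invD[OF assms(1)]
  assume eq: "{neg x', y'} = {neg x, y}"
  have x': "fst x' \<in> fst ` fst ` set stk" using assms(3) by (metis fst_conv imageI)
  have "fst x \<notin> fst ` fst ` set stk" using inv(4) by (simp add: image_image)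
  then have "fst x \<noteq> fst x'" using x' by metis
  then have "neg x' \<noteq> neg x" by auto
  with eq have "neg x' = y" by (metis doubleton_eq_iff)
  then have "fst x' = fst y" by (metis fst_neg)
  moreover have "R \<subseteq> U \<times> UNIV" using inv(6) by simp
  then have "fst y \<in> U" using assms(2) by auto
  moreover have "fst x' \<in> V - U" using inv(5) x' by auto
  ultimately show False by simp
qed

lemma dfs_inv_absent:
  assumes "dfs_inv V ((x, R) # stk) U S K s N" "y \<in> R"
  shows "dfs_inv V ((x, R - {y}) # stk) U (S - {{neg x, y}}) K s (Suc N)"
proof -
  note inv = dfs_invD[OF assms(1)]
  have xU: "fst x \<notin> U" using inv(5) by auto
  have RU: "R \<subseteq> U \<times> UNIV" using inv(6) by simp
  have fR: "finite R"
    by (rule finite_subset[OF RU]) (simp add: finite_subset[OF inv(2,1)])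
  have cR: "card R = Suc (card (R - {y}))" using fR assms(2) by (rule card.remove)
  have n7: "\<forall>y1\<in>U \<times> UNIV. \<forall>y2\<in>U \<times> UNIV. fst y1 \<noteq> fst y2 \<longrightarrow> {y1, y2} \<in> S - {{neg x, y}}"
  proof (intro ballI impI)
    fix y1 y2 :: literal assume that: "y1 \<in> U \<times> UNIV" "y2 \<in> U \<times> UNIV" "fst y1 \<noteq> fst y2"
    have "neg x \<notin> U \<times> UNIV" using xU by (auto simp: neg_def)
    then have "{y1, y2} \<noteq> {neg x, y}" using that by (metis insertCI insertE singletonD)
    moreover have "{y1, y2} \<in> S" using inv(7) that by blast
    ultimately show "{y1, y2} \<in> S - {{neg x, y}}" by blast
  qed
  have n6: "\<forall>(x', R')\<in>set ((x, R - {y}) # stk).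
      R' \<subseteq> U \<times> UNIV \<and> (\<forall>y'\<in>R'. {neg x', y'} \<in> S - {{neg x, y}})"
  proof
    fix z assume z: "z \<in> set ((x, R - {y}) # stk)"
    obtain x' R' where z': "z = (x', R')" by (cases z)
    have "R' \<subseteq> U \<times> UNIV \<and> (\<forall>y'\<in>R'. {neg x', y'} \<in> S \<and> {neg x', y'} \<noteq> {neg x, y})"
    proof (cases "(x', R') \<in> set stk")
      case True
      have "R' \<subseteq> U \<times> UNIV \<and> (\<forall>y'\<in>R'. {neg x', y'} \<in> S)" using inv(6) True by auto
      then show ?thesis using dfs_query_fresh[OF assms True] by blast
    next
      case False
      then have eq: "x' = x" "R' = R - {y}" using z z' by auto
      have "R \<subseteq> U \<times> UNIV \<and> (\<forall>y\<in>R. {neg x, y} \<in> S)" using inv(6) by simp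
      moreover have "{neg x, y'} \<noteq> {neg x, y}" if "y' \<noteq> y" for y'
        using that by (metis doubleton_eq_iff)
      ultimately show ?thesis unfolding eq by blast
    qed
    then show "case z of (x', R') \<Rightarrow> R' \<subseteq> U \<times> UNIV \<and> (\<forall>y'\<in>R'. {neg x', y'} \<in> S - {{neg x, y}})"
      unfolding z' by simp
  qed
  have n4: "distinct (map (fst \<circ> fst) ((x, R - {y}) # stk))" using inv(4) by simp
  have n5: "fst ` fst ` set ((x, R - {y}) # stk) \<subseteq> V - U" using inv(5) by simp
  have n8: "ipath K (map fst ((x, R - {y}) # stk))" using inv(8) by simp
  have n9: "s + length ((x, R - {y}) # stk) + card U = card V" using inv(9) by simp
  have n10: "2 * real s * card U + (\<Sum>(x, R)\<leftarrow>(x, R - {y}) # stk. 2 * real (card U) - card R) \<le> real (Suc N)"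
    using inv(10) cR by (simp del: card_Diff_insert card_Diff_singleton)
  have n3: "finite (S - {{neg x, y}})" using inv(3) by simp
  show ?thesis
    unfolding dfs_inv_def by (intro conjI inv(1,2) n3 n4 n5 n6 n7 n8 n9 n10)
qed

text \<open>Visiting the variable of \<open>y\<close> removes at most two literals from each pending
  set, while \<open>2 * card U\<close> drops by exactly two; so the lower bound on the number of
  queries survives.\<close>

lemma dfs_inv_present:
  assumes "dfs_inv V ((x, R) # stk) U S K s N" "y \<in> R"
  defines "U' \<equiv> U - {fst y}"
  shows "dfs_inv V ((y, U' \<times> UNIV) # map (\<lambda>(x, R). (x, R \<inter> U' \<times> UNIV)) ((x, R) # stk)) U'
    (S - {{neg x, y}}) (insert {neg x, y} K) s (Suc N)"
proof -
  note inv = dfs_invD[OF assms(1)]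
  let ?stk = "(x, R) # stk"
  let ?c = "\<lambda>(x, R). (x, R \<inter> U' \<times> (UNIV :: bool set))"
  have xU: "fst x \<notin> U" using inv(5) by auto
  have RU: "R \<subseteq> U \<times> UNIV" using inv(6) by simp
  have yU: "fst y \<in> U" using RU assms(2) by auto
  have fU: "finite U" using finite_subset[OF inv(2,1)] .
  have cU: "card U = Suc (card U')" unfolding U'_def using fU yU by (rule card.remove)
  define stk' where "stk' = map ?c ?stk"
  have fst_c: "map (fst \<circ> fst) (stk') = map (fst \<circ> fst) ?stk"
    "map fst (stk') = map fst ?stk" "fst ` set (stk') = fst ` set ?stk"
    by (simp_all add: stk'_def image_image case_prod_unfold o_def)
  have n1: "distinct (map (fst \<circ> fst) ((y, U' \<times> UNIV) # stk'))"
  proof -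
    have "fst y \<notin> set (map (fst \<circ> fst) ?stk)"
      using inv(5) yU by (simp only: set_map image_comp[symmetric]) blast
    then show ?thesis
      unfolding list.map(2) fst_c distinct.simps using inv(4) by simp
  qed
  have n2: "fst ` fst ` set ((y, U' \<times> UNIV) # stk') \<subseteq> V - U'"
  proof -
    have eq: "fst ` fst ` set ((y, U' \<times> UNIV) # stk') = insert (fst y) (fst ` fst ` set ?stk)"
      using fst_c(3) by (simp only: list.set image_insert fst_conv)
    have yV: "fst y \<in> V - U'" and sub: "V - U \<subseteq> V - U'" using inv(2) yU by (auto simp: U'_def)
    show ?thesis
      unfolding eq insert_subset using yV order_trans[OF inv(5) sub] by (rule conjI)
  qed
  have n3: "ipath (insert {neg x, y} K) (map fst ((y, U' \<times> UNIV) # stk'))"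
    unfolding list.map(2) fst_c using inv(8) by (auto intro: ipath_mono)
  have U'S: "{y1, y2} \<in> S - {{neg x, y}}"
    if "y1 \<in> U \<times> UNIV" "y2 \<in> U \<times> UNIV" "fst y1 \<noteq> fst y2" for y1 y2
  proof -
    have "neg x \<notin> U \<times> UNIV" using xU by (auto simp: neg_def)
    then have "{y1, y2} \<noteq> {neg x, y}" using that by (metis insertCI insertE singletonD)
    moreover have "{y1, y2} \<in> S" using inv(7) that by blast
    ultimately show ?thesis by blast
  qed
  have n4: "\<forall>(x', R')\<in>set ((y, U' \<times> UNIV) # stk').
      R' \<subseteq> U' \<times> UNIV \<and> (\<forall>y'\<in>R'. {neg x', y'} \<in> S - {{neg x, y}})"
  proof
    fix z assume z: "z \<in> set ((y, U' \<times> UNIV) # stk')"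
    obtain x' R' where z': "z = (x', R')" by (cases z)
    consider "x' = y" "R' = U' \<times> UNIV" | "x' = x" "R' = R \<inter> U' \<times> UNIV"
      | R'' where "(x', R'') \<in> set stk" "R' = R'' \<inter> U' \<times> UNIV"
      using z z' by (auto simp: stk'_def)
    then have "R' \<subseteq> U' \<times> UNIV \<and> (\<forall>y'\<in>R'. {neg x', y'} \<in> S - {{neg x, y}})"
    proof cases
      case 1
      have "{neg y, y'} \<in> S - {{neg x, y}}" if "y' \<in> U' \<times> UNIV" for y'
        using that yU by (intro U'S) (auto simp: U'_def neg_def)
      then show ?thesis unfolding 1 by blast
    next
      case 2
      have "\<forall>y\<in>R. {neg x, y} \<in> S" using inv(6) by simp
      moreover have "{neg x, y'} \<noteq> {neg x, y}" if "y' \<in> U' \<times> UNIV" for y'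
      proof -
        have "y' \<noteq> y" using that by (auto simp: U'_def)
        then show ?thesis by (metis doubleton_eq_iff)
      qed
      ultimately show ?thesis unfolding 2 by blast
    next
      case 3
      have "\<forall>y\<in>R''. {neg x', y} \<in> S" using inv(6) 3(1) by auto
      then show ?thesis unfolding 3(2) using dfs_query_fresh[OF assms(1,2) 3(1)] by blast
    qed
    then show "case z of (x', R') \<Rightarrow> R' \<subseteq> U' \<times> UNIV \<and> (\<forall>y'\<in>R'. {neg x', y'} \<in> S - {{neg x, y}})"
      unfolding z' by simp
  qed
  have n5: "2 * real s * card U' + (\<Sum>(x, R)\<leftarrow>(y, U' \<times> UNIV) # stk'. 2 * real (card U') - card R)
      \<le> real (Suc N)"
  proof -
    have le: "2 * real (card U') - card (R \<inter> U' \<times> UNIV) \<le> 2 * real (card U) - card R" 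
      if "(x, R) \<in> set ?stk" for x R
    proof -
      have R: "R \<subseteq> U \<times> UNIV" using inv(6) that by auto
      have "finite (U' \<times> (UNIV :: bool set))" using fU by (simp add: U'_def)
      have "R \<subseteq> (R \<inter> U' \<times> UNIV) \<union> {fst y} \<times> UNIV" using R by (auto simp: U'_def)
      then have "card R \<le> card ((R \<inter> U' \<times> UNIV) \<union> {fst y} \<times> (UNIV :: bool set))"
        using fU by (intro card_mono) (auto simp: U'_def)
      also have "\<dots> \<le> card (R \<inter> U' \<times> UNIV) + card ({fst y} \<times> (UNIV :: bool set))"
        by (rule card_Un_le)
      finally have "card R \<le> card (R \<inter> U' \<times> UNIV) + 2" by (simp add: card_cartesian_product)
      then show ?thesis using cU by simp
    qed
    have "(\<Sum>(x, R)\<leftarrow>stk'. 2 * real (card U') - card R)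
        = (\<Sum>(x, R)\<leftarrow>?stk. 2 * real (card U') - card (R \<inter> U' \<times> UNIV))"
      unfolding stk'_def map_map o_def by (simp add: case_prod_unfold)
    also have "\<dots> \<le> (\<Sum>(x, R)\<leftarrow>?stk. 2 * real (card U) - card R)"
      by (rule sum_list_mono) (use le in auto)
    finally have 1: "(\<Sum>(x, R)\<leftarrow>stk'. 2 * real (card U') - card R)
        \<le> (\<Sum>(x, R)\<leftarrow>?stk. 2 * real (card U) - card R)" .
    have 2: "2 * real s * card U' \<le> 2 * real s * card U"
      using cU by (intro mult_left_mono) auto
    have 3: "(\<Sum>(x, R)\<leftarrow>(y, U' \<times> UNIV) # stk'. 2 * real (card U') - card R)
        = (\<Sum>(x, R)\<leftarrow>stk'. 2 * real (card U') - card R)"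
      by (simp add: card_cartesian_product)
    have arith: "a' + S0 \<le> real (Suc N)" if "S1 \<le> S2" "a' \<le> a" "S0 = S1" "a + S2 \<le> real N"
      for a a' S0 S1 S2 :: real
      using that by simp
    show ?thesis by (rule arith[OF 1 2 3 inv(10)])
  qed
  have n6: "s + length ((y, U' \<times> UNIV) # stk') + card U' = card V"
    using inv(9) cU by (simp add: stk'_def)
  have n7: "\<forall>y1\<in>U' \<times> UNIV. \<forall>y2\<in>U' \<times> UNIV. fst y1 \<noteq> fst y2 \<longrightarrow> {y1, y2} \<in> S - {{neg x, y}}"
    by (intro ballI impI U'S) (auto simp: U'_def)
  have n8: "U' \<subseteq> V" using inv(2) by (auto simp: U'_def)
  have n9: "finite (S - {{neg x, y}})" using inv(3) by simp
  show ?thesis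
    unfolding dfs_inv_def stk'_def[symmetric]
    by (intro conjI inv(1) n8 n9 n1 n2 n4 n7 n3 n6 n5)
qed

lemma bexp_remove:
  assumes "finite S" "e \<in> S"
  shows "bexp p S f = p * bexp p (S - {e}) (\<lambda>B. f (insert e B)) + (1 - p) * bexp p (S - {e}) f"
  using bexp_insert[of "S - {e}" e p f] assms by (simp add: insert_absorb)

text \<open>The number of queries that depth-first search needs in order to discard \<open>d\<close> literals is large
  compared to the number of literals found, while the answers are independent. The exponential
  moment bound is carried along the search.\<close>

lemma dfs_bound:
  fixes p \<mu> :: real and M d :: nat
  assumes p: "0 \<le> p" "p \<le> 1" and \<mu>: "0 \<le> \<mu>" and dM: "d + M < card V"
  shows "dfs_inv V stk U S K s N \<Longrightarrow> s \<le> d \<Longrightarrow> length stk \<le> M \<Longrightarrow>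
    bexp p S (\<lambda>B. if has_path V M (K \<union> B) then 0 else 1)
      \<le> exp (\<mu> * (real (d + M) - real (s + length stk))
             - p * (1 - exp (- \<mu>)) * (2 * real d * (real (card V) - d - M) - real N))"
\<comment> \<open>A visited variable brings one stack entry with \<open>2 * (card U - 1)\<close>
  pending literals, and \<open>card U * (2 * card U + 3)\<close> falls by more than that. Absent
  clauses and discarded literals decrease the other two terms.\<close>
proof (induction "card U * (2 * card U + 3) + (\<Sum>(x, R)\<leftarrow>stk. card R) + length stk"
    arbitrary: stk U S K s N rule: less_induct)
  case less
  define F where "F K B = (if has_path V M (K \<union> B) then 0 else 1 :: real)" for K B
  define L where "L = p * (1 - exp (- \<mu>))"
  define A where "A a N = \<mu> * (real (d + M) - real a) - L * (2 * real d * (real (card V) - d - M) - real N)"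
    for a N :: nat
  have L0: "0 \<le> L" using p \<mu> by (simp add: L_def)
  have IH: "bexp p S' (F K') \<le> exp (A (s' + length stk') N')"
    if "card U' * (2 * card U' + 3) + (\<Sum>(x, R)\<leftarrow>stk'. card R) + length stk'
        < card U * (2 * card U + 3) + (\<Sum>(x, R)\<leftarrow>stk. card R) + length stk"
      "dfs_inv V stk' U' S' K' s' N'" "s' \<le> d" "length stk' \<le> M" for U' stk' S' K' s' N'
    using less.hyps[OF that] unfolding F_def A_def L_def .
  note inv = dfs_invD[OF less.prems(1)]
  have F01: "0 \<le> F K B" "F K B \<le> 1" for K B by (auto simp: F_def)
  have fU: "finite U" using finite_subset[OF inv(2,1)] .
  have "bexp p S (F K) \<le> exp (A (s + length stk) N)"
  proof -
    consider "length stk = M" | "s = d" | "length stk < M" "s < d"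
      using less.prems by linarith
    then show ?thesis
    proof cases
      case 1
      have "var_list V M (map fst stk)"
        using 1 inv(4,5) by (auto simp: var_list_def)
      moreover have "ipath (K \<union> B) (map fst stk)" for B
        using inv(8) by (rule ipath_mono) simp
      ultimately have "F K = (\<lambda>_. 0)"
        unfolding F_def has_path_def by (intro HOL.ext) auto
      then show ?thesis using inv(3) by simp
    next
      case 2
      have "bexp p S (F K) \<le> bexp p S (\<lambda>_. 1)" using p F01 by (intro bexp_mono) auto
      also have "\<dots> \<le> exp (A (s + length stk) N)"
      proof -
        \<comment> \<open>With \<open>d\<close> literals discarded the number \<open>N\<close> of
          queries is already so large that the exponent is nonnegative and the bound
          trivial.\<close>
        have "real (card U) = real (card V) - d - length stk" using inv(9) 2 by simp
        then have "2 * real d * (real (card V) - d - M) \<le> 2 * real d * card U"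
          using less.prems(3) by (intro mult_left_mono) auto
        also have "(\<Sum>(x, R)\<leftarrow>stk. 2 * real (card U) - card R) \<ge> 0"
        proof (rule sum_list_nonneg)
          fix r assume "r \<in> set (map (\<lambda>(x, R). 2 * real (card U) - card R) stk)"
          then obtain x R where r: "(x, R) \<in> set stk" "r = 2 * real (card U) - card R" by auto
          then have "R \<subseteq> U \<times> UNIV" using inv(6) by auto
          then have "card R \<le> card (U \<times> (UNIV :: bool set))" using fU by (intro card_mono) auto
          then show "0 \<le> r" using r by (simp add: card_cartesian_product)
        qed
        then have "2 * real d * card U \<le> N" using inv(10)[unfolded 2] by linarith
        finally have "0 \<le> L * (real N - 2 * real d * (real (card V) - d - M))"
          using L0 by simp
        moreover have "0 \<le> \<mu> * (real (d + M) - real (s + length stk))"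
          using \<mu> 2 less.prems(3) by simp
        ultimately have "0 \<le> A (s + length stk) N" by (simp add: A_def algebra_simps)
        then show ?thesis using inv(3) by simp
      qed
      finally show ?thesis .
    next
      case 3
      show ?thesis
      proof (cases stk)
        case Nil
        have "card U > 0" using inv(9) 3 dM Nil by simp
        then obtain u where u: "u \<in> U" by (metis card_gt_0_iff ex_in_conv)
        define U' where "U' = U - {u}"
        have cU: "card U = Suc (card U')" unfolding U'_def using fU u by (rule card.remove)
        have "dfs_inv V [((u, True), U' \<times> UNIV)] U' S K s N"
          using dfs_inv_root[of V U S K s N u] less.prems(1) u Nil by (simp add: U'_def)
        then have "bexp p S (F K) \<le> exp (A (s + length [((u, True), U' \<times> (UNIV :: bool set))]) N)"
          using 3 by (intro IH) (auto simp: Nil cU card_cartesian_product algebra_simps)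
        also have "\<dots> \<le> exp (A (s + length stk) N)"
          using \<mu> Nil by (simp add: A_def algebra_simps)
        finally show ?thesis .
      next
        case (Cons xR rest)
        obtain x R where xR: "xR = (x, R)" by (cases xR)
        note stk = Cons[unfolded xR]
        have R: "R \<subseteq> U \<times> UNIV" "\<forall>y\<in>R. {neg x, y} \<in> S" using inv(6) stk by auto
        have fR: "finite R" by (rule finite_subset[OF R(1)]) (simp add: fU)
        show ?thesis
        proof (cases "R = {}")
          case True
          have "dfs_inv V rest U S K (Suc s) N"
            using dfs_inv_pop less.prems(1) stk True by blast
          then have "bexp p S (F K) \<le> exp (A (Suc s + length rest) N)"
            using 3 stk by (intro IH) auto
          then show ?thesis using stk by simp
        next
          case False
          then obtain y where y: "y \<in> R" by blast
          define e where "e = {neg x, y}"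
          have eS: "e \<in> S" using R(2) y by (simp add: e_def)
          define U' where "U' = U - {fst y}"
          have yU: "fst y \<in> U" using R(1) y by auto
          have cU: "card U = Suc (card U')" unfolding U'_def using fU yU by (rule card.remove)
          have cR: "card R = Suc (card (R - {y}))" using fR y by (rule card.remove)
          define stk' where "stk' = map (\<lambda>(x, R). (x, R \<inter> U' \<times> (UNIV :: bool set))) ((x, R) # rest)"
          have absent: "bexp p (S - {e}) (F K) \<le> exp (A (s + length stk) (Suc N))"
          proof -
            have "dfs_inv V ((x, R - {y}) # rest) U (S - {e}) K s (Suc N)"
              unfolding e_def using dfs_inv_absent less.prems(1) stk y by blast
            then have "bexp p (S - {e}) (F K) \<le> exp (A (s + length ((x, R - {y}) # rest)) (Suc N))"
              using 3 stk cR by (intro IH) (auto simp del: card_Diff_insert card_Diff_singleton)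
            then show ?thesis using stk by simp
          qed
          have present: "bexp p (S - {e}) (F (insert e K)) \<le> exp (A (Suc (s + length stk)) (Suc N))"
          proof -
            have len: "length stk' = length stk" using stk by (simp add: stk'_def)
            have "dfs_inv V ((y, U' \<times> UNIV) # stk') U' (S - {e}) (insert e K) s (Suc N)"
              unfolding e_def U'_def stk'_def
              using dfs_inv_present[OF less.prems(1)[unfolded stk] y] .
            moreover have "(\<Sum>(x, R)\<leftarrow>stk'. card R) \<le> (\<Sum>(x, R)\<leftarrow>stk. card R)"
            proof -
              have fin: "finite R'" if "(x', R') \<in> set stk" for x' R'
              proof -
                have "R' \<subseteq> U \<times> UNIV" using inv(6) that by auto
                then show ?thesis by (rule finite_subset) (simp add: fU)
              qed
              have "(\<Sum>(x, R)\<leftarrow>stk'. card R) = (\<Sum>(x, R)\<leftarrow>stk. card (R \<inter> U' \<times> (UNIV :: bool set)))"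
                unfolding stk'_def stk map_map o_def by (simp add: case_prod_unfold)
              also have "\<dots> \<le> (\<Sum>(x, R)\<leftarrow>stk. card R)"
                by (rule sum_list_mono) (use fin in \<open>auto intro!: card_mono\<close>)
              finally show ?thesis .
            qed
            ultimately have "bexp p (S - {e}) (F (insert e K))
                \<le> exp (A (s + length ((y, U' \<times> (UNIV :: bool set)) # stk')) (Suc N))"
              using 3 len by (intro IH) (auto simp: cU card_cartesian_product algebra_simps)
            then show ?thesis using len by simp
          qed
          have "bexp p S (F K) = p * bexp p (S - {e}) (F (insert e K)) + (1 - p) * bexp p (S - {e}) (F K)"
          proof -
            have "(\<lambda>B. F K (insert e B)) = F (insert e K)" by (rule HOL.ext) (simp add: F_def)
            then show ?thesis using bexp_remove[OF inv(3) eS, of p "F K"] by simp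
          qed
          also have "\<dots> \<le> p * exp (A (Suc (s + length stk)) (Suc N)) + (1 - p) * exp (A (s + length stk) (Suc N))"
            using p absent present by (intro add_mono mult_left_mono) auto
          also have "\<dots> = exp (A (s + length stk) N) * (exp L * (1 - L))"
          proof -
            have "A (Suc (s + length stk)) (Suc N) = A (s + length stk) N + L - \<mu>"
              "A (s + length stk) (Suc N) = A (s + length stk) N + L"
              by (simp_all add: A_def algebra_simps)
            then have "exp (A (Suc (s + length stk)) (Suc N)) = exp (A (s + length stk) N) * exp L * exp (- \<mu>)"
              "exp (A (s + length stk) (Suc N)) = exp (A (s + length stk) N) * exp L"
              by (simp_all add: exp_add[symmetric])
            moreover have "1 - L = p * exp (- \<mu>) + (1 - p)" by (simp add: L_def algebra_simps)
            moreover have "p * (a * b * c) + (1 - p) * (a * b) = a * (b * (p * c + (1 - p)))" for a b c :: real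
              by (simp add: algebra_simps)
            ultimately show ?thesis by (simp only:)
          qed
          \<comment> \<open>Every query raises the exponent by \<open>L\<close> and every literal
            found lowers it by \<mu>; \<open>L\<close> is chosen so that the mean factor is at most
            1, by \<open>1 - L \<le> exp (- L)\<close>.\<close>
          also have "\<dots> \<le> exp (A (s + length stk) N) * 1"
          proof (intro mult_left_mono)
            have "exp L * (1 - L) \<le> exp L * exp (- L)"
              using exp_ge_add_one_self[of "- L"] by (intro mult_left_mono) auto
            then show "exp L * (1 - L) \<le> 1" by (simp add: exp_minus)
          qed simp
          finally show ?thesis by simp
        qed
      qed
    qed
  qed
  then show ?case by (simp add: F_def[abs_def] A_def L_def)
qed

text \<open>A failed search makes at least \<open>2 * d * (card V - d - M)\<close> queries and finds
  at most \<open>d + M\<close> clauses. This is the Chernoff bound for that event, with free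
  parameter \<mu>.\<close>

lemma no_path_bound:
  fixes p \<mu> :: real and M d :: nat
  assumes "0 \<le> p" "p \<le> 1" "0 \<le> \<mu>" "d + M < card V" "finite V"
  shows "bexp p (clauses_on V) (\<lambda>B. if has_path V M B then 0 else 1)
      \<le> exp (\<mu> * real (d + M) - p * (1 - exp (- \<mu>)) * (2 * real d * (real (card V) - d - M)))"
proof -
  have "dfs_inv V [] V (clauses_on V) {} 0 0"
    using assms by (auto simp: dfs_inv_def intro!: clauses_onI)
  from dfs_bound[OF assms(1-4) this] show ?thesis by simp
qed

section \<open>Counting paths and the assignments along them\<close>

fun path_clauses :: "literal list \<Rightarrow> clause set" where
  "path_clauses (y # x # xs) = insert {neg x, y} (path_clauses (x # xs))"
| "path_clauses xs = {}"

text \<open>The list is in stack order, so \<open>a\<close> belongs to the implying literal and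
  \<open>b\<close> to the implied one; a descent is exactly a violated clause of the path.\<close>

fun descents :: "bool list \<Rightarrow> nat" where
  "descents (b # a # as) = (if a \<and> \<not> b then 1 else 0) + descents (a # as)"
| "descents bs = 0"

lemma ipath_iff: "ipath B xs \<longleftrightarrow> path_clauses xs \<subseteq> B"
  by (induction B xs rule: ipath.induct) auto

lemma finite_path_clauses [simp]: "finite (path_clauses xs)"
  by (induction xs rule: path_clauses.induct) auto

lemma path_clauses_vars: "C \<in> path_clauses xs \<Longrightarrow> fst ` C \<subseteq> fst ` set xs"
  by (induction xs rule: path_clauses.induct) auto

lemma path_clause_fresh:
  assumes "distinct (map fst (y # x # xs))"
  shows "{neg x, y} \<notin> path_clauses (x # xs)"
  using path_clauses_vars[of "{neg x, y}" "x # xs"] assms by auto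

lemma path_clauses_subset:
  "distinct (map fst xs) \<Longrightarrow> fst ` set xs \<subseteq> V \<Longrightarrow> path_clauses xs \<subseteq> clauses_on V"
proof (induction xs rule: path_clauses.induct)
  case (1 y x xs)
  have "{neg x, y} \<in> clauses_on V"
    using 1 by (intro clauses_onI) (auto simp: mem_Times_iff)
  then show ?case using 1 by simp
qed auto

text \<open>Distinct variables make the clauses of a path distinct, so that each of them contributes
  a factor \<open>p\<close>.\<close>

lemma card_path_clauses: "distinct (map fst xs) \<Longrightarrow> card (path_clauses xs) = length xs - 1"
proof (induction xs rule: path_clauses.induct)
  case (1 y x xs)
  then show ?case using path_clause_fresh[OF 1(2)] by simp
qed auto

lemma viol_insert:
  assumes "finite B" "C \<notin> B"
  shows "viol \<sigma> (insert C B) = (if satisfies \<sigma> C then 0 else 1) + viol \<sigma> B"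
proof -
  have "viol \<sigma> ({C} \<union> B) = viol \<sigma> {C} + viol \<sigma> B"
    using assms by (intro viol_union) auto
  moreover have "{C' \<in> {C}. \<not> satisfies \<sigma> C'} = (if satisfies \<sigma> C then {} else {C})" by auto
  then have "viol \<sigma> {C} = (if satisfies \<sigma> C then 0 else 1)" by (simp add: viol_def)
  ultimately show ?thesis by simp
qed

lemma viol_path_clauses:
  "distinct (map fst xs) \<Longrightarrow> viol \<sigma> (path_clauses xs) = descents (map (\<lambda>x. \<sigma> (fst x) = snd x) xs)"
proof (induction xs rule: path_clauses.induct)
  case (1 y x xs)
  have "satisfies \<sigma> {neg x, y} \<longleftrightarrow> \<sigma> (fst x) \<noteq> snd x \<or> \<sigma> (fst y) = snd y"
    by (auto simp: satisfies_def neg_def case_prod_unfold)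
  then show ?case
    using 1 path_clause_fresh[OF 1(2)] by (simp add: viol_insert)
qed (auto simp: viol_def)

lemma finite_bool_lists: "finite {bs :: bool list. length bs = n}"
  using finite_lists_length_eq[of "UNIV :: bool set" n] by simp

lemma sum_bool_lists_Suc:
  fixes f :: "bool list \<Rightarrow> real"
  shows "(\<Sum>bs | length bs = Suc n. f bs)
    = (\<Sum>bs | length bs = n. f (True # bs)) + (\<Sum>bs | length bs = n. f (False # bs))"
proof -
  have eq: "{bs :: bool list. length bs = Suc n} = (#) True ` {bs. length bs = n} \<union> (#) False ` {bs. length bs = n}"
    by (auto simp: length_Suc_conv image_iff)
  have disj: "(#) True ` {bs. length bs = n} \<inter> (#) False ` {bs. length bs = n} = {}" by auto
  show ?thesis
    unfolding eq using finite_bool_lists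
    by (subst sum.union_disjoint[OF _ _ disj]) (simp_all add: sum.reindex o_def)
qed

text \<open>The growth rate \<open>1 + x\<close> is the top eigenvalue of the transfer matrix with rows \<open>1, 1\<close> and
  \<open>x\<^sup>2, 1\<close>, with eigenvector \<open>(1 / x, 1)\<close>.\<close>

lemma sum_descents:
  fixes x :: real
  assumes "0 < x" "x \<le> 1"
  shows "(\<Sum>bs | length bs = Suc n. (x\<^sup>2) ^ descents bs) \<le> (1 + 1 / x) * (1 + x) ^ n"
proof -
  have "(\<Sum>bs | length bs = n. (x\<^sup>2) ^ descents (True # bs)) \<le> 1 / x * (1 + x) ^ n \<and>
        (\<Sum>bs | length bs = n. (x\<^sup>2) ^ descents (False # bs)) \<le> (1 + x) ^ n"
  proof (induction n)
    case (Suc n)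
    let ?T = "\<Sum>bs | length bs = n. (x\<^sup>2) ^ descents (True # bs)"
    let ?F = "\<Sum>bs | length bs = n. (x\<^sup>2) ^ descents (False # bs)"
    have "(\<Sum>bs | length bs = Suc n. (x\<^sup>2) ^ descents (True # bs)) = ?T + ?F"
      by (simp add: sum_bool_lists_Suc)
    also have "\<dots> \<le> 1 / x * (1 + x) ^ n + (1 + x) ^ n" using Suc by (intro add_mono) auto
    also have "\<dots> = 1 / x * (1 + x) ^ Suc n" using assms by (simp add: field_simps)
    finally have 1: "(\<Sum>bs | length bs = Suc n. (x\<^sup>2) ^ descents (True # bs)) \<le> 1 / x * (1 + x) ^ Suc n" .
    have "(\<Sum>bs | length bs = Suc n. (x\<^sup>2) ^ descents (False # bs)) = x\<^sup>2 * ?T + ?F"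
      by (simp add: sum_bool_lists_Suc sum_distrib_left)
    also have "\<dots> \<le> x\<^sup>2 * (1 / x * (1 + x) ^ n) + (1 + x) ^ n"
      using Suc by (intro add_mono mult_left_mono) auto
    also have "\<dots> = (1 + x) ^ Suc n" using assms by (simp add: field_simps power2_eq_square)
    finally show ?case using 1 by simp
  qed (use assms in simp)
  then show ?thesis by (simp add: sum_bool_lists_Suc algebra_simps)
qed

lemma card_var_lists:
  assumes "finite V"
  shows "finite {xs. var_list V M xs}" "card {xs. var_list V M xs} \<le> (2 * card V) ^ M"
proof -
  let ?A = "V \<times> (UNIV :: bool set)"
  have sub: "{xs. var_list V M xs} \<subseteq> {xs. set xs \<subseteq> ?A \<and> length xs = M}"
    by (auto simp: var_list_def)
  have fin: "finite {xs. set xs \<subseteq> ?A \<and> length xs = M}"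
    using assms by (intro finite_lists_length_eq) auto
  show "finite {xs. var_list V M xs}" using sub fin by (rule finite_subset)
  have "card {xs. var_list V M xs} \<le> card {xs. set xs \<subseteq> ?A \<and> length xs = M}"
    using sub fin by (intro card_mono)
  also have "\<dots> = (2 * card V) ^ M"
    using assms by (subst card_lists_length_eq) (auto simp: card_cartesian_product mult.commute)
  finally show "card {xs. var_list V M xs} \<le> (2 * card V) ^ M" .
qed

text \<open>Indexes the assignments of the path by their patterns of truth values, so that they can
  be summed with weights given by \<open>descents\<close>. Any assignment realizing the pattern
  serves, since only its values on the path are read.\<close>

definition path_assignment :: "literal list \<Rightarrow> bool list \<Rightarrow> nat \<Rightarrow> bool" where
  "path_assignment xs bs = (SOME \<tau>. map (\<lambda>x. \<tau> (fst x) = snd x) xs = bs)"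

lemma path_assignment_ext:
  "\<sigma> \<in> ext (fst ` set xs) (path_assignment xs (map (\<lambda>x. \<sigma> (fst x) = snd x) xs))"
proof -
  let ?\<tau> = "path_assignment xs (map (\<lambda>x. \<sigma> (fst x) = snd x) xs)"
  have "map (\<lambda>x. ?\<tau> (fst x) = snd x) xs = map (\<lambda>x. \<sigma> (fst x) = snd x) xs"
    unfolding path_assignment_def
    by (rule someI[of "\<lambda>\<tau>. map (\<lambda>x. \<tau> (fst x) = snd x) xs = map (\<lambda>x. \<sigma> (fst x) = snd x) xs" \<sigma>])
       (rule refl)
  then have "(?\<tau> (fst x) = snd x) = (\<sigma> (fst x) = snd x)" if "x \<in> set xs" for x
    using that by simp
  then show ?thesis by (auto simp: ext_def)
qed

text \<open>Truth values along a path increase up to violated clauses, so a path has few relevant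
  assignments although it contains many literals. The square of \<open>w\<close> pays for a
  violation twice, on the path and in the formula.\<close>

lemma few_violations_bound:
  fixes w x p Q :: real
  assumes V: "finite V" and w: "w = x\<^sup>2" "0 < x" "x \<le> 1" and p: "0 \<le> p" "p \<le> 1"
    and Q: "\<And>D \<tau>. D \<subseteq> V \<Longrightarrow> card D = Suc M \<Longrightarrow> bexp p (clauses_on V) (best w D \<tau>) \<le> Q"
  shows "bexp p (clauses_on V) (\<lambda>B. if \<exists>\<sigma>. viol \<sigma> B \<le> k then 1 else 0)
    \<le> bexp p (clauses_on V) (\<lambda>B. if has_path V (Suc M) B then 0 else 1)
      + (1 / w) ^ (2 * k) * (2 * real (card V)) ^ Suc M * p ^ M * ((1 + 1 / x) * (1 + x) ^ M) * \<bar>Q\<bar>"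
proof -
  have w01: "0 < w" "w \<le> 1" using w by (auto simp: power_le_one)
  let ?S = "clauses_on V"
  let ?XS = "{xs. var_list V (Suc M) xs}"
  let ?BS = "{bs :: bool list. length bs = Suc M}"
  \<comment> \<open>A sum over patterns replaces the maximum over assignments of the path, and it
    stays decreasing in \<open>B\<close>.\<close>
  define f where "f xs B = (\<Sum>bs\<in>?BS. w ^ descents bs * best w (fst ` set xs) (path_assignment xs bs) B)"
    for xs B
  have f0: "0 \<le> f xs B" if "B \<subseteq> ?S" for xs B
    unfolding f_def using w01 that V
    by (intro sum_nonneg mult_nonneg_nonneg best_nonneg) (auto intro: finite_subset)
  have pt: "(if \<exists>\<sigma>. viol \<sigma> B \<le> k then 1 else 0) \<le> (if has_path V (Suc M) B then 0 else 1)
      + (1 / w) ^ (2 * k) * (\<Sum>xs\<in>?XS. if path_clauses xs \<subseteq> B then f xs B else 0)"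
    if B: "B \<subseteq> ?S" for B
  proof -
    have nn: "0 \<le> (\<Sum>xs\<in>?XS. if path_clauses xs \<subseteq> B then f xs B else 0)"
      using f0[OF B] by (intro sum_nonneg) auto
    have fB: "finite B" using B V finite_subset by fastforce
    show ?thesis
    proof (cases "(\<exists>\<sigma>. viol \<sigma> B \<le> k) \<and> has_path V (Suc M) B")
      case True
      then obtain \<sigma> xs where \<sigma>: "viol \<sigma> B \<le> k" and xs: "var_list V (Suc M) xs" "path_clauses xs \<subseteq> B"
        by (auto simp: has_path_def ipath_iff)
      define bs where "bs = map (\<lambda>x. \<sigma> (fst x) = snd x) xs"
      have bs: "bs \<in> ?BS" using xs by (simp add: bs_def var_list_def)
      have "descents bs = viol \<sigma> (path_clauses xs)"
        using xs by (simp add: bs_def var_list_def viol_path_clauses)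
      also have "\<dots> \<le> k" using viol_mono[OF xs(2) fB, of \<sigma>] \<sigma> by simp
      \<comment> \<open>The at most \<open>k\<close> violations are counted once along the path and
        once in all of \<open>B\<close>, hence the exponent \<open>2 * k\<close>.\<close>
      finally have "w ^ (2 * k) \<le> w ^ (descents bs + viol \<sigma> B)"
        using \<sigma> w01 by (intro power_decreasing) auto
      also have "\<dots> = w ^ descents bs * w ^ viol \<sigma> B" by (simp add: power_add)
      also have "\<dots> \<le> w ^ descents bs * best w (fst ` set xs) (path_assignment xs bs) B"
        unfolding bs_def using w01 by (intro mult_left_mono best_ge fB path_assignment_ext) auto
      also have "\<dots> \<le> f xs B"
        unfolding f_def using bs w01 fB finite_bool_lists
        by (intro member_le_sum[of bs _ "\<lambda>bs. w ^ descents bs * best w (fst ` set xs) (path_assignment xs bs) B"])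
           (auto intro!: mult_nonneg_nonneg best_nonneg)
      also have "\<dots> = (if path_clauses xs \<subseteq> B then f xs B else 0)" using xs by simp
      also have "\<dots> \<le> (\<Sum>xs\<in>?XS. if path_clauses xs \<subseteq> B then f xs B else 0)"
        using xs f0[OF B] card_var_lists(1)[OF V]
        by (intro member_le_sum[of xs _ "\<lambda>xs. if path_clauses xs \<subseteq> B then f xs B else 0"]) auto
      finally have "1 \<le> (1 / w) ^ (2 * k) * (\<Sum>xs\<in>?XS. if path_clauses xs \<subseteq> B then f xs B else 0)"
        using w01 by (simp add: power_one_over field_simps)
      then show ?thesis using True by simp
    next
      case False
      have "0 \<le> (1 / w) ^ (2 * k) * (\<Sum>xs\<in>?XS. if path_clauses xs \<subseteq> B then f xs B else 0)"
        using nn w01 by simp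
      then show ?thesis using False by auto
    qed
  qed
  have "bexp p ?S (\<lambda>B. if \<exists>\<sigma>. viol \<sigma> B \<le> k then 1 else 0)
    \<le> bexp p ?S (\<lambda>B. (if has_path V (Suc M) B then 0 else 1)
      + (1 / w) ^ (2 * k) * (\<Sum>xs\<in>?XS. if path_clauses xs \<subseteq> B then f xs B else 0))"
    using p pt by (rule bexp_mono)
  also have "\<dots> = bexp p ?S (\<lambda>B. if has_path V (Suc M) B then 0 else 1)
      + (1 / w) ^ (2 * k) * (\<Sum>xs\<in>?XS. bexp p ?S (\<lambda>B. if path_clauses xs \<subseteq> B then f xs B else 0))"
    by (simp add: bexp_add bexp_cmult bexp_sum)
  also have "(\<Sum>xs\<in>?XS. bexp p ?S (\<lambda>B. if path_clauses xs \<subseteq> B then f xs B else 0))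
      \<le> (\<Sum>xs\<in>?XS. p ^ M * (((1 + 1 / x) * (1 + x) ^ M) * \<bar>Q\<bar>))"
  proof (rule sum_mono)
    fix xs assume "xs \<in> ?XS"
    then have xs: "distinct (map fst xs)" "fst ` set xs \<subseteq> V" "length xs = Suc M"
      by (auto simp: var_list_def)
    have cD: "card (fst ` set xs) = Suc M"
      using xs distinct_card[OF xs(1)] by simp
    \<comment> \<open>Since \<open>f xs\<close> decreases in \<open>B\<close>, requiring the clauses
      of the path costs the factor \<open>p ^ M\<close> and does not favour the assignment.\<close>
    have "bexp p ?S (\<lambda>B. if path_clauses xs \<subseteq> B then f xs B else 0)
        \<le> p ^ card (path_clauses xs) * bexp p ?S (f xs)"
    proof (rule bexp_superset_le)
      show "f xs B \<le> f xs A" if "A \<subseteq> B" "B \<subseteq> ?S" for A B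
        unfolding f_def using w01 that V finite_subset[OF that(2)]
        by (intro sum_mono mult_left_mono best_antimono) auto
    qed (use V xs p path_clauses_subset in auto)
    also have "card (path_clauses xs) = M" using xs by (simp add: card_path_clauses)
    also have "bexp p ?S (f xs) = (\<Sum>bs\<in>?BS. w ^ descents bs * bexp p ?S (best w (fst ` set xs) (path_assignment xs bs)))"
      unfolding f_def[abs_def] by (simp add: bexp_sum bexp_cmult)
    also have "\<dots> \<le> (\<Sum>bs\<in>?BS. w ^ descents bs * \<bar>Q\<bar>)"
      using w01 Q[OF xs(2) cD] by (intro sum_mono mult_left_mono) (auto intro: order_trans[OF _ abs_ge_self])
    also have "\<dots> = (\<Sum>bs\<in>?BS. w ^ descents bs) * \<bar>Q\<bar>"
      by (simp add: sum_distrib_right)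
    also have "\<dots> \<le> ((1 + 1 / x) * (1 + x) ^ M) * \<bar>Q\<bar>"
      unfolding w(1) using w by (intro mult_right_mono sum_descents) auto
    finally show "bexp p ?S (\<lambda>B. if path_clauses xs \<subseteq> B then f xs B else 0)
        \<le> p ^ M * (((1 + 1 / x) * (1 + x) ^ M) * \<bar>Q\<bar>)"
      using p by (simp add: mult_left_mono)
  qed
  also have "\<dots> = card ?XS * (p ^ M * (((1 + 1 / x) * (1 + x) ^ M) * \<bar>Q\<bar>))" by simp
  also have "\<dots> \<le> (2 * real (card V)) ^ Suc M * (p ^ M * (((1 + 1 / x) * (1 + x) ^ M) * \<bar>Q\<bar>))"
  proof (rule mult_right_mono)
    have "real (card ?XS) \<le> real ((2 * card V) ^ Suc M)"
      using card_var_lists(2)[OF V] by (intro of_nat_mono)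
    then show "real (card ?XS) \<le> (2 * real (card V)) ^ Suc M" by simp
  qed (use p w in auto)
  finally show ?thesis
    using w01 by (simp add: mult.assoc mult_left_mono)
qed

section \<open>The upper bound\<close>

text \<open>From the quadratic lower bound on \<open>exp y\<close>, since \<open>(1 - y + y\<^sup>2
  / 2) * (1 + y + y\<^sup>2 / 2) = 1 + (y\<^sup>2 / 2)\<^sup>2\<close>.\<close>

lemma exp_minus_le:
  fixes y :: real
  assumes "0 \<le> y"
  shows "exp (- y) \<le> 1 - y + y\<^sup>2 / 2"
proof -
  define z where "z = y\<^sup>2 / 2"
  have z: "0 \<le> z" "y * y = 2 * z" by (simp_all add: z_def power2_eq_square)
  have pos: "0 < 1 + y + z" using assms z(1) by linarith
  have le: "1 + y + z \<le> exp y" unfolding z_def using assms by (rule exp_lower_Taylor_quadratic)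
  have "(1 - y + z) * (1 + y + z) = (1 + z) * (1 + z) - y * y" by (simp add: algebra_simps)
  also have "\<dots> = 1 + z * z" unfolding z(2) by (simp add: algebra_simps)
  finally have "1 \<le> (1 - y + z) * (1 + y + z)" by simp
  then have "1 / (1 + y + z) \<le> 1 - y + z" using pos by (simp add: divide_le_eq)
  moreover have "exp (- y) \<le> 1 / (1 + y + z)"
    unfolding exp_minus inverse_eq_divide using pos le by (intro divide_left_mono) auto
  ultimately show ?thesis unfolding z_def by (rule order_trans[rotated])
qed

section \<open>Limits of rounded parameters and of the clause probability\<close>

lemma nat_floor_limit:
  fixes a :: real
  assumes "0 \<le> a"
  shows "(\<lambda>n. real (nat \<lfloor>a * real n\<rfloor>) / real n) \<longlonglongrightarrow> a"
proof (rule tendsto_sandwich)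
  show "\<forall>\<^sub>F n in sequentially. a - 1 / real n \<le> real (nat \<lfloor>a * real n\<rfloor>) / real n"
    using eventually_gt_at_top[of 0]
  proof eventually_elim
    case (elim n)
    have "0 \<le> \<lfloor>a * real n\<rfloor>" using assms by simp
    then have "a * real n - 1 \<le> real (nat \<lfloor>a * real n\<rfloor>)" by linarith
    then have "(a * real n - 1) / real n \<le> real (nat \<lfloor>a * real n\<rfloor>) / real n"
      by (intro divide_right_mono) auto
    then show ?case using elim by (simp add: diff_divide_distrib)
  qed
  show "\<forall>\<^sub>F n in sequentially. real (nat \<lfloor>a * real n\<rfloor>) / real n \<le> a"
    using eventually_gt_at_top[of 0]
  proof eventually_elim
    case (elim n)
    have "0 \<le> a * real n" using assms by simp
    then have "real (nat \<lfloor>a * real n\<rfloor>) \<le> a * real n" by linarith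
    then show ?case using elim by (simp add: field_simps)
  qed
  show "(\<lambda>n. a - 1 / real n) \<longlonglongrightarrow> a" by real_asymp
qed simp

lemma one_minus_exp_limit:
  fixes y :: "nat \<Rightarrow> real"
  assumes y: "(\<lambda>n. real n * y n) \<longlonglongrightarrow> a" and y0: "\<And>n. 0 \<le> y n"
  shows "(\<lambda>n. real n * (1 - exp (- y n))) \<longlonglongrightarrow> a"
proof (rule tendsto_sandwich)
  have "(\<lambda>n. real n * y n * (1 / real n)) \<longlonglongrightarrow> a * 0"
    by (intro tendsto_mult y) real_asymp
  then have "(\<lambda>n. real n * y n * (1 / real n)) \<longlonglongrightarrow> 0" by simp
  then have y1: "y \<longlonglongrightarrow> 0"
    by (rule Lim_transform_eventually) (rule eventually_mono[OF eventually_gt_at_top[of 0]], simp)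
  have "(\<lambda>n. real n * y n - real n * y n * y n / 2) \<longlonglongrightarrow> a - a * 0 / 2"
    by (intro tendsto_intros y y1) simp
  then show "(\<lambda>n. real n * y n - real n * y n * y n / 2) \<longlonglongrightarrow> a" by simp
  show "(\<lambda>n. real n * y n) \<longlonglongrightarrow> a" by (rule y)
  show "\<forall>\<^sub>F n in sequentially. real n * y n - real n * y n * y n / 2 \<le> real n * (1 - exp (- y n))"
  proof (intro always_eventually allI)
    fix n
    have "y n - (y n)\<^sup>2 / 2 \<le> 1 - exp (- y n)" using exp_minus_le[OF y0[of n]] by simp
    then have "real n * (y n - (y n)\<^sup>2 / 2) \<le> real n * (1 - exp (- y n))"
      by (intro mult_left_mono) auto
    then show "real n * y n - real n * y n * y n / 2 \<le> real n * (1 - exp (- y n))"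
      by (simp add: algebra_simps power2_eq_square)
  qed
  show "\<forall>\<^sub>F n in sequentially. real n * (1 - exp (- y n)) \<le> real n * y n"
  proof (intro always_eventually allI mult_left_mono)
    fix n show "1 - exp (- y n) \<le> y n" using exp_ge_add_one_self[of "- y n"] by simp
  qed simp
qed

lemma card_clauses_on_atLeastAtMost: "real (card (clauses_on {1..n})) = 2 * real n * (real n - 1)"
proof -
  have "even (n * (n - 1))" by (cases n) auto
  then have "2 * (n choose 2) = n * (n - 1)" by (auto simp: choose_two elim: evenE)
  then have "card (clauses_on {1..n}) = 2 * (n * (n - 1))"
    unfolding proper_clauses_eq[symmetric] card_proper_clauses by linarith
  then show ?thesis by (cases n) (simp_all add: algebra_simps)
qed

text \<open>Absorbs the polynomial losses: one factor of order \<open>n\<close> from Poissonization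
  and one from the free choice of one literal of the path.\<close>

lemma poly_exp_limit:
  fixes E :: "nat \<Rightarrow> real"
  assumes "(\<lambda>n. E n / real n) \<longlonglongrightarrow> L" "L < 0"
  shows "(\<lambda>n. real n ^ 2 * exp (E n)) \<longlonglongrightarrow> 0"
proof (rule tendsto_sandwich[of "\<lambda>_. 0" _ _ "\<lambda>n. real n ^ 2 * exp (L / 2 * real n)"])
  have "\<forall>\<^sub>F n in sequentially. E n / real n < L / 2"
    using order_tendstoD(2)[OF assms(1), of "L / 2"] assms(2) by simp
  then show "\<forall>\<^sub>F n in sequentially. real n ^ 2 * exp (E n) \<le> real n ^ 2 * exp (L / 2 * real n)"
    using eventually_gt_at_top[of 0]
  proof eventually_elim
    case (elim n)
    then have "E n \<le> L / 2 * real n" by (simp add: field_simps)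
    then show ?case by (intro mult_left_mono) auto
  qed
  show "(\<lambda>n. real n ^ 2 * exp (L / 2 * real n)) \<longlonglongrightarrow> 0"
    using assms(2) by real_asymp
  show "\<forall>\<^sub>F n in sequentially. 0 \<le> real n ^ 2 * exp (E n)" by simp
qed simp

lemma power_eq_exp: "0 < a \<Longrightarrow> a ^ k = exp (real k * ln a)"
  by (simp add: exp_of_nat_mult)

text \<open>Probability that a fixed clause occurs after Poissonization. The limit
  \<open>1 + \<epsilon>\<close> of \<open>2 * n * cl_prob \<epsilon> n\<close> is the mean number of
  implications out of a literal.\<close>

definition cl_prob :: "real \<Rightarrow> nat \<Rightarrow> real" where
  "cl_prob \<epsilon> n = 1 - exp (- (real (nat \<lfloor>(1 + \<epsilon>) * real n\<rfloor>) / real (card (clauses_on {1..n}))))"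

lemma cl_prob_limit:
  assumes \<epsilon>: "0 \<le> \<epsilon>"
  shows "(\<lambda>n. real n * cl_prob \<epsilon> n) \<longlonglongrightarrow> (1 + \<epsilon>) / 2"
  unfolding cl_prob_def
proof (rule one_minus_exp_limit)
  have "(\<lambda>n. real (nat \<lfloor>(1 + \<epsilon>) * real n\<rfloor>) / real n * (real n ^ 2 / (2 * real n * (real n - 1))))
      \<longlonglongrightarrow> (1 + \<epsilon>) * (1 / 2)"
  proof (rule tendsto_mult)
    show "(\<lambda>n. real (nat \<lfloor>(1 + \<epsilon>) * real n\<rfloor>) / real n) \<longlonglongrightarrow> 1 + \<epsilon>"
      using \<epsilon> by (intro nat_floor_limit) simp
    show "(\<lambda>n. real n ^ 2 / (2 * real n * (real n - 1))) \<longlonglongrightarrow> 1 / 2" by real_asymp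
  qed
  then have "(\<lambda>n. real (nat \<lfloor>(1 + \<epsilon>) * real n\<rfloor>) / real n * (real n ^ 2 / (2 * real n * (real n - 1))))
      \<longlonglongrightarrow> (1 + \<epsilon>) / 2" by simp
  then show "(\<lambda>n. real n * (real (nat \<lfloor>(1 + \<epsilon>) * real n\<rfloor>) / real (card (clauses_on {1..n}))))
      \<longlonglongrightarrow> (1 + \<epsilon>) / 2"
  proof (rule Lim_transform_eventually)
    have eq: "a / x * (x ^ 2 / (2 * x * (x - 1))) = x * (a / (2 * x * (x - 1)))" if "x > 1" for a x :: real
      using that by (simp add: power2_eq_square)
    show "\<forall>\<^sub>F n in sequentially. real (nat \<lfloor>(1 + \<epsilon>) * real n\<rfloor>) / real n * (real n ^ 2 / (2 * real n * (real n - 1)))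
      = real n * (real (nat \<lfloor>(1 + \<epsilon>) * real n\<rfloor>) / real (card (clauses_on {1..n})))"
      using eventually_gt_at_top[of 1] unfolding card_clauses_on_atLeastAtMost
      by (rule eventually_mono) (rule eq, simp)
  qed
qed simp

lemma cl_prob_bounds: "0 \<le> \<epsilon> \<Longrightarrow> 0 \<le> cl_prob \<epsilon> n" "cl_prob \<epsilon> n \<le> 1"
  unfolding cl_prob_def by simp_all

text \<open>The limiting drift condition of \<open>exploration_bound\<close> with
  \<open>\<epsilon> / 100 * n\<close> steps. The terms \<open>3 / 2 * \<epsilon>\<close> agree on
  both sides; in second order the right side has a coefficient of about 0.36 against 3/40.\<close>

lemma growth_constant:
  fixes \<epsilon> :: real
  assumes \<epsilon>: "0 < \<epsilon>" "\<epsilon> < 1 / 1000"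
  shows "3 / 2 * \<epsilon> * (1 + \<epsilon> / 20) < (1 + \<epsilon>) * (1 - \<epsilon> / 100) * (1 - \<epsilon> ^ 4 - exp (- (3 / 2 * \<epsilon>)))"
proof -
  have e2: "\<epsilon> * \<epsilon> \<le> \<epsilon> / 1000" using \<epsilon> by (simp add: field_simps)
  have e4: "\<epsilon> ^ 4 \<le> \<epsilon> * \<epsilon> / 1000"
  proof -
    have "\<epsilon> ^ 2 \<le> 1 / 1000" using power_mono[of \<epsilon> "1 / 1000" 2] \<epsilon> by (simp add: power_divide)
    then have "\<epsilon> ^ 2 * \<epsilon> ^ 2 \<le> 1 / 1000 * \<epsilon> ^ 2" by (intro mult_right_mono) auto
    then show ?thesis by (simp add: power2_eq_square power4_eq_xxxx)
  qed
  have "exp (- (3 / 2 * \<epsilon>)) \<le> 1 - 3 / 2 * \<epsilon> + (3 / 2 * \<epsilon>)\<^sup>2 / 2"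
    using \<epsilon> by (intro exp_minus_le) auto
  also have "(3 / 2 * \<epsilon>)\<^sup>2 / 2 = 9 / 8 * (\<epsilon> * \<epsilon>)" by (simp add: power2_eq_square)
  finally have k: "3 / 2 * \<epsilon> - 6 / 5 * (\<epsilon> * \<epsilon>) \<le> 1 - \<epsilon> ^ 4 - exp (- (3 / 2 * \<epsilon>))"
    using e4 zero_le_square[of \<epsilon>] by linarith
  have c: "1 + 9 / 10 * \<epsilon> \<le> (1 + \<epsilon>) * (1 - \<epsilon> / 100)"
  proof -
    have "(1 + \<epsilon>) * (1 - \<epsilon> / 100) = 1 + 99 / 100 * \<epsilon> - (\<epsilon> * \<epsilon>) / 100" by (simp add: field_simps)
    then show ?thesis using e2 \<epsilon> by linarith
  qed
  have "3 / 2 * \<epsilon> * (1 + \<epsilon> / 20) < \<epsilon> * ((1 + 9 / 10 * \<epsilon>) * (3 / 2 - 6 / 5 * \<epsilon>))"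
  proof -
    have "3 / 2 * (1 + \<epsilon> / 20) < (1 + 9 / 10 * \<epsilon>) * (3 / 2 - 6 / 5 * \<epsilon>)"
    proof -
      have "3 / 2 * (1 + \<epsilon> / 20) = 3 / 2 + 3 / 40 * \<epsilon>" by simp
      also have "\<dots> < 3 / 2 + 3 / 20 * \<epsilon> - 27 / 25 * (\<epsilon> * \<epsilon>)"
        using e2 \<epsilon> by linarith
      also have "\<dots> = (1 + 9 / 10 * \<epsilon>) * (3 / 2 - 6 / 5 * \<epsilon>)"
        by (simp add: field_simps)
      finally show ?thesis .
    qed
    then have "\<epsilon> * (3 / 2 * (1 + \<epsilon> / 20)) < \<epsilon> * ((1 + 9 / 10 * \<epsilon>) * (3 / 2 - 6 / 5 * \<epsilon>))"
      using \<epsilon> by (intro mult_strict_left_mono) auto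
    then show ?thesis by (simp only: mult.commute mult.left_commute mult.assoc)
  qed
  also have "\<dots> = (1 + 9 / 10 * \<epsilon>) * (3 / 2 * \<epsilon> - 6 / 5 * (\<epsilon> * \<epsilon>))" by (simp add: algebra_simps)
  also have "\<dots> \<le> (1 + \<epsilon>) * (1 - \<epsilon> / 100) * (1 - \<epsilon> ^ 4 - exp (- (3 / 2 * \<epsilon>)))"
    using c k \<epsilon> e2 by (intro mult_mono) auto
  finally show ?thesis .
qed

text \<open>The main terms \<open>\<epsilon>\<^sup>2 / 64\<close> cancel, and supercriticality
  leaves a margin of order \<open>\<epsilon> ^ 3\<close>. A path of
  \<open>\<beta> * \<epsilon>\<^sup>2 * n\<close> literals costs
  \<open>\<beta> * \<epsilon> ^ 3 / 8\<close>, which is why the path length is of order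
  \<open>\<epsilon>\<^sup>2 * n\<close>.\<close>

lemma dfs_rate:
  fixes \<epsilon> \<beta> :: real
  assumes \<epsilon>: "0 < \<epsilon>" "\<epsilon> < 1 / 1000" and \<beta>: "0 < \<beta>" "\<beta> \<le> 1 / 1000"
  shows "\<epsilon> / 8 * (\<epsilon> / 8 + \<beta> * \<epsilon>\<^sup>2)
    - (1 - exp (- (\<epsilon> / 8))) * ((1 + \<epsilon>) / 2) * (2 * (\<epsilon> / 8) * (1 - \<epsilon> / 8 - \<beta> * \<epsilon>\<^sup>2)) < 0"
proof -
  have e2: "\<epsilon> * \<epsilon> \<le> \<epsilon> / 1000" using \<epsilon> by (simp add: field_simps)
  have b: "\<beta> * \<epsilon> \<le> \<epsilon> / 1000" using \<epsilon> \<beta> by (simp add: field_simps)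
  have b2: "\<beta> * \<epsilon>\<^sup>2 \<le> \<epsilon> / 1000"
  proof -
    have "\<beta> * \<epsilon> * \<epsilon> \<le> \<epsilon> / 1000 * 1" using \<epsilon> b by (intro mult_mono) auto
    then show ?thesis by (simp add: power2_eq_square mult.assoc)
  qed
  have m: "\<epsilon> / 8 * (1 - \<epsilon> / 16) \<le> 1 - exp (- (\<epsilon> / 8))"
    using exp_minus_le[of "\<epsilon> / 8"] \<epsilon> by (simp add: power2_eq_square algebra_simps)
  have "(1 + 9 / 10 * \<epsilon>) * (1 - \<epsilon> / 7) = 1 + 53 / 70 * \<epsilon> - 9 / 70 * (\<epsilon> * \<epsilon>)"
    by (simp add: field_simps)
  then have "1 + 8 * (\<beta> * \<epsilon>) < (1 + 9 / 10 * \<epsilon>) * (1 - \<epsilon> / 7)"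
    using b e2 \<epsilon> by linarith
  also have "\<dots> \<le> ((1 - \<epsilon> / 16) * (1 + \<epsilon>)) * (1 - \<epsilon> / 8 - \<beta> * \<epsilon>\<^sup>2)"
  proof (rule mult_mono)
    have "(1 - \<epsilon> / 16) * (1 + \<epsilon>) = 1 + 15 / 16 * \<epsilon> - (\<epsilon> * \<epsilon>) / 16" by (simp add: field_simps)
    then show "1 + 9 / 10 * \<epsilon> \<le> (1 - \<epsilon> / 16) * (1 + \<epsilon>)" using e2 \<epsilon> by linarith
    show "1 - \<epsilon> / 7 \<le> 1 - \<epsilon> / 8 - \<beta> * \<epsilon>\<^sup>2" using b2 \<epsilon> by linarith
  qed (use \<epsilon> in auto)
  finally have "\<epsilon> / 8 * (\<epsilon> / 8) * (1 + 8 * (\<beta> * \<epsilon>))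
      < \<epsilon> / 8 * (\<epsilon> / 8) * (((1 - \<epsilon> / 16) * (1 + \<epsilon>)) * (1 - \<epsilon> / 8 - \<beta> * \<epsilon>\<^sup>2))"
    using \<epsilon> by (intro mult_strict_left_mono) auto
  also have "\<dots> = \<epsilon> / 8 * (1 - \<epsilon> / 16) * ((1 + \<epsilon>) / 2) * (2 * (\<epsilon> / 8) * (1 - \<epsilon> / 8 - \<beta> * \<epsilon>\<^sup>2))"
    by (simp add: mult_ac)
  also have "\<dots> \<le> (1 - exp (- (\<epsilon> / 8))) * ((1 + \<epsilon>) / 2) * (2 * (\<epsilon> / 8) * (1 - \<epsilon> / 8 - \<beta> * \<epsilon>\<^sup>2))"
    using m b2 \<epsilon> by (intro mult_right_mono mult_nonneg_nonneg) auto
  also have "\<epsilon> / 8 * (\<epsilon> / 8) * (1 + 8 * (\<beta> * \<epsilon>)) = \<epsilon> / 8 * (\<epsilon> / 8 + \<beta> * \<epsilon>\<^sup>2)"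
    by (simp add: power2_eq_square algebra_simps)
  finally show ?thesis by simp
qed

text \<open>Each literal of the path multiplies the number of paths and patterns by
  \<open>(1 + \<epsilon>) * (1 + \<epsilon>\<^sup>2)\<close> and the extinction bound by
  \<open>exp (- 3 / 2 * \<epsilon>)\<close>. The net decay of at least
  \<open>2 / 5 * \<epsilon>\<close> per literal pays for the violation weights.\<close>

lemma path_rate:
  fixes \<epsilon> :: real
  assumes \<epsilon>: "0 < \<epsilon>" "\<epsilon> < 1 / 1000"
  shows "2 * \<epsilon> ^ 3 / 10 ^ 8 + 1 / 10 ^ 7 * \<epsilon>\<^sup>2 * (ln (1 + \<epsilon>) + ln (1 + \<epsilon>\<^sup>2) - 3 / 2 * \<epsilon>) < 0"
proof -
  have "ln (1 + \<epsilon>) + ln (1 + \<epsilon>\<^sup>2) \<le> \<epsilon> + \<epsilon>\<^sup>2"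
    using \<epsilon> by (intro add_mono ln_add_one_self_le_self) auto
  also have "\<epsilon>\<^sup>2 \<le> \<epsilon> / 1000" using \<epsilon> by (simp add: power2_eq_square field_simps)
  finally have "ln (1 + \<epsilon>) + ln (1 + \<epsilon>\<^sup>2) - 3 / 2 * \<epsilon> \<le> - 2 / 5 * \<epsilon>" using \<epsilon> by simp
  then have "1 / 10 ^ 7 * \<epsilon>\<^sup>2 * (ln (1 + \<epsilon>) + ln (1 + \<epsilon>\<^sup>2) - 3 / 2 * \<epsilon>) \<le> 1 / 10 ^ 7 * \<epsilon>\<^sup>2 * (- 2 / 5 * \<epsilon>)"
    by (intro mult_left_mono) auto
  also have "\<dots> = - 4 * \<epsilon> ^ 3 / 10 ^ 8" by (simp add: power2_eq_square power3_eq_cube)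
  finally have le: "1 / 10 ^ 7 * \<epsilon>\<^sup>2 * (ln (1 + \<epsilon>) + ln (1 + \<epsilon>\<^sup>2) - 3 / 2 * \<epsilon>) \<le> - 4 * \<epsilon> ^ 3 / 10 ^ 8" .
  have "2 * E / 10 ^ 8 + a < 0" if "a \<le> - 4 * E / 10 ^ 8" "0 < E" for a E :: real
    using that by simp
  from this[OF le] show ?thesis using \<epsilon> by simp
qed

text \<open>In the other case the queue stays above the barrier for
  \<open>\<epsilon> / 100 * n\<close> steps. The contradictions then gain more than
  \<open>6 / 10 ^ 7 * \<epsilon> ^ 3\<close>, whereas weights, paths and violated unit clauses
  together cost less than \<open>3 / 10 ^ 7 * \<epsilon> ^ 3\<close>; this comparison calls for the
  small factor \<open>1 / 10 ^ 7\<close> in the path length.\<close>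

lemma contradiction_rate:
  fixes \<epsilon> :: real
  assumes \<epsilon>: "0 < \<epsilon>" "\<epsilon> < 1 / 1000"
  shows "2 * \<epsilon> ^ 3 / 10 ^ 8 + 1 / 10 ^ 7 * \<epsilon>\<^sup>2 * (ln (1 + \<epsilon>) + ln (1 + \<epsilon>\<^sup>2))
    + (2 * \<epsilon> ^ 4 * (\<epsilon> / 100) * ((1 + \<epsilon>) / 2)
       - (1 + \<epsilon>) / 2 * (1 - \<epsilon> ^ 4) * (\<epsilon> / 20) * (\<epsilon> / 100 * (\<epsilon> / 100)) / 2) < 0"
proof -
  define E where "E = \<epsilon> ^ 3"
  have E: "0 < E" using \<epsilon> by (simp add: E_def)
  have e2: "\<epsilon>\<^sup>2 \<le> \<epsilon> / 1000" using \<epsilon> by (simp add: power2_eq_square field_simps)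
  have e2': "\<epsilon>\<^sup>2 \<le> 1 / 10 ^ 6"
    using power_mono[of \<epsilon> "1 / 1000" 2] \<epsilon> by (simp add: power_divide)
  have "ln (1 + \<epsilon>) + ln (1 + \<epsilon>\<^sup>2) \<le> \<epsilon> + \<epsilon>\<^sup>2"
    using \<epsilon> by (intro add_mono ln_add_one_self_le_self) auto
  then have "1 / 10 ^ 7 * \<epsilon>\<^sup>2 * (ln (1 + \<epsilon>) + ln (1 + \<epsilon>\<^sup>2)) \<le> 1 / 10 ^ 7 * \<epsilon>\<^sup>2 * (2 * \<epsilon>)"
    using e2 \<epsilon> by (intro mult_left_mono) auto
  also have "\<dots> = 2 * E / 10 ^ 7" by (simp add: E_def power2_eq_square power3_eq_cube)
  finally have 1: "1 / 10 ^ 7 * \<epsilon>\<^sup>2 * (ln (1 + \<epsilon>) + ln (1 + \<epsilon>\<^sup>2)) \<le> 2 * E / 10 ^ 7" .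
  have "2 * \<epsilon> ^ 4 * (\<epsilon> / 100) * ((1 + \<epsilon>) / 2) = E * (\<epsilon>\<^sup>2 * ((1 + \<epsilon>) / 100))"
    by (simp add: E_def power2_eq_square power3_eq_cube power4_eq_xxxx)
  also have "\<dots> \<le> E * (1 / 10 ^ 6 * (2 / 100))"
    using E e2' \<epsilon> by (intro mult_left_mono mult_mono) auto
  finally have 2: "2 * \<epsilon> ^ 4 * (\<epsilon> / 100) * ((1 + \<epsilon>) / 2) \<le> E * (1 / 10 ^ 6 * (2 / 100))" .
  have "\<epsilon> ^ 4 \<le> 1 / 2"
    using power_mono[of \<epsilon> "1 / 1000" 4] \<epsilon> by (simp add: power_divide)
  then have "E * (1 / 2 * (1 / 2) * (1 / 20) * (1 / 10 ^ 4) / 2)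
      \<le> E * ((1 + \<epsilon>) / 2 * (1 - \<epsilon> ^ 4) * (1 / 20) * (1 / 10 ^ 4) / 2)"
    using E \<epsilon> by (intro mult_left_mono divide_right_mono mult_right_mono mult_mono) auto
  also have "\<dots> = (1 + \<epsilon>) / 2 * (1 - \<epsilon> ^ 4) * (\<epsilon> / 20) * (\<epsilon> / 100 * (\<epsilon> / 100)) / 2"
    by (simp add: E_def power3_eq_cube)
  finally have 3: "E * (1 / 2 * (1 / 2) * (1 / 20) * (1 / 10 ^ 4) / 2) \<le> \<dots>" .
  have "2 * E / 10 ^ 8 + a + (b - c) < 0"
    if "a \<le> 2 * E / 10 ^ 7" "b \<le> E * (1 / 10 ^ 6 * (2 / 100))"
      "E * (1 / 2 * (1 / 2) * (1 / 20) * (1 / 10 ^ 4) / 2) \<le> c" for a b c :: real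
    using that E by simp
  from this[OF 1 2 3] show ?thesis unfolding E_def .
qed

text \<open>Three events are balanced: no long path (\<open>E1\<close>), a path whose exploration
  drops to the barrier (\<open>E0 - \<theta> * M\<close>), and one whose exploration stays above it
  despite the contradictions (\<open>E0 + E2\<close>). All three exponents are negative and linear
  in \<open>n\<close>.\<close>

lemma few_violations_limit:
  fixes \<epsilon> :: real
  assumes \<epsilon>: "0 < \<epsilon>" "\<epsilon> < 1 / 1000"
  defines "\<alpha> \<equiv> \<epsilon> ^ 3 / (4 * 10 ^ 8 * ln (1 / \<epsilon>))"
  shows "(\<lambda>n. lexp (nat \<lfloor>(1 + \<epsilon>) * real n\<rfloor>) (clauses_on {1..n})
            (\<lambda>xs. if \<exists>\<sigma>. viol \<sigma> (set xs) \<le> nat \<lfloor>\<alpha> * real n\<rfloor> then 1 else 0)) \<longlonglongrightarrow> 0"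
proof -
  \<comment> \<open>The growth \<open>1 + x\<close> of the number of patterns must stay below the
    gain of order \<epsilon> per literal, while \<open>w = x\<^sup>2\<close> should be no smaller
    than a power of \<epsilon>, so that \<open>ln (1 / w)\<close> is a multiple of
    \<open>ln (1 / \<epsilon>)\<close>.\<close>
  define x where "x = \<epsilon>\<^sup>2"
  define w where "w = x\<^sup>2"
  \<comment> \<open>The factor \<open>3 / 2\<close> lies between the growth rate \<open>\<epsilon>\<close> of the number of paths and the
    exponent \<open>2 * \<epsilon>\<close> of extinction; the other constants only have to be small enough.\<close>
  define \<theta> where "\<theta> = 3 / 2 * \<epsilon>"
  define \<rho> where "\<rho> = \<epsilon> / 20"
  define \<kappa> where "\<kappa> = 1 - w - exp (- \<theta>)"
  define \<mu> where "\<mu> = \<epsilon> / 8"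
  define p where "p = cl_prob \<epsilon>"
  define m where "m n = nat \<lfloor>(1 + \<epsilon>) * real n\<rfloor>" for n
  define k where "k n = nat \<lfloor>\<alpha> * real n\<rfloor>" for n
  define M where "M n = nat \<lfloor>1 / 10 ^ 7 * \<epsilon>\<^sup>2 * real n\<rfloor>" for n
  define T where "T n = nat \<lfloor>\<epsilon> / 100 * real n\<rfloor>" for n
  define d where "d n = nat \<lfloor>\<epsilon> / 8 * real n\<rfloor>" for n
  define E1 where "E1 n = \<mu> * real (d n + Suc (M n))
    - p n * (1 - exp (- \<mu>)) * (2 * real (d n) * (real n - d n - Suc (M n)))" for n
  define E2 where "E2 n = real (T n) * (2 * p n * w * n)
    - p n * (1 - w) * \<rho> * (real (T n) * (real (T n) - 1) / 2)" for n
  define E0 where "E0 n = 2 * real (k n) * ln (1 / w) + real (M n) * (ln (2 * real n * p n) + ln (1 + x))" for n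
  have x: "0 < x" "x \<le> 1" using \<epsilon> by (auto simp: x_def power_le_one)
  have w: "0 < w" "w \<le> 1 / 2"
  proof -
    show "0 < w" using x by (simp add: w_def)
    have "w \<le> (1 / 1000) ^ 4"
      using power_mono[of \<epsilon> "1 / 1000" 4] \<epsilon> by (simp add: w_def x_def)
    then show "w \<le> 1 / 2" by (simp add: power_divide)
  qed
  have w4: "w = \<epsilon> ^ 4" by (simp add: w_def x_def)
  have \<alpha>: "0 \<le> \<alpha>" using \<epsilon> by (simp add: \<alpha>_def)
  have p: "0 \<le> p n" "p n \<le> 1" for n using \<epsilon> cl_prob_bounds[of \<epsilon> n] by (auto simp: p_def)
  have \<kappa>0: "0 < \<kappa>"
  proof -
    have "0 < 3 / 2 * \<epsilon> * (1 + \<epsilon> / 20)" using \<epsilon> by simp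
    also note growth_constant[OF \<epsilon>]
    finally have "0 < (1 + \<epsilon>) * (1 - \<epsilon> / 100) * \<kappa>" by (simp add: \<kappa>_def w4 \<theta>_def)
    moreover have "0 < (1 + \<epsilon>) * (1 - \<epsilon> / 100)" using \<epsilon> by simp
    ultimately show ?thesis by (simp add: zero_less_mult_iff)
  qed
  have \<kappa>w: "2 * \<kappa> \<le> 1 - w"
  proof -
    have "\<kappa> \<le> \<theta>" using exp_ge_add_one_self[of "- \<theta>"] w by (simp add: \<kappa>_def)
    then show ?thesis using \<epsilon> w by (simp add: \<theta>_def)
  qed
  have lim_p: "(\<lambda>n. real n * p n) \<longlonglongrightarrow> (1 + \<epsilon>) / 2"
    unfolding p_def using \<epsilon> by (intro cl_prob_limit) auto
  have lim_c: "(\<lambda>n. 2 * real n * p n) \<longlonglongrightarrow> 1 + \<epsilon>"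
  proof -
    have "2 * ((1 + \<epsilon>) / 2) = 1 + \<epsilon>" by (simp add: field_simps)
    then show ?thesis using tendsto_mult_left[OF lim_p, of 2] by (simp only: mult.assoc)
  qed
  have lim_M: "(\<lambda>n. real (M n) / n) \<longlonglongrightarrow> 1 / 10 ^ 7 * \<epsilon>\<^sup>2"
    unfolding M_def by (intro nat_floor_limit) auto
  have lim_T: "(\<lambda>n. real (T n) / n) \<longlonglongrightarrow> \<epsilon> / 100"
    unfolding T_def using \<epsilon> by (intro nat_floor_limit) auto
  have lim_d: "(\<lambda>n. real (d n) / n) \<longlonglongrightarrow> \<epsilon> / 8"
    unfolding d_def using \<epsilon> by (intro nat_floor_limit) auto
  have lim_k: "(\<lambda>n. real (k n) / n) \<longlonglongrightarrow> \<alpha>"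
    unfolding k_def using \<alpha> by (intro nat_floor_limit)
  have lim_n: "(\<lambda>n. 1 / real n) \<longlonglongrightarrow> 0" by real_asymp
  have pos: "\<forall>\<^sub>F n in sequentially. 0 < real n"
    using eventually_gt_at_top[of "0::nat"] by eventually_elim simp

  have ev_c: "\<forall>\<^sub>F n in sequentially. 0 < 2 * real n * p n"
    using order_tendstoD(1)[OF lim_c, of 0] \<epsilon> by simp
  have ev_d: "\<forall>\<^sub>F n in sequentially. d n + Suc (M n) < n"
  proof -
    have "(\<lambda>n. real (d n) / n + real (M n) / n + 1 / n) \<longlonglongrightarrow> \<epsilon> / 8 + 1 / 10 ^ 7 * \<epsilon>\<^sup>2 + 0"
      by (intro tendsto_add lim_d lim_M lim_n)
    moreover have "\<epsilon>\<^sup>2 \<le> 1" using \<epsilon> by (simp add: power_le_one)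
    then have "\<epsilon> / 8 + 1 / 10 ^ 7 * \<epsilon>\<^sup>2 + 0 < 1" using \<epsilon> by simp
    ultimately have "\<forall>\<^sub>F n in sequentially. real (d n) / n + real (M n) / n + 1 / n < 1"
      by (rule order_tendstoD)
    with pos show ?thesis
    proof eventually_elim
      case (elim n)
      then have "(real (d n) + real (M n) + 1) / n < 1" by (simp add: add_divide_distrib)
      then have "real (d n) + real (M n) + 1 < n" using elim(1) by (simp add: divide_less_eq)
      then show ?case by linarith
    qed
  qed
  have ev_drift: "\<forall>\<^sub>F n in sequentially. \<theta> * (1 + \<rho>) \<le> 2 * p n * (real n - T n) * \<kappa>"
  proof -
    have "(\<lambda>n. 2 * real n * p n * (1 - real (T n) / n) * \<kappa>) \<longlonglongrightarrow> (1 + \<epsilon>) * (1 - \<epsilon> / 100) * \<kappa>"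
      by (intro tendsto_mult tendsto_diff lim_c lim_T tendsto_const)
    moreover have "\<theta> * (1 + \<rho>) < (1 + \<epsilon>) * (1 - \<epsilon> / 100) * \<kappa>"
      using growth_constant[OF \<epsilon>] by (simp add: \<theta>_def \<rho>_def \<kappa>_def w4)
    ultimately have "\<forall>\<^sub>F n in sequentially. \<theta> * (1 + \<rho>) < 2 * real n * p n * (1 - real (T n) / n) * \<kappa>"
      by (rule order_tendstoD)
    with pos show ?thesis
    proof eventually_elim
      case (elim n)
      have eq: "2 * real n * p n * (1 - real (T n) / n) * \<kappa> = 2 * p n * (real n - T n) * \<kappa>"
      proof -
        have "real n * (1 - real (T n) / n) = real n - T n"
          using elim(1) by (simp add: right_diff_distrib)
        then have "2 * p n * (real n * (1 - real (T n) / n)) * \<kappa> = 2 * p n * (real n - T n) * \<kappa>" by simp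
        then show ?thesis by (simp only: mult_ac)
      qed
      show ?case using elim(2) unfolding eq by (rule less_imp_le)
    qed
  qed

  have bound: "\<forall>\<^sub>F n in sequentially. lexp (m n) (clauses_on {1..n})
            (\<lambda>xs. if \<exists>\<sigma>. viol \<sigma> (set xs) \<le> k n then 1 else 0)
      \<le> 2 * exp 1 * (real n ^ 2 * exp (E1 n)) + 4 * exp 1 * (1 + 1 / x) *
          (real n ^ 2 * exp (E0 n - \<theta> * M n) + real n ^ 2 * exp (E0 n + E2 n))"
    using ev_c ev_d ev_drift eventually_ge_at_top[of 2]
  proof eventually_elim
    case (elim n)
    let ?V = "{1..n}"
    let ?S = "clauses_on ?V"
    have cV: "card ?V = n" by simp
    have mn: "1 \<le> m n" "real (m n) \<le> 2 * n"
    proof -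
      have "real n \<le> (1 + \<epsilon>) * real n" using mult_right_mono[of 1 "1 + \<epsilon>" "real n"] \<epsilon> by simp
      then have "int n \<le> \<lfloor>(1 + \<epsilon>) * real n\<rfloor>" by (simp add: le_floor_iff)
      then show "1 \<le> m n" using elim(4) unfolding m_def by linarith
      have "(1 + \<epsilon>) * real n \<le> 2 * real n" using \<epsilon> by (intro mult_right_mono) auto
      moreover have "0 \<le> (1 + \<epsilon>) * real n" using \<epsilon> by simp
      ultimately show "real (m n) \<le> 2 * n" unfolding m_def by linarith
    qed
    have "real (card ?S) > 0"
      unfolding card_clauses_on_atLeastAtMost using elim(4) by simp
    then have S: "finite ?S" "?S \<noteq> {}" by auto
    define Q where "Q = exp (- \<theta> * M n) + exp (E2 n)"
    have Q: "bexp (p n) ?S (best w D \<tau>) \<le> Q" if "D \<subseteq> ?V" "card D = Suc (M n)" for D \<tau>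
    proof -
      have "bexp (p n) ?S (best w D \<tau>)
        \<le> exp (- \<theta> * (card D - (1 + \<rho> * (real (T n) - real (T n)))))
          + exp (\<Sum>j<T n. 2 * p n * w * real n - p n * (1 - w) * \<rho> * (real (T n) - real (Suc j)))"
        by (rule exploration_bound[where \<kappa> = \<kappa> and ?n1.0 = "real n - T n"])
           (use p w \<epsilon> \<kappa>0 \<kappa>w elim(3) that in \<open>auto simp: \<theta>_def \<rho>_def \<kappa>_def\<close>)
      also have "(\<Sum>j<T n. 2 * p n * w * real n - p n * (1 - w) * \<rho> * (real (T n) - real (Suc j))) = E2 n"
      proof -
        have g: "(\<Sum>j<t. real t' - real (Suc j)) = real t * real t' - real t * (real t + 1) / 2" for t t'
          by (induction t) (simp_all add: field_simps)
        have "(\<Sum>j<T n. real (T n) - real (Suc j)) = real (T n) * (real (T n) - 1) / 2"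
          unfolding g by (simp add: field_simps)
        then show ?thesis
          by (simp add: E2_def sum_subtractf sum_distrib_left[symmetric])
      qed
      finally show ?thesis using that by (simp add: Q_def)
    qed
    have np: "bexp (p n) ?S (\<lambda>B. if has_path ?V (Suc (M n)) B then 0 else 1) \<le> exp (E1 n)"
      using no_path_bound[of "p n" \<mu> "d n" "Suc (M n)" ?V] p elim(2) \<epsilon>
      by (simp add: E1_def \<mu>_def)
    have "bexp (p n) ?S (\<lambda>B. if \<exists>\<sigma>. viol \<sigma> B \<le> k n then 1 else 0)
      \<le> bexp (p n) ?S (\<lambda>B. if has_path ?V (Suc (M n)) B then 0 else 1)
        + (1 / w) ^ (2 * k n) * (2 * real (card ?V)) ^ Suc (M n) * p n ^ M n *
            ((1 + 1 / x) * (1 + x) ^ M n) * \<bar>Q\<bar>"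
      by (rule few_violations_bound) (use p x w_def Q in auto)
    \<comment> \<open>One of the \<open>M n + 1\<close> literals is free and leaves a factor
      \<open>2 * n\<close>; each other one contributes \<open>2 * n * p n\<close>, the mean number
      of implications.\<close>
    also have "(1 / w) ^ (2 * k n) * (2 * real (card ?V)) ^ Suc (M n) * p n ^ M n *
            ((1 + 1 / x) * (1 + x) ^ M n) * \<bar>Q\<bar>
        = 2 * real n * (1 + 1 / x) * ((1 / w) ^ (2 * k n) * (2 * real n * p n) ^ M n * (1 + x) ^ M n) * Q"
      by (simp add: Q_def power_mult_distrib mult_ac)
    also have "(1 / w) ^ (2 * k n) * (2 * real n * p n) ^ M n * (1 + x) ^ M n = exp (E0 n)"
    proof -
      have "(1 / w) ^ (2 * k n) = exp (2 * real (k n) * ln (1 / w))"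
        using power_eq_exp[of "1 / w" "2 * k n"] w by simp
      moreover have "(2 * real n * p n) ^ M n = exp (real (M n) * ln (2 * real n * p n))"
        using elim(1) by (rule power_eq_exp)
      moreover have "(1 + x) ^ M n = exp (real (M n) * ln (1 + x))"
        using x by (intro power_eq_exp) auto
      ultimately show ?thesis by (simp add: E0_def exp_add distrib_left)
    qed
    also have "2 * real n * (1 + 1 / x) * exp (E0 n) * Q
        = 2 * real n * (1 + 1 / x) * (exp (E0 n - \<theta> * M n) + exp (E0 n + E2 n))"
      by (simp add: Q_def exp_add[symmetric] distrib_left mult.assoc)
    finally have b: "bexp (p n) ?S (\<lambda>B. if \<exists>\<sigma>. viol \<sigma> B \<le> k n then 1 else 0)
      \<le> exp (E1 n) + 2 * real n * (1 + 1 / x) * (exp (E0 n - \<theta> * M n) + exp (E0 n + E2 n))"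
      using np by linarith
    have "lexp (m n) ?S (\<lambda>xs. if \<exists>\<sigma>. viol \<sigma> (set xs) \<le> k n then 1 else 0)
        \<le> exp 1 * m n * bexp (p n) ?S (\<lambda>B. if \<exists>\<sigma>. viol \<sigma> B \<le> k n then 1 else 0)"
      unfolding p_def cl_prob_def m_def[symmetric]
      by (rule lexp_le_bexp[OF S mn(1), of "\<lambda>B. if \<exists>\<sigma>. viol \<sigma> B \<le> k n then 1 else 0"]) simp
    also have "\<dots> \<le> exp 1 * (2 * n) *
        (exp (E1 n) + 2 * real n * (1 + 1 / x) * (exp (E0 n - \<theta> * M n) + exp (E0 n + E2 n)))"
      using b mn p x by (intro mult_mono) (auto intro!: bexp_nonneg add_nonneg_nonneg)
    also have "\<dots> = 2 * exp 1 * (real n * exp (E1 n)) + 4 * exp 1 * (1 + 1 / x) *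
          (real n ^ 2 * exp (E0 n - \<theta> * M n) + real n ^ 2 * exp (E0 n + E2 n))"
      by (simp add: power2_eq_square distrib_left mult_ac)
    also have "\<dots> \<le> 2 * exp 1 * (real n ^ 2 * exp (E1 n)) + 4 * exp 1 * (1 + 1 / x) *
          (real n ^ 2 * exp (E0 n - \<theta> * M n) + real n ^ 2 * exp (E0 n + E2 n))"
      using elim(4) self_le_power[of "real n" 2]
      by (intro add_right_mono mult_left_mono mult_right_mono) auto
    finally show ?case .
  qed

  have lim1: "(\<lambda>n. real n ^ 2 * exp (E1 n)) \<longlonglongrightarrow> 0"
  proof (rule poly_exp_limit)
    have "(\<lambda>n. \<mu> * (real (d n) / n + real (M n) / n + 1 / n)
        - (1 - exp (- \<mu>)) * (real n * p n) * (2 * (real (d n) / n) * (1 - real (d n) / n - real (M n) / n - 1 / n)))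
      \<longlonglongrightarrow> \<mu> * (\<epsilon> / 8 + 1 / 10 ^ 7 * \<epsilon>\<^sup>2 + 0)
        - (1 - exp (- \<mu>)) * ((1 + \<epsilon>) / 2) * (2 * (\<epsilon> / 8) * (1 - \<epsilon> / 8 - 1 / 10 ^ 7 * \<epsilon>\<^sup>2 - 0))"
      by (intro tendsto_add tendsto_diff tendsto_mult tendsto_const lim_d lim_M lim_n lim_p)
    then show "(\<lambda>n. E1 n / n) \<longlonglongrightarrow> \<mu> * (\<epsilon> / 8 + 1 / 10 ^ 7 * \<epsilon>\<^sup>2)
        - (1 - exp (- \<mu>)) * ((1 + \<epsilon>) / 2) * (2 * (\<epsilon> / 8) * (1 - \<epsilon> / 8 - 1 / 10 ^ 7 * \<epsilon>\<^sup>2))"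
      unfolding add_0_right diff_zero
    proof (rule Lim_transform_eventually)
      have eq: "\<mu> * (D / N + MM / N + 1 / N) - c * (N * P) * (2 * (D / N) * (1 - D / N - MM / N - 1 / N))
        = (\<mu> * (D + (1 + MM)) - P * c * (2 * D * (N - D - (1 + MM)))) / N" if "0 < N" for D MM N P c :: real
        using that by (simp add: field_simps)
      show "\<forall>\<^sub>F n in sequentially. \<mu> * (real (d n) / n + real (M n) / n + 1 / n)
        - (1 - exp (- \<mu>)) * (real n * p n) * (2 * (real (d n) / n) * (1 - real (d n) / n - real (M n) / n - 1 / n))
        = E1 n / n"
        using pos unfolding E1_def of_nat_add of_nat_Suc by (rule eventually_mono) (rule eq)
    qed
    show "\<mu> * (\<epsilon> / 8 + 1 / 10 ^ 7 * \<epsilon>\<^sup>2)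
        - (1 - exp (- \<mu>)) * ((1 + \<epsilon>) / 2) * (2 * (\<epsilon> / 8) * (1 - \<epsilon> / 8 - 1 / 10 ^ 7 * \<epsilon>\<^sup>2)) < 0"
      unfolding \<mu>_def using dfs_rate[OF \<epsilon>, of "1 / 10 ^ 7"] by simp
  qed
  have lim_ln: "(\<lambda>n. ln (2 * real n * p n)) \<longlonglongrightarrow> ln (1 + \<epsilon>)"
    using \<epsilon> by (intro tendsto_ln lim_c) auto
  \<comment> \<open>The logarithm in \<alpha> cancels \<open>ln (1 / w)\<close>, so the weights cost
    a fixed small multiple of \<open>\<epsilon> ^ 3\<close>.\<close>
  have \<alpha>w: "2 * \<alpha> * ln (1 / w) = 2 * \<epsilon> ^ 3 / 10 ^ 8"
  proof -
    have "ln (1 / w) = 4 * ln (1 / \<epsilon>)" using \<epsilon> by (simp add: w4 ln_div ln_realpow)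
    moreover have "ln (1 / \<epsilon>) \<noteq> 0" using \<epsilon> by simp
    ultimately show ?thesis unfolding \<alpha>_def by simp
  qed
  have lim3: "(\<lambda>n. real n ^ 2 * exp (E0 n - \<theta> * M n)) \<longlonglongrightarrow> 0"
  proof (rule poly_exp_limit)
    have "(\<lambda>n. 2 * (real (k n) / n) * ln (1 / w) + real (M n) / n * (ln (2 * real n * p n) + ln (1 + x) - \<theta>))
      \<longlonglongrightarrow> 2 * \<alpha> * ln (1 / w) + 1 / 10 ^ 7 * \<epsilon>\<^sup>2 * (ln (1 + \<epsilon>) + ln (1 + x) - \<theta>)"
      by (intro tendsto_add tendsto_diff tendsto_mult tendsto_const lim_k lim_M lim_ln)
    then show "(\<lambda>n. (E0 n - \<theta> * M n) / n) \<longlonglongrightarrow>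
        2 * \<alpha> * ln (1 / w) + 1 / 10 ^ 7 * \<epsilon>\<^sup>2 * (ln (1 + \<epsilon>) + ln (1 + x) - \<theta>)"
    proof (rule Lim_transform_eventually)
      have eq: "2 * (K / N) * l + MM / N * (a + b - c) = (2 * K * l + MM * (a + b) - c * MM) / N"
        if "0 < N" for K N l MM a b c :: real
        using that by (simp add: field_simps)
      show "\<forall>\<^sub>F n in sequentially. 2 * (real (k n) / n) * ln (1 / w) + real (M n) / n * (ln (2 * real n * p n) + ln (1 + x) - \<theta>)
        = (E0 n - \<theta> * M n) / n"
        using pos unfolding E0_def by (rule eventually_mono) (rule eq)
    qed
    show "2 * \<alpha> * ln (1 / w) + 1 / 10 ^ 7 * \<epsilon>\<^sup>2 * (ln (1 + \<epsilon>) + ln (1 + x) - \<theta>) < 0"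
      using path_rate[OF \<epsilon>] unfolding \<alpha>w x_def \<theta>_def .
  qed
  have lim4: "(\<lambda>n. real n ^ 2 * exp (E0 n + E2 n)) \<longlonglongrightarrow> 0"
  proof (rule poly_exp_limit)
    have half: "(\<lambda>n. (real n * p n) * (1 - w) * \<rho> * (real (T n) / n * (real (T n) / n - 1 / n)) / 2)
      \<longlonglongrightarrow> (1 + \<epsilon>) / 2 * (1 - w) * \<rho> * (\<epsilon> / 100 * (\<epsilon> / 100 - 0)) / 2"
      by (rule tendsto_divide[OF _ tendsto_const])
         (intro tendsto_diff tendsto_mult tendsto_const lim_T lim_p lim_n, simp)
    have "(\<lambda>n. 2 * (real (k n) / n) * ln (1 / w) + real (M n) / n * (ln (2 * real n * p n) + ln (1 + x))
        + (2 * w * (real (T n) / n) * (real n * p n)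
            - (real n * p n) * (1 - w) * \<rho> * (real (T n) / n * (real (T n) / n - 1 / n)) / 2))
      \<longlonglongrightarrow> 2 * \<alpha> * ln (1 / w) + 1 / 10 ^ 7 * \<epsilon>\<^sup>2 * (ln (1 + \<epsilon>) + ln (1 + x))
        + (2 * w * (\<epsilon> / 100) * ((1 + \<epsilon>) / 2)
            - (1 + \<epsilon>) / 2 * (1 - w) * \<rho> * (\<epsilon> / 100 * (\<epsilon> / 100 - 0)) / 2)"
      by (intro half tendsto_add tendsto_diff[OF _ half] tendsto_mult tendsto_const lim_k lim_M lim_ln
          lim_T lim_p)
    then show "(\<lambda>n. (E0 n + E2 n) / n) \<longlonglongrightarrow>
        2 * \<alpha> * ln (1 / w) + 1 / 10 ^ 7 * \<epsilon>\<^sup>2 * (ln (1 + \<epsilon>) + ln (1 + x))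
        + (2 * w * (\<epsilon> / 100) * ((1 + \<epsilon>) / 2)
            - (1 + \<epsilon>) / 2 * (1 - w) * \<rho> * (\<epsilon> / 100 * (\<epsilon> / 100)) / 2)"
      unfolding diff_zero
    proof (rule Lim_transform_eventually)
      have eq: "2 * (K / N) * l + MM / N * (a + b) + (2 * w * (t / N) * (N * P)
            - (N * P) * (1 - w) * \<rho> * (t / N * (t / N - 1 / N)) / 2)
         = (2 * K * l + MM * (a + b) + (t * (2 * P * w * N) - P * (1 - w) * \<rho> * (t * (t - 1) / 2))) / N"
        if "0 < N" for K N l MM a b t P :: real
        using that by (simp add: field_simps)
      show "\<forall>\<^sub>F n in sequentially. 2 * (real (k n) / n) * ln (1 / w) + real (M n) / n * (ln (2 * real n * p n) + ln (1 + x))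
        + (2 * w * (real (T n) / n) * (real n * p n)
            - (real n * p n) * (1 - w) * \<rho> * (real (T n) / n * (real (T n) / n - 1 / n)) / 2)
        = (E0 n + E2 n) / n"
        using pos unfolding E0_def E2_def by (rule eventually_mono) (rule eq)
    qed
    show "2 * \<alpha> * ln (1 / w) + 1 / 10 ^ 7 * \<epsilon>\<^sup>2 * (ln (1 + \<epsilon>) + ln (1 + x))
        + (2 * w * (\<epsilon> / 100) * ((1 + \<epsilon>) / 2)
            - (1 + \<epsilon>) / 2 * (1 - w) * \<rho> * (\<epsilon> / 100 * (\<epsilon> / 100)) / 2) < 0"
      using contradiction_rate[OF \<epsilon>] unfolding \<alpha>w unfolding x_def \<rho>_def w4 .
  qed
  have "(\<lambda>n. 2 * exp 1 * (real n ^ 2 * exp (E1 n)) + 4 * exp 1 * (1 + 1 / x) *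
          (real n ^ 2 * exp (E0 n - \<theta> * M n) + real n ^ 2 * exp (E0 n + E2 n)))
      \<longlonglongrightarrow> 2 * exp 1 * 0 + 4 * exp 1 * (1 + 1 / x) * (0 + 0)"
    by (intro tendsto_add tendsto_mult tendsto_const lim1 lim3 lim4)
  then have lim: "(\<lambda>n. 2 * exp 1 * (real n ^ 2 * exp (E1 n)) + 4 * exp 1 * (1 + 1 / x) *
          (real n ^ 2 * exp (E0 n - \<theta> * M n) + real n ^ 2 * exp (E0 n + E2 n))) \<longlonglongrightarrow> 0" by simp
  show ?thesis
    unfolding m_def[symmetric] k_def[symmetric]
    by (rule tendsto_sandwich[OF _ bound tendsto_const lim])
       (auto intro!: always_eventually lexp_nonneg)
qed

section \<open>From violated clauses to the expected maximum\<close>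

lemma length_filter_not_satisfied:
  "viol \<sigma> (set F) + length (filter (satisfies \<sigma>) F) \<le> length F"
proof -
  have "viol \<sigma> (set F) = card (set (filter (\<lambda>C. \<not> satisfies \<sigma> C) F))"
    by (simp add: viol_def)
  also have "\<dots> \<le> length (filter (\<lambda>C. \<not> satisfies \<sigma> C) F)" by (rule card_length)
  finally show ?thesis
    using sum_length_filter_compl[of "satisfies \<sigma>" F] by simp
qed

lemma finite_max_sat_range: "finite (range (\<lambda>\<sigma>. length (filter (satisfies \<sigma>) F)))"
  by (rule finite_subset[of _ "{..length F}"]) (auto simp: length_filter_le)

lemma expected_max_sat_eq:
  assumes "n \<ge> 2"
  shows "expected_max_sat n m = lexp m (clauses_on {1..n}) (\<lambda>F. real (max_sat F))"
proof -
  have "real (card (clauses_on {1..n})) > 0"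
    unfolding card_clauses_on_atLeastAtMost using assms by simp
  then have "finite (clauses_on {1..n})" "clauses_on {1..n} \<noteq> {}" by auto
  then show ?thesis
    unfolding expected_max_sat_def random_2sat_def proper_clauses_eq
    by (rule replicate_pmf_expectation)
qed

text \<open>Either every assignment violates at least \<open>k + 1\<close> distinct clauses, and
  \<open>max_sat\<close> loses that much, or the trivial bound \<open>m\<close> is used.\<close>

lemma expected_max_sat_upper:
  assumes "n \<ge> 2"
  shows "expected_max_sat n m \<le> real m - (real k + 1) *
    (1 - lexp m (clauses_on {1..n}) (\<lambda>xs. if \<exists>\<sigma>. viol \<sigma> (set xs) \<le> k then 1 else 0))"
proof -
  let ?S = "clauses_on {1..n}"
  have "real (card ?S) > 0"
    unfolding card_clauses_on_atLeastAtMost using assms by simp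
  then have S: "finite ?S" "?S \<noteq> {}" by auto
  have "lexp m ?S (\<lambda>F. real (max_sat F))
      \<le> lexp m ?S (\<lambda>F. (real m - (real k + 1)) + (real k + 1) * (if \<exists>\<sigma>. viol \<sigma> (set F) \<le> k then 1 else 0))"
  proof (rule lexp_mono)
    fix F :: "clause list" assume F: "length F = m"
    obtain \<sigma> where \<sigma>: "max_sat F = length (filter (satisfies \<sigma>) F)"
      using Max_in[OF finite_max_sat_range[of F]] unfolding max_sat_def by blast
    show "real (max_sat F) \<le> (real m - (real k + 1)) + (real k + 1) * (if \<exists>\<sigma>. viol \<sigma> (set F) \<le> k then 1 else 0)"
    proof (cases "\<exists>\<sigma>. viol \<sigma> (set F) \<le> k")
      case True
      then show ?thesis using length_filter_not_satisfied[of \<sigma> F] F \<sigma> by simp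
    next
      case False
      then have "k + 1 \<le> viol \<sigma> (set F)" by (simp add: not_le Suc_leI)
      then show ?thesis using False length_filter_not_satisfied[of \<sigma> F] F \<sigma> by simp
    qed
  qed
  also have "\<dots> = (real m - (real k + 1)) + (real k + 1) * lexp m ?S (\<lambda>F. if \<exists>\<sigma>. viol \<sigma> (set F) \<le> k then 1 else 0)"
    using S by (simp add: lexp_add lexp_cmult)
  finally show ?thesis
    unfolding expected_max_sat_eq[OF assms] by (simp add: algebra_simps)
qed

lemma upper_bound:
  fixes \<epsilon> :: real
  assumes \<epsilon>: "0 < \<epsilon>" "\<epsilon> < 1 / 1000"
  defines "\<alpha> \<equiv> \<epsilon> ^ 3 / (4 * 10 ^ 8 * ln (1 / \<epsilon>))"
  shows "asymp_le (\<lambda>n. expected_max_sat n (nat \<lfloor>(1 + \<epsilon>) * real n\<rfloor>)) (\<lambda>n. (1 + \<epsilon> - \<alpha>) * real n)"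
proof -
  define P where "P n = lexp (nat \<lfloor>(1 + \<epsilon>) * real n\<rfloor>) (clauses_on {1..n})
            (\<lambda>xs. if \<exists>\<sigma>. viol \<sigma> (set xs) \<le> nat \<lfloor>\<alpha> * real n\<rfloor> then 1 else 0)" for n
  have P: "P \<longlonglongrightarrow> 0"
    using few_violations_limit[OF \<epsilon>] unfolding P_def[abs_def] \<alpha>_def .
  have ln: "1 / 2 \<le> ln (1 / \<epsilon>)"
  proof -
    have "ln \<epsilon> \<le> \<epsilon> - 1" using \<epsilon> by (intro ln_le_minus_one)
    then show ?thesis using \<epsilon> by (simp add: ln_div)
  qed
  have \<alpha>: "0 \<le> \<alpha>" "\<alpha> \<le> 1 / 2"
  proof -
    show "0 \<le> \<alpha>" using \<epsilon> ln by (simp add: \<alpha>_def)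
    have "\<epsilon> ^ 3 \<le> 1" using \<epsilon> by (simp add: power_le_one)
    then have "\<alpha> \<le> 1 / (4 * 10 ^ 8 * ln (1 / \<epsilon>))"
      unfolding \<alpha>_def using ln by (intro divide_right_mono) auto
    also have "\<dots> \<le> 1 / (4 * 10 ^ 8 * (1 / 2))"
      using ln by (intro divide_left_mono mult_left_mono) auto
    finally show "\<alpha> \<le> 1 / 2" by simp
  qed
  define q where "q = 1 + \<epsilon> - \<alpha>"
  have q: "0 < q" using \<alpha> \<epsilon> by (simp add: q_def)
  define g where "g n = (1 + \<epsilon> - (real (nat \<lfloor>\<alpha> * real n\<rfloor>) / n + 1 / n) * (1 - P n)) / q" for n :: nat
  have "g \<longlonglongrightarrow> (1 + \<epsilon> - (\<alpha> + 0) * (1 - 0)) / q"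
    unfolding g_def[abs_def]
  proof (rule tendsto_divide)
    show "(\<lambda>n. 1 + \<epsilon> - (real (nat \<lfloor>\<alpha> * real n\<rfloor>) / n + 1 / n) * (1 - P n)) \<longlonglongrightarrow> 1 + \<epsilon> - (\<alpha> + 0) * (1 - 0)"
    proof (intro tendsto_diff tendsto_mult tendsto_add tendsto_const P nat_floor_limit \<alpha>)
      show "(\<lambda>n. 1 / real n) \<longlonglongrightarrow> 0" by real_asymp
    qed
  qed (use q in auto)
  then have "g \<longlonglongrightarrow> 1" using q by (simp add: q_def)
  then have "limsup (\<lambda>n. ereal (g n)) = 1"
    by (intro lim_imp_Limsup) (auto simp: one_ereal_def)
  moreover have "limsup (\<lambda>n. ereal (expected_max_sat n (nat \<lfloor>(1 + \<epsilon>) * real n\<rfloor>) / (q * real n)))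
      \<le> limsup (\<lambda>n. ereal (g n))"
  proof (rule Limsup_mono)
    show "\<forall>\<^sub>F n in sequentially. ereal (expected_max_sat n (nat \<lfloor>(1 + \<epsilon>) * real n\<rfloor>) / (q * real n)) \<le> ereal (g n)"
      using eventually_ge_at_top[of 2]
    proof eventually_elim
      case (elim n)
      let ?m = "nat \<lfloor>(1 + \<epsilon>) * real n\<rfloor>" and ?k = "nat \<lfloor>\<alpha> * real n\<rfloor>"
      have n: "0 < real n" using elim by simp
      have "0 \<le> (1 + \<epsilon>) * real n" using \<epsilon> by simp
      then have m: "real ?m \<le> (1 + \<epsilon>) * real n" by linarith
      have "expected_max_sat n ?m \<le> real ?m - (real ?k + 1) * (1 - P n)"
        unfolding P_def by (rule expected_max_sat_upper[OF elim])
      also have "\<dots> \<le> (1 + \<epsilon>) * real n - (real ?k + 1) * (1 - P n)" using m by simp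
      also have "\<dots> = g n * (q * real n)"
      proof -
        have "a * N - (K + 1) * r = (a - (K / N + 1 / N) * r) / q * (q * N)" if "0 < N" for a N K r :: real
          using that q by (simp add: field_simps)
        from this[OF n] show ?thesis unfolding g_def .
      qed
      finally have "expected_max_sat n ?m / (q * real n) \<le> g n"
        using n q by (simp add: divide_le_eq)
      then show ?case by simp
    qed
  qed
  ultimately show ?thesis by (simp add: asymp_le_def q_def)
qed

section \<open>Violated clauses and independent cycles\<close>

definition conn :: "('a \<times> 'a) set \<Rightarrow> ('a \<times> 'a) set" where
  "conn A = (A \<union> A\<inverse>)\<^sup>*"

lemma conn_refl [simp]: "(x, x) \<in> conn A"
  by (simp add: conn_def)

lemma conn_sym: "(x, y) \<in> conn A \<Longrightarrow> (y, x) \<in> conn A"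
proof -
  have "sym (A \<union> A\<inverse>)" by (auto simp: sym_def)
  then have "sym (conn A)" unfolding conn_def by (rule sym_rtrancl)
  then show "(x, y) \<in> conn A \<Longrightarrow> (y, x) \<in> conn A" by (rule symD)
qed

lemma conn_trans: "(x, y) \<in> conn A \<Longrightarrow> (y, z) \<in> conn A \<Longrightarrow> (x, z) \<in> conn A"
  unfolding conn_def by (rule rtrancl_trans)

lemma conn_mono: "A \<subseteq> B \<Longrightarrow> conn A \<subseteq> conn B"
  unfolding conn_def by (intro rtrancl_mono) auto

lemma conn_base: "(x, y) \<in> A \<Longrightarrow> (x, y) \<in> conn A"
  unfolding conn_def by auto

lemma conn_insert:
  "(x, y) \<in> conn (insert (a, b) A) \<longleftrightarrow>
     (x, y) \<in> conn A \<or> (x, a) \<in> conn A \<and> (b, y) \<in> conn A \<or> (x, b) \<in> conn A \<and> (a, y) \<in> conn A"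
proof -
  have "insert (a, b) A \<union> (insert (a, b) A)\<inverse> = insert (a, b) (insert (b, a) (A \<union> A\<inverse>))" by auto
  then have "(x, y) \<in> conn (insert (a, b) A) \<longleftrightarrow>
     (x, y) \<in> conn A \<or> (x, b) \<in> conn A \<and> (a, y) \<in> conn A \<or>
     ((x, a) \<in> conn A \<or> (x, b) \<in> conn A \<and> (a, a) \<in> conn A) \<and>
     ((b, y) \<in> conn A \<or> (b, b) \<in> conn A \<and> (a, y) \<in> conn A)"
    unfolding conn_def by (simp add: rtrancl_insert)
  then show ?thesis
    using conn_trans[of x a A y] conn_trans[of x b A y] conn_refl by metis
qed

lemma conn_subsetI: "(\<And>x y. (x, y) \<in> A \<Longrightarrow> (x, y) \<in> conn B) \<Longrightarrow> conn A \<subseteq> conn B"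
proof (rule subrelI)
  fix x y assume sub: "\<And>x y. (x, y) \<in> A \<Longrightarrow> (x, y) \<in> conn B" and xy: "(x, y) \<in> conn A"
  show "(x, y) \<in> conn B"
    using xy unfolding conn_def[of A]
  proof (induction rule: rtrancl_induct)
    case (step y z)
    have "(y, z) \<in> A \<or> (z, y) \<in> A" using step.hyps by simp
    then have "(y, z) \<in> conn B" using sub[of y z] sub[of z y] conn_sym[of z y B] by blast
    with step.IH show ?case by (rule conn_trans)
  qed simp
qed

text \<open>The least vertex represents its component, so \<open>card (reps V A)\<close> counts
  components without forming a quotient.\<close>

definition reps :: "nat set \<Rightarrow> (nat \<times> nat) set \<Rightarrow> nat set" where
  "reps V A = {v \<in> V. \<forall>u\<in>V. (v, u) \<in> conn A \<longrightarrow> v \<le> u}"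

lemma reps_cong: "conn A = conn B \<Longrightarrow> reps V A = reps V B"
  by (simp add: reps_def)

text \<open>An edge between different components merges them; of their two minima the larger one,
  \<open>r\<close>, ceases to be a representative.\<close>

lemma card_reps_insert:
  assumes V: "finite V" and ab: "a \<in> V" "b \<in> V"
  shows "card (reps V A) = card (reps V (insert (a, b) A)) + (if (a, b) \<in> conn A then 0 else 1)"
proof (cases "(a, b) \<in> conn A")
  case True
  have "(x, y) \<in> conn (insert (a, b) A) \<longleftrightarrow> (x, y) \<in> conn A" for x y
    unfolding conn_insert using True conn_trans conn_sym by metis
  then have "conn (insert (a, b) A) = conn A" by auto
  then show ?thesis using True by (simp add: reps_def)
next
  case False
  define cls where "cls x = {u \<in> V. (x, u) \<in> conn A}" for x
  have cls: "finite (cls a)" "finite (cls b)" "a \<in> cls a" "b \<in> cls b"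
    using V ab by (auto simp: cls_def)
  define r where "r = max (Min (cls a)) (Min (cls b))"
  have disj: "cls a \<inter> cls b = {}"
  proof (rule ccontr)
    assume "cls a \<inter> cls b \<noteq> {}"
    then obtain u where "(a, u) \<in> conn A" "(b, u) \<in> conn A" by (auto simp: cls_def)
    then have "(a, b) \<in> conn A" using conn_trans conn_sym by metis
    with False show False by simp
  qed
  have Min_in': "Min (cls a) \<in> cls a" "Min (cls b) \<in> cls b"
    using cls by (auto intro!: Min_in)
  then have neq: "Min (cls a) \<noteq> Min (cls b)" using disj by auto
  have reps_iff: "x \<in> reps V B \<longleftrightarrow> x \<in> V \<and> (\<forall>u\<in>V. (x, u) \<in> conn B \<longrightarrow> x \<le> u)" for x B
    by (simp add: reps_def)
  have rep_cls: "x \<in> reps V A \<longleftrightarrow> x = Min (cls y)" if "x \<in> cls y" "y \<in> {a, b}" for x y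
  proof
    assume x: "x \<in> reps V A"
    have "x \<le> u" if "u \<in> cls y" for u
    proof -
      have "(y, x) \<in> conn A" "(y, u) \<in> conn A" using that \<open>x \<in> cls y\<close> by (auto simp: cls_def)
      then have "(x, u) \<in> conn A" by (rule conn_trans[OF conn_sym])
      then show ?thesis using x that by (auto simp: reps_iff cls_def)
    qed
    then show "x = Min (cls y)" using \<open>x \<in> cls y\<close> V by (intro Min_eqI[symmetric]) (auto simp: cls_def)
  next
    assume x: "x = Min (cls y)"
    have "x \<le> u" if "u \<in> V" "(x, u) \<in> conn A" for u
    proof -
      have "u \<in> cls y" using that \<open>x \<in> cls y\<close> conn_trans[of y x A u] by (auto simp: cls_def)
      then show ?thesis unfolding x using V by (intro Min_le) (auto simp: cls_def)
    qed
    then show "x \<in> reps V A" using \<open>x \<in> cls y\<close> by (auto simp: reps_iff cls_def)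
  qed
  have sub: "(x, u) \<in> conn A \<Longrightarrow> (x, u) \<in> conn (insert (a, b) A)" for x u
    by (simp add: conn_insert)
  have r_rep: "r \<in> reps V A"
    using rep_cls[of _ a] rep_cls[of _ b] Min_in' by (auto simp: r_def max_def)
  have "reps V (insert (a, b) A) = reps V A - {r}"
  proof (intro set_eqI iffI)
    fix x assume x: "x \<in> reps V (insert (a, b) A)"
    then have "x \<in> reps V A" using sub by (auto simp: reps_iff)
    moreover have "x \<noteq> r"
    proof
      assume "x = r"
      then consider "x = Min (cls a)" "Min (cls b) < x" | "x = Min (cls b)" "Min (cls a) < x"
        using neq by (auto simp: r_def max_def split: if_splits)
      then show False
      proof cases
        case 1
        have "(x, a) \<in> conn A" "(b, Min (cls b)) \<in> conn A" "Min (cls b) \<in> V"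
          using Min_in' 1 conn_sym by (auto simp: cls_def)
        then have "(x, Min (cls b)) \<in> conn (insert (a, b) A)" by (simp add: conn_insert)
        then show False using x 1 \<open>Min (cls b) \<in> V\<close> by (auto simp: reps_iff)
      next
        case 2
        have "(x, b) \<in> conn A" "(a, Min (cls a)) \<in> conn A" "Min (cls a) \<in> V"
          using Min_in' 2 conn_sym by (auto simp: cls_def)
        then have "(x, Min (cls a)) \<in> conn (insert (a, b) A)" by (simp add: conn_insert)
        then show False using x 2 \<open>Min (cls a) \<in> V\<close> by (auto simp: reps_iff)
      qed
    qed
    ultimately show "x \<in> reps V A - {r}" by simp
  next
    fix x assume x: "x \<in> reps V A - {r}"
    have "x \<le> u" if u: "u \<in> V" "(x, u) \<in> conn (insert (a, b) A)" for u
    proof -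
      consider "(x, u) \<in> conn A" | "(x, a) \<in> conn A" "(b, u) \<in> conn A" | "(x, b) \<in> conn A" "(a, u) \<in> conn A"
        using u(2) unfolding conn_insert by blast
      then show ?thesis
      proof cases
        case 1
        then show ?thesis using x u by (auto simp: reps_iff)
      next
        case 2
        have "x \<in> cls a" "u \<in> cls b" using 2 x u conn_sym by (auto simp: cls_def reps_iff)
        then have "x = Min (cls a)" "Min (cls b) \<le> u" using x rep_cls cls by auto
        then show ?thesis using x by (auto simp: r_def max_def split: if_splits)
      next
        case 3
        have "x \<in> cls b" "u \<in> cls a" using 3 x u conn_sym by (auto simp: cls_def reps_iff)
        then have "x = Min (cls b)" "Min (cls a) \<le> u" using x rep_cls cls by auto
        then show ?thesis using x by (auto simp: r_def max_def split: if_splits)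
      qed
    qed
    then show "x \<in> reps V (insert (a, b) A)" using x by (auto simp: reps_iff)
  qed
  moreover have "finite (reps V A)" using V by (simp add: reps_def)
  then have "card (reps V A) = Suc (card (reps V A - {r}))" using r_rep by (rule card.remove)
  ultimately show ?thesis using False by simp
qed

text \<open>Contracting \<open>W\<close> to a point is expressed by adding all pairs over \<open>W\<close>.\<close>

lemma conn_contract_insert:
  assumes "w \<in> W"
  shows "conn (insert w' W \<times> insert w' W \<union> K) = conn (insert (w, w') (W \<times> W \<union> K))"
proof
  show "conn (insert (w, w') (W \<times> W \<union> K)) \<subseteq> conn (insert w' W \<times> insert w' W \<union> K)"
    using assms by (intro conn_mono) auto
  show "conn (insert w' W \<times> insert w' W \<union> K) \<subseteq> conn (insert (w, w') (W \<times> W \<union> K))"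
  proof (rule conn_subsetI)
    let ?C = "conn (insert (w, w') (W \<times> W \<union> K))"
    fix x y assume xy: "(x, y) \<in> insert w' W \<times> insert w' W \<union> K"
    have wz: "(w, z) \<in> ?C" if "z \<in> insert w' W" for z
      using that assms by (auto intro: conn_base)
    from xy show "(x, y) \<in> ?C"
    proof
      assume "(x, y) \<in> insert w' W \<times> insert w' W"
      then have "(w, x) \<in> ?C" "(w, y) \<in> ?C" using wz by auto
      then show ?thesis by (rule conn_trans[OF conn_sym])
    next
      assume "(x, y) \<in> K"
      then show ?thesis by (intro conn_base) simp
    qed
  qed
qed

text \<open>Used to refute connectedness by exhibiting a set that no edge leaves.\<close>

lemma conn_avoid:
  assumes "\<And>x y. (x, y) \<in> A \<Longrightarrow> x \<in> S \<longleftrightarrow> y \<in> S" "(x, y) \<in> conn A"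
  shows "x \<in> S \<longleftrightarrow> y \<in> S"
  using assms(2) unfolding conn_def
  by (induction rule: rtrancl_induct) (use assms(1) in auto)

lemma card_reps_contract:
  assumes "finite V" "W \<subseteq> V" "w \<in> W" "v \<in> V - W"
  shows "card (reps V (W \<times> W \<union> K)) = card (reps V (insert v W \<times> insert v W \<union> K))
    + (if (w, v) \<in> conn (W \<times> W \<union> K) then 0 else 1)"
  using card_reps_insert[of V w v "W \<times> W \<union> K"] assms
    reps_cong[OF conn_contract_insert[OF assms(3), of v K], of V] by auto

section \<open>Minimum violations of signed edges and the cycle count\<close>

type_synonym edge = "nat \<times> nat"
type_synonym signs = "bool \<times> bool"

text \<open>Splitting a clause into an unsigned edge and two signs keeps the signs random while the
  graph is explored.\<close>

definition violated :: "(nat \<Rightarrow> bool) \<Rightarrow> edge \<times> signs \<Rightarrow> bool" where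
  "violated \<sigma> c \<longleftrightarrow> \<sigma> (fst (fst c)) \<noteq> fst (snd c) \<and> \<sigma> (snd (fst c)) \<noteq> snd (snd c)"

definition min_viol :: "nat set \<Rightarrow> (nat \<Rightarrow> bool) \<Rightarrow> (edge \<times> signs) list \<Rightarrow> nat" where
  "min_viol W \<tau> L = Min ((\<lambda>\<sigma>. length (filter (violated \<sigma>) L)) ` ext W \<tau>)"

lemma finite_viol_range: "finite ((\<lambda>\<sigma>. length (filter (violated \<sigma>) L)) ` X)"
  by (rule finite_subset[of _ "{..length L}"]) auto

lemma min_viol_le: "\<sigma> \<in> ext W \<tau> \<Longrightarrow> min_viol W \<tau> L \<le> length (filter (violated \<sigma>) L)"
  unfolding min_viol_def by (intro Min_le finite_viol_range) auto

lemma min_viol_obtain: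
  obtains \<sigma> where "\<sigma> \<in> ext W \<tau>" "min_viol W \<tau> L = length (filter (violated \<sigma>) L)"
proof -
  have "ext W \<tau> \<noteq> {}" using ext_self by blast
  then have "min_viol W \<tau> L \<in> (\<lambda>\<sigma>. length (filter (violated \<sigma>) L)) ` ext W \<tau>"
    unfolding min_viol_def by (intro Min_in finite_viol_range) simp
  then show ?thesis using that by auto
qed

lemma min_viol_ext_mono:
  assumes "W \<subseteq> W'" "\<And>i. i \<in> W \<Longrightarrow> \<tau>' i = \<tau> i"
  shows "min_viol W \<tau> L \<le> min_viol W' \<tau>' L"
proof -
  obtain \<sigma> where \<sigma>: "\<sigma> \<in> ext W' \<tau>'" "min_viol W' \<tau>' L = length (filter (violated \<sigma>) L)"
    by (rule min_viol_obtain)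
  have "\<sigma> \<in> ext W \<tau>" using \<sigma>(1) assms by (auto simp: ext_def)
  then show ?thesis using min_viol_le \<sigma>(2) by metis
qed

lemma min_viol_middle: "min_viol W \<tau> (xs @ c # ys) = min_viol W \<tau> (c # xs @ ys)"
proof -
  have "(\<lambda>\<sigma>. length (filter (violated \<sigma>) (xs @ c # ys))) = (\<lambda>\<sigma>. length (filter (violated \<sigma>) (c # xs @ ys)))"
    by (simp add: fun_eq_iff)
  then show ?thesis by (simp only: min_viol_def)
qed

lemma min_viol_Cons_satisfied:
  assumes "\<And>\<sigma>. \<sigma> \<in> ext W \<tau> \<Longrightarrow> \<not> violated \<sigma> c"
  shows "min_viol W \<tau> (c # L) \<le> min_viol W \<tau> L"
proof -
  obtain \<sigma> where \<sigma>: "\<sigma> \<in> ext W \<tau>" "min_viol W \<tau> L = length (filter (violated \<sigma>) L)"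
    by (rule min_viol_obtain)
  have "min_viol W \<tau> (c # L) \<le> length (filter (violated \<sigma>) (c # L))" by (rule min_viol_le) fact
  then show ?thesis using \<sigma> assms[OF \<sigma>(1)] by simp
qed

text \<open>The clause is satisfied at the price of restricting the assignments to those that extend
  \<open>\<tau>'\<close> on \<open>W'\<close>.\<close>

lemma min_viol_Cons_forced:
  assumes "W \<subseteq> W'" "\<And>i. i \<in> W \<Longrightarrow> \<tau>' i = \<tau> i" "\<And>\<sigma>. \<sigma> \<in> ext W' \<tau>' \<Longrightarrow> \<not> violated \<sigma> c"
  shows "min_viol W \<tau> (c # L) \<le> min_viol W' \<tau>' L"
proof -
  have "min_viol W \<tau> (c # L) \<le> min_viol W' \<tau>' (c # L)"
    by (rule min_viol_ext_mono[OF assms(1,2)])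
  also have "\<dots> \<le> min_viol W' \<tau>' L"
    by (rule min_viol_Cons_satisfied[OF assms(3)])
  finally show ?thesis .
qed

text \<open>The mark \<open>True\<close> models a clause not satisfied by its first assigned
  variable, which holds for two of its four sign pairs; marks are fair coins accordingly.\<close>

definition kept :: "(edge \<times> bool) list \<Rightarrow> (nat \<times> nat) set" where
  "kept L = {e. (e, True) \<in> set L}"

text \<open>The number of independent cycles of the graph of kept edges after contracting \<open>W\<close>.\<close>

definition surplus :: "nat set \<Rightarrow> nat set \<Rightarrow> (edge \<times> bool) list \<Rightarrow> real" where
  "surplus V W L = real (length (filter snd L)) - real (card (reps V (W \<times> W)))
     + real (card (reps V (W \<times> W \<union> kept L)))"

lemma surplus_middle: "surplus V W (xs @ c # ys) = surplus V W (c # xs @ ys)"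
proof -
  have "kept (xs @ c # ys) = kept (c # xs @ ys)" by (auto simp: kept_def)
  then show ?thesis by (simp add: surplus_def)
qed

lemma surplus_removed: "surplus V W ((e, False) # L) = surplus V W L"
proof -
  have "kept ((e, False) # L) = kept L" by (auto simp: kept_def)
  then show ?thesis by (simp add: surplus_def)
qed

lemma contract_fresh: "v \<notin> W \<Longrightarrow> w \<in> W \<Longrightarrow> (w, v) \<notin> conn (W \<times> W)"
  using conn_avoid[of "W \<times> W" W w v] by auto

text \<open>Such an edge is a tree edge at the contracted set: absorbing \<open>v\<close> takes away
  one edge and one component of the contracted empty graph, so the cycle count is unchanged.\<close>

lemma surplus_kept:
  assumes V: "finite V" "W \<subseteq> V" "w \<in> W" "v \<in> V - W" and e: "e = (w, v) \<or> e = (v, w)"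
  shows "surplus V W ((e, True) # L) = surplus V (insert v W) L"
proof -
  have k: "kept ((e, True) # L) = insert e (kept L)" by (auto simp: kept_def)
  have sw: "conn (insert (v, w) B) = conn (insert (w, v) B)" for B
    by (auto simp: conn_insert)
  have "conn (W \<times> W \<union> kept ((e, True) # L)) = conn (insert (w, v) (W \<times> W \<union> kept L))"
    using e sw[of "W \<times> W \<union> kept L"] by (auto simp: k)
  also have "\<dots> = conn (insert v W \<times> insert v W \<union> kept L)"
    using conn_contract_insert[OF V(3)] by simp
  finally have "card (reps V (W \<times> W \<union> kept ((e, True) # L))) = card (reps V (insert v W \<times> insert v W \<union> kept L))"
    by (simp add: reps_def)
  moreover have "card (reps V (W \<times> W)) = card (reps V (insert v W \<times> insert v W)) + 1"
    using card_reps_contract[OF V, of "{}"] contract_fresh[of v W w] V by simp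
  ultimately show ?thesis by (simp add: surplus_def)
qed

text \<open>Identifying vertices from different components of the kept graph closes no
  cycle.\<close>

lemma surplus_new_root:
  assumes V: "finite V" "W \<subseteq> V" "w \<in> W" "v \<in> V - W"
    and cross: "\<And>x y. (x, y) \<in> kept L \<Longrightarrow> x \<in> W \<longleftrightarrow> y \<in> W"
  shows "surplus V W L = surplus V (insert v W) L"
proof -
  have "(w, v) \<notin> conn (W \<times> W \<union> kept L)"
    using conn_avoid[of "W \<times> W \<union> kept L" W w v] cross V by auto
  then have "card (reps V (W \<times> W \<union> kept L)) = card (reps V (insert v W \<times> insert v W \<union> kept L)) + 1"
    using card_reps_contract[OF V, of "kept L"] by simp
  moreover have "card (reps V (W \<times> W)) = card (reps V (insert v W \<times> insert v W)) + 1"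
    using card_reps_contract[OF V, of "{}"] contract_fresh[of v W w] V by simp
  ultimately show ?thesis by (simp add: surplus_def)
qed

text \<open>Positions are exchangeable, so the exploration may reveal the signs of a crossing edge
  wherever it stands in the list.\<close>

lemma lexp_Suc_middle:
  "lexp (a + Suc b) S f = (\<Sum>s\<in>S. lexp (a + b) S (\<lambda>zs. f (take a zs @ s # drop a zs))) / card S"
proof (induction a arbitrary: f)
  case (Suc a)
  have "lexp (Suc a + Suc b) S f = (\<Sum>x\<in>S. lexp (a + Suc b) S (\<lambda>zs. f (x # zs))) / card S"
    by simp
  also have "\<dots> = (\<Sum>x\<in>S. (\<Sum>s\<in>S. lexp (a + b) S (\<lambda>zs. f (x # take a zs @ s # drop a zs))) / card S) / card S"
    by (simp only: Suc)
  also have "\<dots> = (\<Sum>x\<in>S. \<Sum>s\<in>S. lexp (a + b) S (\<lambda>zs. f (x # take a zs @ s # drop a zs))) / card S / card S"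
    by (simp only: sum_divide_distrib)
  also have "\<dots> = (\<Sum>s\<in>S. \<Sum>x\<in>S. lexp (a + b) S (\<lambda>zs. f (x # take a zs @ s # drop a zs))) / card S / card S"
    by (subst sum.swap) (rule refl)
  also have "\<dots> = (\<Sum>s\<in>S. lexp (Suc a + b) S (\<lambda>zs. f (take (Suc a) zs @ s # drop (Suc a) zs))) / card S"
    by (simp add: sum_divide_distrib)
  finally show ?case .
qed simp

lemma lexp_zip_middle:
  assumes "\<And>ys c zs. f (ys @ c # zs) = f (c # ys @ zs)"
  shows "lexp (length (xs @ e # ys)) S (\<lambda>ss. f (zip (xs @ e # ys) ss))
    = (\<Sum>s\<in>S. lexp (length (xs @ ys)) S (\<lambda>ss. f ((e, s) # zip (xs @ ys) ss))) / card S"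
proof -
  have "lexp (length (xs @ e # ys)) S (\<lambda>ss. f (zip (xs @ e # ys) ss))
    = lexp (length xs + Suc (length ys)) S (\<lambda>ss. f (zip (xs @ e # ys) ss))" by simp
  also have "\<dots> = (\<Sum>s\<in>S. lexp (length xs + length ys) S
      (\<lambda>zs. f (zip (xs @ e # ys) (take (length xs) zs @ s # drop (length xs) zs)))) / card S"
    by (rule lexp_Suc_middle)
  also have "\<dots> = (\<Sum>s\<in>S. lexp (length xs + length ys) S (\<lambda>ss. f ((e, s) # zip (xs @ ys) ss))) / card S"
  proof (intro arg_cong2[of _ _ _ _ "(/)"] sum.cong refl lexp_cong)
    fix s and zs :: "'b list" assume len: "length zs = length xs + length ys"
    have "zip (xs @ e # ys) (take (length xs) zs @ s # drop (length xs) zs)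
        = zip xs (take (length xs) zs) @ (e, s) # zip ys (drop (length xs) zs)"
      using len by simp
    moreover have "zip (xs @ ys) zs = zip xs (take (length xs) zs) @ zip ys (drop (length xs) zs)"
      by (rule zip_append1)
    ultimately show "f (zip (xs @ e # ys) (take (length xs) zs @ s # drop (length xs) zs))
        = f ((e, s) # zip (xs @ ys) zs)"
      using assms by simp
  qed
  finally show ?thesis by simp
qed

lemma lexp_count:
  assumes "finite S" "S \<noteq> {}"
    and "\<And>e. e \<in> set es \<Longrightarrow> (\<Sum>s\<in>S. if P (e, s) then 1 else 0) = c * real (card S)"
  shows "lexp (length es) S (\<lambda>ss. real (length (filter P (zip es ss)))) = c * real (length es)"
  using assms(3)
proof (induction es)
  case (Cons e es)
  have IH: "lexp (length es) S (\<lambda>ss. real (length (filter P (zip es ss)))) = c * real (length es)"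
    using Cons by simp
  have "lexp (length (e # es)) S (\<lambda>ss. real (length (filter P (zip (e # es) ss))))
      = (\<Sum>s\<in>S. lexp (length es) S (\<lambda>ss. (if P (e, s) then 1 else 0) + real (length (filter P (zip es ss))))) / card S"
    unfolding length_Cons lexp.simps(2)
    by (intro arg_cong2[of _ _ _ _ "(/)"] sum.cong refl lexp_cong) auto
  also have "\<dots> = ((\<Sum>s\<in>S. if P (e, s) then 1 else 0) + real (card S) * (c * real (length es))) / card S"
    using assms(1,2) by (simp add: lexp_add IH sum.distrib)
  also have "\<dots> = c * real (length (e # es))"
    using assms(1,2) Cons.prems[of e] by (simp add: card_gt_0_iff field_simps)
  finally show ?case .
qed simp

lemma sum_bool: "(\<Sum>b\<in>(UNIV :: bool set). f b) = f True + f False"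
  by (simp add: UNIV_bool add.commute)

lemma sum_signs: "(\<Sum>s\<in>(UNIV :: signs set). f s)
    = f (True, True) + f (True, False) + f (False, True) + (f (False, False) :: real)"
proof -
  have "(\<Sum>b\<in>UNIV. \<Sum>c\<in>UNIV. f (b, c)) = (\<Sum>(b, c)\<in>UNIV \<times> UNIV. f (b, c))"
    by (rule sum.cartesian_product)
  also have "\<dots> = (\<Sum>s\<in>(UNIV :: signs set). f s)" by (simp add: case_prod_unfold)
  finally show ?thesis by (simp add: sum_bool)
qed

lemma card_signs: "card (UNIV :: signs set) = 4"
  using card_cartesian_product[of "UNIV :: bool set" "UNIV :: bool set"] by simp

text \<open>Both sides obey the same recursion in the set \<open>W\<close> of assigned variables. A
  crossing edge is satisfied by its end in \<open>W\<close> with probability 1/2 and otherwise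
  forces its other end, just as an edge is removed or kept; without crossing edges a new variable is
  set freely. When \<open>W = V\<close>, each remaining edge is violated with probability 1/4 and is
  a kept cycle edge with probability 1/2, whence the factor 1/2.\<close>

lemma min_viol_surplus:
  assumes "finite V" "W \<subseteq> V" "W \<noteq> {}" "set es \<subseteq> V \<times> V"
  shows "lexp (length es) UNIV (\<lambda>ss :: signs list. real (min_viol W \<tau> (zip es ss)))
     \<le> lexp (length es) UNIV (\<lambda>ks. surplus V W (zip es ks)) / 2"
  using assms(2-4)
proof (induction "length es + card (V - W)" arbitrary: es W \<tau> rule: less_induct)
  case less
  let ?L = "\<lambda>es W \<tau>. lexp (length es) UNIV (\<lambda>ss :: signs list. real (min_viol W \<tau> (zip es ss)))"
  let ?R = "\<lambda>es W. lexp (length es) UNIV (\<lambda>ks. surplus V W (zip es ks))"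
  obtain w0 where w0: "w0 \<in> W" using less.prems by blast
  show ?case
  proof (cases "\<exists>e\<in>set es. (fst e \<in> W) \<noteq> (snd e \<in> W)")
    case True
    then obtain e xs ys where e: "(fst e \<in> W) \<noteq> (snd e \<in> W)" and es: "es = xs @ e # ys"
      by (meson split_list)
    define w v where "w = (if fst e \<in> W then fst e else snd e)" and "v = (if fst e \<in> W then snd e else fst e)"
    have wv: "w \<in> W" "v \<in> V - W" "e = (w, v) \<or> e = (v, w)"
      using e less.prems(3) by (auto simp: w_def v_def es)
    let ?es = "xs @ ys"
    have IH1: "?L ?es W \<tau>' \<le> ?R ?es W / 2" for \<tau>'
      using less.prems by (intro less.hyps) (auto simp: es)
    have lt: "card (V - insert v W) < card (V - W)"
      using assms(1) wv(2) by (intro psubset_card_mono) auto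
    have IH2: "?L ?es (insert v W) \<tau>' \<le> ?R ?es (insert v W) / 2" for \<tau>'
      by (rule less.hyps) (use less.prems wv lt in \<open>auto simp: es\<close>)
    have L: "?L es W \<tau> = (\<Sum>s\<in>UNIV. lexp (length ?es) UNIV (\<lambda>ss :: signs list. real (min_viol W \<tau> ((e, s) # zip ?es ss)))) / 4"
      unfolding es by (subst lexp_zip_middle[where f = "\<lambda>L. real (min_viol W \<tau> L)"])
        (simp_all only: min_viol_middle card_signs of_nat_numeral)
    have clause: "lexp (length ?es) UNIV (\<lambda>ss :: signs list. real (min_viol W \<tau> ((e, s) # zip ?es ss)))
        \<le> (if (if fst e \<in> W then fst s else snd s) = \<tau> w then ?R ?es W / 2 else ?R ?es (insert v W) / 2)" for s
    proof (cases "(if fst e \<in> W then fst s else snd s) = \<tau> w")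
      case True
      have "min_viol W \<tau> ((e, s) # L) \<le> min_viol W \<tau> L" for L
        using True wv(1) by (intro min_viol_Cons_satisfied)
          (auto simp: violated_def ext_def w_def split: if_splits)
      then have "lexp (length ?es) UNIV (\<lambda>ss :: signs list. real (min_viol W \<tau> ((e, s) # zip ?es ss))) \<le> ?L ?es W \<tau>"
        by (intro lexp_mono) simp
      then show ?thesis using True IH1[of \<tau>] by simp
    next
      case False
      \<comment> \<open>The forced variable takes the value of its own sign and thereby satisfies
        the clause.\<close>
      define \<tau>' where "\<tau>' = \<tau>(v := (if fst e \<in> W then snd s else fst s))"
      have "min_viol W \<tau> ((e, s) # L) \<le> min_viol (insert v W) \<tau>' L" for L
        using wv by (intro min_viol_Cons_forced)
          (auto simp: violated_def ext_def v_def \<tau>'_def split: if_splits)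
      then have "lexp (length ?es) UNIV (\<lambda>ss :: signs list. real (min_viol W \<tau> ((e, s) # zip ?es ss)))
          \<le> ?L ?es (insert v W) \<tau>'"
        by (intro lexp_mono) simp
      then show ?thesis using False IH2[of \<tau>'] by simp
    qed
    have "?L es W \<tau> \<le> (\<Sum>s\<in>(UNIV :: signs set).
        (if (if fst e \<in> W then fst s else snd s) = \<tau> w then ?R ?es W / 2 else ?R ?es (insert v W) / 2)) / 4"
      unfolding L by (intro divide_right_mono sum_mono clause) auto
    also have "\<dots> = (?R ?es W + ?R ?es (insert v W)) / 4"
      by (cases "fst e \<in> W"; cases "\<tau> w") (simp_all add: sum_signs)
    also have "\<dots> = ?R es W / 2"
    proof -
      have "?R es W = (\<Sum>k\<in>UNIV. lexp (length ?es) UNIV (\<lambda>ks. surplus V W ((e, k) # zip ?es ks))) / 2"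
        unfolding es by (subst lexp_zip_middle[where f = "surplus V W"])
          (simp_all only: surplus_middle card_UNIV_bool of_nat_numeral)
      also have "\<dots> = (?R ?es (insert v W) + ?R ?es W) / 2"
        unfolding sum_bool surplus_removed
        by (simp only: surplus_kept[OF assms(1) less.prems(1) wv])
      finally show ?thesis by simp
    qed
    finally show ?thesis .
  next
    case no_cross: False
    show ?thesis
    proof (cases "V - W = {}")
      case False
      then obtain v where v: "v \<in> V - W" by blast
      have lt: "card (V - insert v W) < card (V - W)"
        using assms(1) v by (intro psubset_card_mono) auto
      \<comment> \<open>The new root may take any value; \<open>\<tau> v\<close> serves.\<close>
      have "?L es W \<tau> \<le> ?L es (insert v W) \<tau>"
        by (intro lexp_mono of_nat_mono min_viol_ext_mono) auto
      also have "\<dots> \<le> ?R es (insert v W) / 2"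
        by (rule less.hyps) (use less.prems v lt in auto)
      also have "?R es (insert v W) = ?R es W"
      proof (rule lexp_cong)
        fix ks :: "bool list"
        have "x \<in> W \<longleftrightarrow> y \<in> W" if "(x, y) \<in> kept (zip es ks)" for x y
        proof -
          have "(x, y) \<in> set es" using that by (auto simp: kept_def dest: set_zip_leftD)
          then show ?thesis using no_cross by auto
        qed
        then show "surplus V (insert v W) (zip es ks) = surplus V W (zip es ks)"
          using surplus_new_root[OF assms(1) less.prems(1) w0 v] by simp
      qed
      finally show ?thesis .
    next
      case True
      then have WV: "W = V" using less.prems by blast
      have "?L es W \<tau> \<le> lexp (length es) UNIV (\<lambda>ss :: signs list. real (length (filter (violated \<tau>) (zip es ss))))"
        by (intro lexp_mono of_nat_mono min_viol_le) simp
      also have "\<dots> = 1 / 4 * real (length es)"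
      proof (rule lexp_count)
        fix e :: edge
        show "(\<Sum>s\<in>UNIV. if violated \<tau> (e, s) then 1 else 0) = 1 / 4 * real (card (UNIV :: signs set))"
          by (cases "\<tau> (fst e)"; cases "\<tau> (snd e)") (simp_all add: sum_signs card_signs violated_def)
      qed auto
      also have "\<dots> = lexp (length es) UNIV (\<lambda>ks. real (length (filter snd (zip es ks)))) / 2"
      proof -
        have "lexp (length es) UNIV (\<lambda>ks. real (length (filter snd (zip es ks)))) = 1 / 2 * real (length es)"
          by (rule lexp_count) (simp_all add: sum_bool)
        then show ?thesis by simp
      qed
      also have "lexp (length es) UNIV (\<lambda>ks. real (length (filter snd (zip es ks)))) = ?R es W"
      proof (rule lexp_cong)
        fix ks :: "bool list"
        have "kept (zip es ks) \<subseteq> V \<times> V"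
          using less.prems(3) by (auto simp: kept_def dest: set_zip_leftD)
        \<comment> \<open>Everything is contracted to one point, so each kept edge counts as a
          cycle.\<close>
        then have "V \<times> V \<union> kept (zip es ks) = V \<times> V" by blast
        then show "real (length (filter snd (zip es ks))) = surplus V W (zip es ks)"
          by (simp add: surplus_def WV)
      qed
      finally show ?thesis .
    qed
  qed
qed

section \<open>Random clauses as random edges with independent signs\<close>

lemma lexp_bij:
  assumes "bij_betw h A B"
  shows "lexp m B f = lexp m A (\<lambda>xs. f (map h xs))"
proof (induction m arbitrary: f)
  case (Suc m)
  have "lexp (Suc m) B f = (\<Sum>y\<in>B. lexp m A (\<lambda>xs. f (y # map h xs))) / card B"
    by (simp add: Suc)
  also have "(\<Sum>y\<in>B. lexp m A (\<lambda>xs. f (y # map h xs))) = (\<Sum>x\<in>A. lexp m A (\<lambda>xs. f (h x # map h xs)))"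
    by (rule sum.reindex_bij_betw[OF assms, symmetric])
  finally show ?case using bij_betw_same_card[OF assms] by simp
qed simp

lemma lexp_product:
  shows "lexp m (A \<times> S) f = lexp m A (\<lambda>es. lexp m S (\<lambda>ss. f (zip es ss)))"
proof (induction m arbitrary: f)
  case (Suc m)
  have "lexp (Suc m) (A \<times> S) f = (\<Sum>x\<in>A. \<Sum>s\<in>S. lexp m (A \<times> S) (\<lambda>zs. f ((x, s) # zs))) / card (A \<times> S)"
    by (simp add: sum.cartesian_product)
  also have "\<dots> = (\<Sum>x\<in>A. \<Sum>s\<in>S. lexp m A (\<lambda>es. lexp m S (\<lambda>ss. f ((x, s) # zip es ss)))) / card (A \<times> S)"
    by (simp only: Suc)
  also have "\<dots> = (\<Sum>x\<in>A. (\<Sum>s\<in>S. lexp m A (\<lambda>es. lexp m S (\<lambda>ss. f ((x, s) # zip es ss)))) / card S) / card A"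
    by (simp add: card_cartesian_product sum_divide_distrib mult.commute)
  also have "\<dots> = (\<Sum>x\<in>A. lexp m A (\<lambda>es. lexp (Suc m) S (\<lambda>ss. f (zip (x # es) ss)))) / card A"
  proof -
    have "(\<Sum>s\<in>S. lexp m A (\<lambda>es. lexp m S (\<lambda>ss. f ((x, s) # zip es ss)))) / card S
        = lexp m A (\<lambda>es. lexp (Suc m) S (\<lambda>ss. f (zip (x # es) ss)))" for x
    proof -
      have "lexp m A (\<lambda>es. lexp (Suc m) S (\<lambda>ss. f (zip (x # es) ss)))
          = lexp m A (\<lambda>es. (1 / card S) * (\<Sum>s\<in>S. lexp m S (\<lambda>ss. f ((x, s) # zip es ss))))"
        by simp
      also have "\<dots> = (1 / card S) * (\<Sum>s\<in>S. lexp m A (\<lambda>es. lexp m S (\<lambda>ss. f ((x, s) # zip es ss))))"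
        unfolding lexp_cmult lexp_sum ..
      finally show ?thesis by simp
    qed
    then show ?thesis by simp
  qed
  finally show ?case by simp
qed simp

text \<open>Ordering the ends encodes each undirected edge once and fixes which sign belongs to
  which end.\<close>

definition edges_on :: "nat set \<Rightarrow> edge set" where
  "edges_on V = {(i, j). i \<in> V \<and> j \<in> V \<and> i < j}"

lemma finite_edges_on [simp]: "finite V \<Longrightarrow> finite (edges_on V)"
  by (rule finite_subset[of _ "V \<times> V"]) (auto simp: edges_on_def)

lemma edges_on_subset: "edges_on V \<subseteq> V \<times> V"
  by (auto simp: edges_on_def)

definition clause_of :: "edge \<times> signs \<Rightarrow> clause" where
  "clause_of c = {(fst (fst c), fst (snd c)), (snd (fst c), snd (snd c))}"

lemma satisfies_clause_of: "satisfies \<sigma> (clause_of c) \<longleftrightarrow> \<not> violated \<sigma> c"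
  by (simp add: satisfies_def clause_of_def violated_def)

lemma bij_betw_clause_of: "bij_betw clause_of (edges_on V \<times> UNIV) (clauses_on V)"
  unfolding bij_betw_def
proof
  show "inj_on clause_of (edges_on V \<times> UNIV)"
  proof (rule inj_onI)
    fix x y assume xy: "x \<in> edges_on V \<times> UNIV" "y \<in> edges_on V \<times> UNIV" "clause_of x = clause_of y"
    obtain i j b c where x: "x = ((i, j), (b, c))" by (metis surj_pair)
    obtain i' j' b' c' where y: "y = ((i', j'), (b', c'))" by (metis surj_pair)
    have "i < j" "i' < j'" using xy by (auto simp: x y edges_on_def)
    then show "x = y" using xy(3) by (auto simp: x y clause_of_def doubleton_eq_iff)
  qed
  show "clause_of ` (edges_on V \<times> UNIV) = clauses_on V"
  proof
    show "clause_of ` (edges_on V \<times> UNIV) \<subseteq> clauses_on V"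
      by (auto simp: edges_on_def clause_of_def intro!: clauses_onI)
    show "clauses_on V \<subseteq> clause_of ` (edges_on V \<times> UNIV)"
    proof
      fix C assume "C \<in> clauses_on V"
      then obtain i b j c where C: "C = {(i, b), (j, c)}" "i \<in> V" "j \<in> V" "i \<noteq> j"
        unfolding clauses_on_def by blast
      show "C \<in> clause_of ` (edges_on V \<times> UNIV)"
      proof (cases "i < j")
        case True
        then have "C = clause_of ((i, j), (b, c))" "((i, j), (b, c)) \<in> edges_on V \<times> UNIV"
          using C by (simp_all add: clause_of_def edges_on_def)
        then show ?thesis by (rule image_eqI)
      next
        case False
        then have "C = clause_of ((j, i), (c, b))" "((j, i), (c, b)) \<in> edges_on V \<times> UNIV"
          using C by (simp_all add: clause_of_def edges_on_def insert_commute)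
        then show ?thesis by (rule image_eqI)
      qed
    qed
  qed
qed

lemma max_sat_clause_of: "real (length L) - real (min_viol W \<tau> L) \<le> real (max_sat (map clause_of L))"
proof -
  obtain \<sigma> where \<sigma>: "min_viol W \<tau> L = length (filter (violated \<sigma>) L)"
    by (rule min_viol_obtain)
  have "length (filter (satisfies \<sigma>) (map clause_of L)) \<le> max_sat (map clause_of L)"
    unfolding max_sat_def by (intro Max_ge finite_max_sat_range) auto
  moreover have "length (filter (satisfies \<sigma>) (map clause_of L)) = length (filter (\<lambda>c. \<not> violated \<sigma> c) L)"
    by (simp add: filter_map o_def satisfies_clause_of)
  moreover have "length (filter (violated \<sigma>) L) + length (filter (\<lambda>c. \<not> violated \<sigma> c) L) = length L"
    by (rule sum_length_filter_compl)
  ultimately show ?thesis using \<sigma> by linarith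
qed

text \<open>Probability that a fresh uniform edge would close a cycle in the graph of the kept ones
  among \<open>i\<close> random edges.\<close>

definition conn_prob :: "nat \<Rightarrow> nat \<Rightarrow> real" where
  "conn_prob n i = lexp i (edges_on {1..n} \<times> UNIV)
     (\<lambda>L. (\<Sum>e\<in>edges_on {1..n}. of_bool (e \<in> conn (kept L))) / card (edges_on {1..n}))"

lemma conn_insert_refl: "conn (insert (x, x) A) = conn A"
proof -
  have "(y, z) \<in> conn (insert (x, x) A) \<longleftrightarrow> (y, z) \<in> conn A" for y z
    unfolding conn_insert using conn_trans[of y x A z] by blast
  then show ?thesis by auto
qed

text \<open>Contracting a single vertex only adds a loop, so the surplus is the usual cycle rank and
  grows exactly when a kept edge joins connected vertices.\<close>

lemma surplus_Cons:
  assumes "finite V" "e \<in> V \<times> V"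
  shows "surplus V {v} ((e, k) # L) = surplus V {v} L + (if k then of_bool (e \<in> conn (kept L)) else 0)"
proof (cases k)
  case True
  obtain a b where e: "e = (a, b)" by (cases e)
  have "kept ((e, True) # L) = insert e (kept L)" by (auto simp: kept_def)
  moreover have "card (reps V (insert (v, v) (kept L)))
      = card (reps V (insert e (insert (v, v) (kept L)))) + (if e \<in> conn (kept L) then 0 else 1)"
    using card_reps_insert[OF assms(1), of a b "insert (v, v) (kept L)"] assms(2)
    by (simp add: e conn_insert_refl)
  ultimately show ?thesis
    using True by (simp add: surplus_def insert_commute)
next
  case False
  then show ?thesis by (simp add: surplus_removed)
qed

lemma edges_on_nonempty:
  assumes "n \<ge> 2"
  shows "edges_on {1..n} \<noteq> {}"
proof -
  have "(1, 2) \<in> edges_on {1..n}" using assms by (simp add: edges_on_def)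
  then show ?thesis by blast
qed

lemma surplus_expectation:
  assumes "n \<ge> 2"
  shows "lexp m (edges_on {1..n} \<times> UNIV) (surplus {1..n} {1}) = (\<Sum>i<m. conn_prob n i) / 2"
proof (induction m)
  case 0
  have "surplus {1..n} {1} [] = 0" by (simp add: surplus_def kept_def)
  then show ?case by simp
next
  case (Suc m)
  let ?E = "edges_on {1..n}"
  have E: "finite ?E" "?E \<noteq> {}" using edges_on_nonempty[OF assms] by auto
  then have A: "finite (?E \<times> (UNIV :: bool set))" "?E \<times> (UNIV :: bool set) \<noteq> {}" by auto
  have cE: "real (card ?E) > 0" using E by (simp add: card_gt_0_iff)
  have "lexp (Suc m) (?E \<times> UNIV) (surplus {1..n} {1})
      = (\<Sum>c\<in>?E \<times> UNIV. lexp m (?E \<times> UNIV) (\<lambda>L. surplus {1..n} {1} (c # L))) / card (?E \<times> (UNIV :: bool set))"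
    by simp
  also have "(\<Sum>c\<in>?E \<times> UNIV. lexp m (?E \<times> UNIV) (\<lambda>L. surplus {1..n} {1} (c # L)))
      = (\<Sum>e\<in>?E. \<Sum>k\<in>UNIV. lexp m (?E \<times> UNIV) (\<lambda>L. surplus {1..n} {1} ((e, k) # L)))"
    by (simp add: sum.cartesian_product)
  also have "\<dots> = (\<Sum>e\<in>?E. 2 * lexp m (?E \<times> UNIV) (surplus {1..n} {1})
      + lexp m (?E \<times> UNIV) (\<lambda>L. of_bool (e \<in> conn (kept L))))"
  proof (rule sum.cong[OF refl])
    fix e assume "e \<in> ?E"
    then have "e \<in> {1..n} \<times> {1..n}" using edges_on_subset by blast
    then have s: "surplus {1..n} {1} ((e, k) # L)
        = surplus {1..n} {1} L + (if k then of_bool (e \<in> conn (kept L)) else 0)" for k L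
      by (intro surplus_Cons) simp
    show "(\<Sum>k\<in>UNIV. lexp m (?E \<times> UNIV) (\<lambda>L. surplus {1..n} {1} ((e, k) # L)))
      = 2 * lexp m (?E \<times> UNIV) (surplus {1..n} {1}) + lexp m (?E \<times> UNIV) (\<lambda>L. of_bool (e \<in> conn (kept L)))"
      unfolding sum_bool s by (simp add: lexp_add)
  qed
  also have "\<dots> = card ?E * (2 * lexp m (?E \<times> UNIV) (surplus {1..n} {1}))
      + (\<Sum>e\<in>?E. lexp m (?E \<times> UNIV) (\<lambda>L. of_bool (e \<in> conn (kept L))))"
    by (simp add: sum.distrib)
  also have "(\<Sum>e\<in>?E. lexp m (?E \<times> UNIV) (\<lambda>L. of_bool (e \<in> conn (kept L)))) = card ?E * conn_prob n m"
  proof -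
    have "conn_prob n m = lexp m (?E \<times> UNIV) (\<lambda>L. 1 / card ?E * (\<Sum>e\<in>?E. of_bool (e \<in> conn (kept L))))"
      by (simp add: conn_prob_def)
    also have "\<dots> = 1 / card ?E * (\<Sum>e\<in>?E. lexp m (?E \<times> UNIV) (\<lambda>L. of_bool (e \<in> conn (kept L))))"
      unfolding lexp_cmult lexp_sum ..
    finally show ?thesis using cE by simp
  qed
  also have "(card ?E * (2 * lexp m (?E \<times> UNIV) (surplus {1..n} {1})) + card ?E * conn_prob n m)
      / card (?E \<times> (UNIV :: bool set)) = lexp m (?E \<times> UNIV) (surplus {1..n} {1}) + conn_prob n m / 2"
  proof -
    have "(C * (2 * s) + C * q) / (C * 2) = s + q / 2" if "0 < C" for C s q :: real
      using that by (simp add: add_divide_distrib)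
    from this[OF cE] show ?thesis by (simp add: card_cartesian_product)
  qed
  finally show ?case using Suc by (simp add: add_divide_distrib)
qed

text \<open>The factor 1/4 is 1/2 for keeping the edge times 1/2 from
  \<open>min_viol_surplus\<close>. Starting from variable 1 with value \<open>True\<close> is an
  arbitrary choice of root.\<close>

lemma expected_max_sat_lower:
  assumes "n \<ge> 2"
  shows "real m - (\<Sum>i<m. conn_prob n i) / 4 \<le> expected_max_sat n m"
proof -
  let ?E = "edges_on {1..n}"
  have E: "finite ?E" "?E \<noteq> {}" using edges_on_nonempty[OF assms] by auto
  have A: "finite (?E \<times> (UNIV :: signs set))" "?E \<times> (UNIV :: signs set) \<noteq> {}" using E by auto
  have "lexp m (?E \<times> UNIV) (\<lambda>L. real (min_viol {1} (\<lambda>_. True) L))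
      = lexp m ?E (\<lambda>es. lexp m UNIV (\<lambda>ss :: signs list. real (min_viol {1} (\<lambda>_. True) (zip es ss))))"
    by (rule lexp_product)
  also have "\<dots> \<le> lexp m ?E (\<lambda>es. 1 / 2 * lexp m UNIV (\<lambda>ks. surplus {1..n} {1} (zip es ks)))"
  proof (rule lexp_mono)
    fix es assume "set es \<subseteq> ?E" "length es = m"
    then show "lexp m UNIV (\<lambda>ss :: signs list. real (min_viol {1} (\<lambda>_. True) (zip es ss)))
        \<le> 1 / 2 * lexp m UNIV (\<lambda>ks. surplus {1..n} {1} (zip es ks))"
      using min_viol_surplus[of "{1..n}" "{1}" es "\<lambda>_. True"] edges_on_subset[of "{1..n}"] assms by auto
  qed
  also have "\<dots> = lexp m (?E \<times> UNIV) (surplus {1..n} {1}) / 2"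
    unfolding lexp_cmult by (simp add: lexp_product)
  also have "\<dots> = (\<Sum>i<m. conn_prob n i) / 4"
    unfolding surplus_expectation[OF assms] by simp
  finally have le: "lexp m (?E \<times> UNIV) (\<lambda>L. real (min_viol {1} (\<lambda>_. True) L)) \<le> (\<Sum>i<m. conn_prob n i) / 4" .
  have "real m - lexp m (?E \<times> UNIV) (\<lambda>L. real (min_viol {1} (\<lambda>_. True) L))
      = lexp m (?E \<times> UNIV) (\<lambda>L. real m + (- 1) * real (min_viol {1} (\<lambda>_. True) L))"
    unfolding lexp_add lexp_cmult using A by simp
  also have "\<dots> \<le> lexp m (?E \<times> UNIV) (\<lambda>L. real (max_sat (map clause_of L)))"
  proof (rule lexp_mono)
    fix L :: "(edge \<times> signs) list" assume "length L = m"
    then show "real m + (- 1) * real (min_viol {1} (\<lambda>_. True) L) \<le> real (max_sat (map clause_of L))"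
      using max_sat_clause_of[of L "{1}" "\<lambda>_. True"] by simp
  qed
  also have "\<dots> = expected_max_sat n m"
    unfolding expected_max_sat_eq[OF assms] by (rule lexp_bij[OF bij_betw_clause_of, symmetric])
  finally show ?thesis using le by linarith
qed

section \<open>Connected pairs of vertices in random graphs\<close>

definition component :: "nat set \<Rightarrow> edge set \<Rightarrow> nat \<Rightarrow> nat set" where
  "component V B x = {u \<in> V. (x, u) \<in> conn B}"

text \<open>The seeds \<open>W\<close> stand in for a giant component: \<open>reach\<close> is
  monotone in edges and seeds, which makes the deletion of vertices easy to control.\<close>

definition reach :: "nat set \<Rightarrow> edge set \<Rightarrow> nat set \<Rightarrow> nat set" where
  "reach V B W = {v \<in> V. \<exists>w\<in>W. (w, v) \<in> conn B}"

lemma reach_iff_component: "W \<subseteq> V \<Longrightarrow> x \<in> V \<Longrightarrow> x \<in> reach V B W \<longleftrightarrow> component V B x \<inter> W \<noteq> {}"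
proof -
  assume W: "W \<subseteq> V" "x \<in> V"
  have "(w, x) \<in> conn B \<longleftrightarrow> (x, w) \<in> conn B" for w using conn_sym[of w x B] conn_sym[of x w B] by argo
  then show ?thesis using W by (auto simp: reach_def component_def)
qed

lemma finite_component [simp]: "finite V \<Longrightarrow> finite (component V B x)"
  by (simp add: component_def)

lemma finite_reach [simp]: "finite V \<Longrightarrow> finite (reach V B W)"
  by (simp add: reach_def)

text \<open>Components without seeds are small, as a component of \<open>s\<close> vertices contains no seed with probability
  \<open>(1 - \<delta>)\<^sup>s\<close>.\<close>

lemma unseeded_bound:
  fixes \<delta> :: real
  assumes V: "finite V" and \<delta>: "0 < \<delta>" "\<delta> \<le> 1"
  shows "(\<Sum>x\<in>V. \<Sum>y\<in>V. bexp \<delta> V (\<lambda>W. of_bool ((x, y) \<in> conn B \<and> component V B x \<inter> W = {})))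
      \<le> card V / \<delta>"
proof -
  have "(\<Sum>y\<in>V. bexp \<delta> V (\<lambda>W. of_bool ((x, y) \<in> conn B \<and> component V B x \<inter> W = {}))) \<le> 1 / \<delta>"
    if x: "x \<in> V" for x
  proof -
    let ?c = "card (component V B x)"
    have "bexp \<delta> V (\<lambda>W. of_bool ((x, y) \<in> conn B \<and> component V B x \<inter> W = {}))
        = of_bool ((x, y) \<in> conn B) * (1 - \<delta>) ^ ?c" for y
    proof -
      have "bexp \<delta> V (\<lambda>W. of_bool ((x, y) \<in> conn B \<and> component V B x \<inter> W = {}))
          = bexp \<delta> V (\<lambda>W. of_bool ((x, y) \<in> conn B) * (if W \<inter> component V B x = {} then 1 else 0))"
        by (intro bexp_cong) (auto simp: Int_commute)
      then show ?thesis
        using V by (simp only: bexp_cmult, subst bexp_disjoint) (auto simp: component_def)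
    qed
    then have "(\<Sum>y\<in>V. bexp \<delta> V (\<lambda>W. of_bool ((x, y) \<in> conn B \<and> component V B x \<inter> W = {})))
        = (\<Sum>y\<in>V. of_bool ((x, y) \<in> conn B)) * (1 - \<delta>) ^ ?c"
      by (simp add: sum_distrib_right)
    also have "(\<Sum>y\<in>V. of_bool ((x, y) \<in> conn B)) = real ?c"
      using V by (simp add: component_def Int_def of_bool_def sum.If_cases)
    \<comment> \<open>This is \<open>t * exp (- t) \<le> 1\<close>, applied to the component size
      times \<delta>.\<close>
    also have "real ?c * (1 - \<delta>) ^ ?c \<le> 1 / \<delta>"
    proof -
      have "(1 - \<delta>) ^ ?c \<le> exp (- \<delta>) ^ ?c"
        using \<delta> exp_ge_add_one_self[of "- \<delta>"] by (intro power_mono) auto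
      also have "\<dots> = exp (- (real ?c * \<delta>))" by (simp add: exp_of_nat_mult[symmetric])
      finally have "\<delta> * real ?c * (1 - \<delta>) ^ ?c \<le> (real ?c * \<delta>) * exp (- (real ?c * \<delta>))"
        using \<delta> by (simp add: mult_ac mult_left_mono)
      also have "\<dots> \<le> 1"
      proof -
        have "real ?c * \<delta> \<le> exp (real ?c * \<delta>)" using exp_ge_add_one_self[of "real ?c * \<delta>"] by linarith
        then show ?thesis by (simp add: exp_minus divide_inverse[symmetric])
      qed
      finally show ?thesis using \<delta> by (simp add: field_simps)
    qed
    finally show ?thesis .
  qed
  then have "(\<Sum>x\<in>V. \<Sum>y\<in>V. bexp \<delta> V (\<lambda>W. of_bool ((x, y) \<in> conn B \<and> component V B x \<inter> W = {})))
      \<le> (\<Sum>x\<in>V. 1 / \<delta>)" by (rule sum_mono)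
  then show ?thesis by simp
qed

lemma bexp_superset: "finite S \<Longrightarrow> E \<subseteq> S \<Longrightarrow> 0 \<le> p \<Longrightarrow> p \<le> 1 \<Longrightarrow>
    bexp p S (\<lambda>B. of_bool (E \<subseteq> B)) \<le> p ^ card E"
  using bexp_superset_le[of S E p "\<lambda>_. 1"] by (simp add: of_bool_def)

lemma bexp_power_compl:
  assumes "finite S"
  shows "bexp p S (\<lambda>B. y ^ card (S - B)) = (p + (1 - p) * y) ^ card S"
  using assms
proof (induction S rule: finite_induct)
  case (insert e S)
  have 1: "bexp p S (\<lambda>B. y ^ card (insert e S - insert e B)) = bexp p S (\<lambda>B. y ^ card (S - B))"
  proof (intro bexp_cong)
    fix B
    have "insert e S - insert e B = S - B" using insert by auto
    then show "y ^ card (insert e S - insert e B) = y ^ card (S - B)" by simp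
  qed
  have 2: "bexp p S (\<lambda>B. y ^ card (insert e S - B)) = bexp p S (\<lambda>B. y * y ^ card (S - B))"
  proof (intro bexp_cong)
    fix B assume B: "B \<subseteq> S"
    have "insert e S - B = insert e (S - B)" "e \<notin> S - B" "finite (S - B)" using insert B by auto
    then show "y ^ card (insert e S - B) = y * y ^ card (S - B)" by simp
  qed
  show ?case
    using insert by (simp only: bexp_insert[OF insert.hyps(1,2)] 1 2 bexp_cmult) (simp add: insert algebra_simps)
qed simp

text \<open>Independence over disjoint blocks; the blocks will be the stars of edges at deleted
  vertices.\<close>

lemma bexp_prod:
  fixes f :: "'i \<Rightarrow> 'a set \<Rightarrow> real"
  assumes "finite I" "\<And>i. i \<in> I \<Longrightarrow> finite (S i)"
    and "\<And>i j. i \<in> I \<Longrightarrow> j \<in> I \<Longrightarrow> i \<noteq> j \<Longrightarrow> S i \<inter> S j = {}"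
  shows "bexp p (\<Union>i\<in>I. S i) (\<lambda>B. \<Prod>i\<in>I. f i (B \<inter> S i)) = (\<Prod>i\<in>I. bexp p (S i) (f i))"
  using assms
proof (induction I rule: finite_induct)
  case (insert j I)
  have disj: "S j \<inter> (\<Union>i\<in>I. S i) = {}" using insert.hyps insert.prems(2) by blast
  have fin: "finite (S j)" "finite (\<Union>i\<in>I. S i)" using insert.hyps insert.prems(1) by auto
  have "bexp p (\<Union>i\<in>insert j I. S i) (\<lambda>B. \<Prod>i\<in>insert j I. f i (B \<inter> S i))
      = bexp p (S j) (\<lambda>A. bexp p (\<Union>i\<in>I. S i) (\<lambda>B. \<Prod>i\<in>insert j I. f i ((A \<union> B) \<inter> S i)))"
    using bexp_union[OF fin disj, of p "\<lambda>B. \<Prod>i\<in>insert j I. f i (B \<inter> S i)"] by simp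
  also have "\<dots> = bexp p (S j) (\<lambda>A. bexp p (\<Union>i\<in>I. S i) (\<lambda>B. f j A * (\<Prod>i\<in>I. f i (B \<inter> S i))))"
  proof (intro bexp_cong)
    fix A B assume A: "A \<subseteq> S j" and B: "B \<subseteq> (\<Union>i\<in>I. S i)"
    have "(A \<union> B) \<inter> S j = A" using A B disj by blast
    moreover have "(A \<union> B) \<inter> S i = B \<inter> S i" if "i \<in> I" for i
      using A disj that by blast
    ultimately show "(\<Prod>i\<in>insert j I. f i ((A \<union> B) \<inter> S i)) = f j A * (\<Prod>i\<in>I. f i (B \<inter> S i))"
      using insert.hyps by simp
  qed
  also have "\<dots> = bexp p (S j) (f j) * bexp p (\<Union>i\<in>I. S i) (\<lambda>B. \<Prod>i\<in>I. f i (B \<inter> S i))"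
    by (simp add: bexp_cmult bexp_cmult_right)
  also have "bexp p (\<Union>i\<in>I. S i) (\<lambda>B. \<Prod>i\<in>I. f i (B \<inter> S i)) = (\<Prod>i\<in>I. bexp p (S i) (f i))"
    using insert.prems by (intro insert.IH) auto
  finally show ?case using insert.hyps by simp
qed simp

section \<open>Deleting a small vertex set from a seeded random graph\<close>

definition edge :: "nat \<Rightarrow> nat \<Rightarrow> edge" where
  "edge x y = (min x y, max x y)"

lemma edge_eq_iff: "edge x y = edge u v \<longleftrightarrow> x = u \<and> y = v \<or> x = v \<and> y = u"
  by (auto simp: edge_def min_def max_def)

lemma edge_mem_edges_on: "x \<in> V \<Longrightarrow> y \<in> V \<Longrightarrow> x \<noteq> y \<Longrightarrow> edge x y \<in> edges_on V"
  by (auto simp: edge_def edges_on_def min_def max_def)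

lemma edges_on_split:
  assumes "Z \<subseteq> V"
  shows "edges_on V = edges_on (V - Z) \<union> ((\<Union>z\<in>Z. edge z ` (V - Z)) \<union> edges_on Z)"
    "edges_on (V - Z) \<inter> ((\<Union>z\<in>Z. edge z ` (V - Z)) \<union> edges_on Z) = {}"
    "(\<Union>z\<in>Z. edge z ` (V - Z)) \<inter> edges_on Z = {}"
proof -
  have "e \<in> edges_on (V - Z) \<union> ((\<Union>z\<in>Z. edge z ` (V - Z)) \<union> edges_on Z)" if eV: "e \<in> edges_on V" for e
  proof -
    obtain i j where e: "e = (i, j)" "i \<in> V" "j \<in> V" "i < j" using eV by (auto simp: edges_on_def)
    consider "i \<in> Z" "j \<in> Z" | "i \<notin> Z" "j \<notin> Z" | "i \<in> Z" "j \<notin> Z" | "i \<notin> Z" "j \<in> Z" by blast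
    then show ?thesis
    proof cases
      case 3
      have "e = edge i j" using e by (simp add: edge_def)
      then show ?thesis using 3 e by blast
    next
      case 4
      have "e = edge j i" using e by (simp add: edge_def)
      then show ?thesis using 4 e by blast
    qed (use e in \<open>auto simp: edges_on_def\<close>)
  qed
  moreover have "edge z u \<in> edges_on V" if "z \<in> Z" "u \<in> V - Z" for z u
    using that assms by (intro edge_mem_edges_on) auto
  moreover have "edges_on (V - Z) \<subseteq> edges_on V" "edges_on Z \<subseteq> edges_on V"
    using assms by (auto simp: edges_on_def)
  ultimately show "edges_on V = edges_on (V - Z) \<union> ((\<Union>z\<in>Z. edge z ` (V - Z)) \<union> edges_on Z)"
    by blast
  show "edges_on (V - Z) \<inter> ((\<Union>z\<in>Z. edge z ` (V - Z)) \<union> edges_on Z) = {}"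
    by (auto simp: edges_on_def edge_def min_def max_def split: if_splits)
  show "(\<Union>z\<in>Z. edge z ` (V - Z)) \<inter> edges_on Z = {}"
    by (auto simp: edges_on_def edge_def min_def max_def split: if_splits)
qed

text \<open>If two vertices of \<open>Z\<close> are not joined through an unseeded component of the remaining graph, a vertex of
  \<open>Z\<close> is reached from a seed only directly from the part reached without \<open>Z\<close>.\<close>

lemma reach_cavity:
  assumes Z: "Z \<subseteq> V" and B: "B0 \<subseteq> edges_on (V - Z)" "B1 \<subseteq> (\<Union>z\<in>Z. edge z ` (V - Z))"
    and W: "W0 \<subseteq> V - Z" "W1 \<subseteq> Z" and z: "z \<in> Z" "z \<in> reach V (B0 \<union> B1) (W0 \<union> W1)" "z \<notin> W1"
    and no: "edge z ` reach (V - Z) B0 W0 \<inter> B1 = {}"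
  shows "\<exists>z'\<in>Z - {z}. \<exists>u\<in>V - Z. \<exists>u'\<in>V - Z. edge z u \<in> B1 \<and> edge z' u' \<in> B1 \<and> (u, u') \<in> conn B0
     \<and> component (V - Z) B0 u \<inter> W0 = {}"
proof (rule ccontr)
  assume contra: "\<not> ?thesis"
  define N where "N = {u \<in> V - Z. edge z u \<in> B1}"
  \<comment> \<open>If the claim fails, this set, made of \<open>z\<close> and the unseeded
    components it attaches to, is closed under all edges and contains no seed, so \<open>z\<close>
    is not reached.\<close>
  define S where "S = insert z {v \<in> V - Z. \<exists>u\<in>N. (u, v) \<in> conn B0}"
  have unseeded: "component (V - Z) B0 u \<inter> W0 = {}" if "u \<in> N" for u
  proof -
    have "u \<notin> reach (V - Z) B0 W0" using that no by (auto simp: N_def)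
    then show ?thesis using that W(1) reach_iff_component[of W0 "V - Z" u B0] by (auto simp: N_def)
  qed
  have S_seed: "w \<notin> S" if "w \<in> W0 \<union> W1" for w
  proof
    assume "w \<in> S"
    moreover have "w \<noteq> z" using that z W by auto
    ultimately obtain u where u: "u \<in> N" "(u, w) \<in> conn B0" "w \<in> V - Z" by (auto simp: S_def)
    then have "w \<in> W0" using that W by auto
    then show False using unseeded[OF u(1)] u by (auto simp: component_def)
  qed
  have closed: "x \<in> S \<longleftrightarrow> y \<in> S" if "(x, y) \<in> B0 \<union> B1" for x y
    using that
  proof
    assume xy: "(x, y) \<in> B0"
    then have "x \<in> V - Z" "y \<in> V - Z" using B(1) by (auto simp: edges_on_def)
    moreover have "(u, x) \<in> conn B0 \<longleftrightarrow> (u, y) \<in> conn B0" for u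
      using conn_trans[OF _ conn_base[OF xy]] conn_trans[OF _ conn_sym[OF conn_base[OF xy]]] by blast
    ultimately show ?thesis using z(1) by (auto simp: S_def)
  next
    assume xy: "(x, y) \<in> B1"
    then obtain z' u' where zu: "z' \<in> Z" "u' \<in> V - Z" "(x, y) = edge z' u'" using B(2) by blast
    have "z' \<in> S \<longleftrightarrow> u' \<in> S"
    proof (cases "z' = z")
      case True
      then have "u' \<in> N" using zu xy by (simp add: N_def)
      then have "u' \<in> S" using zu(2) conn_refl[of u' B0] unfolding S_def by blast
      then show ?thesis using True by (simp add: S_def)
    next
      case False
      have "u' \<notin> S"
      proof
        assume "u' \<in> S"
        then obtain u where "u \<in> N" "(u, u') \<in> conn B0" using zu z(1) by (auto simp: S_def)
        moreover from this have "u \<in> V - Z" "edge z u \<in> B1" by (auto simp: N_def)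
        moreover have "z' \<in> Z - {z}" "edge z' u' \<in> B1" using False zu xy by auto
        ultimately show False using contra zu(2) unseeded[of u] by blast
      qed
      moreover have "z' \<notin> S" using False zu by (auto simp: S_def)
      ultimately show ?thesis by simp
    qed
    moreover have "x = z' \<and> y = u' \<or> x = u' \<and> y = z'"
      using zu(3) by (auto simp: edge_def min_def max_def split: if_splits)
    ultimately show ?thesis by auto
  qed
  obtain w where "w \<in> W0 \<union> W1" "(w, z) \<in> conn (B0 \<union> B1)" using z(2) by (auto simp: reach_def)
  then have "w \<in> S \<longleftrightarrow> z \<in> S" using conn_avoid[of "B0 \<union> B1" S, OF closed] by blast
  then show False using S_seed \<open>w \<in> W0 \<union> W1\<close> by (auto simp: S_def)
qed

text \<open>Probability that a vertex is a seed itself or has an edge to one of \<open>r\<close>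
  given vertices.\<close>

definition hit :: "real \<Rightarrow> real \<Rightarrow> nat \<Rightarrow> real" where
  "hit p \<delta> r = 1 - (1 - \<delta>) * (1 - p) ^ r"

lemma hit_mono: "0 \<le> p \<Longrightarrow> p \<le> 1 \<Longrightarrow> 0 \<le> \<delta> \<Longrightarrow> \<delta> \<le> 1 \<Longrightarrow> r \<le> r' \<Longrightarrow> hit p \<delta> r \<le> hit p \<delta> r'"
  unfolding hit_def by (simp add: mult_left_mono power_decreasing)

lemma hit_bounds: "0 \<le> p \<Longrightarrow> p \<le> 1 \<Longrightarrow> 0 \<le> \<delta> \<Longrightarrow> \<delta> \<le> 1 \<Longrightarrow> 0 \<le> hit p \<delta> r \<and> hit p \<delta> r \<le> 1"
  unfolding hit_def by (simp add: mult_le_one power_le_one)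

text \<open>The vertices of \<open>Z\<close> have disjoint stars of edges to \<open>V - Z\<close>
  and separate seed choices, so for fixed \<open>R\<close> their hits are independent.\<close>

lemma all_hit_probability:
  fixes p \<delta> :: real
  assumes V: "finite V" "Z \<subseteq> V" and p: "0 \<le> p" "p \<le> 1" and R: "R \<subseteq> V - Z"
  shows "bexp \<delta> Z (\<lambda>W. bexp p (\<Union>z\<in>Z. edge z ` (V - Z))
      (\<lambda>B. of_bool (\<forall>z\<in>Z. z \<in> W \<or> edge z ` R \<inter> B \<noteq> {}))) = hit p \<delta> (card R) ^ card Z"
proof -
  have finZ: "finite Z" using V finite_subset by blast
  let ?S = "\<lambda>z. edge z ` (V - Z)"
  have dS: "?S i \<inter> ?S j = {}" if "i \<in> Z" "j \<in> Z" "i \<noteq> j" for i j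
    using that by (auto simp: edge_eq_iff)
  define y where "y = 1 - (1 - p) ^ card R"
  have inner: "bexp p (\<Union>z\<in>Z. ?S z) (\<lambda>B. of_bool (\<forall>z\<in>Z. z \<in> W \<or> edge z ` R \<inter> B \<noteq> {}))
      = y ^ card (Z - W)" for W
  proof -
    have "bexp p (\<Union>z\<in>Z. ?S z) (\<lambda>B. of_bool (\<forall>z\<in>Z. z \<in> W \<or> edge z ` R \<inter> B \<noteq> {}))
        = bexp p (\<Union>z\<in>Z. ?S z) (\<lambda>B. \<Prod>z\<in>Z. (\<lambda>B. of_bool (z \<in> W \<or> edge z ` R \<inter> B \<noteq> {}) :: real) (B \<inter> ?S z))"
    proof (rule bexp_cong)
      fix B
      have "edge z ` R \<inter> (B \<inter> ?S z) = edge z ` R \<inter> B" for z using R by auto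
      then have "(\<Prod>z\<in>Z. of_bool (z \<in> W \<or> edge z ` R \<inter> (B \<inter> ?S z) \<noteq> {}))
          = (\<Prod>z\<in>Z. of_bool (z \<in> W \<or> edge z ` R \<inter> B \<noteq> {}) :: real)" by simp
      also have "\<dots> = of_bool (\<forall>z\<in>Z. z \<in> W \<or> edge z ` R \<inter> B \<noteq> {})"
      proof (cases "\<forall>z\<in>Z. z \<in> W \<or> edge z ` R \<inter> B \<noteq> {}")
        case False
        then show ?thesis using finZ by (auto intro!: prod_zero)
      qed simp
      finally show "of_bool (\<forall>z\<in>Z. z \<in> W \<or> edge z ` R \<inter> B \<noteq> {})
          = (\<Prod>z\<in>Z. (\<lambda>B. of_bool (z \<in> W \<or> edge z ` R \<inter> B \<noteq> {}) :: real) (B \<inter> ?S z))" by simp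
    qed
    also have "\<dots> = (\<Prod>z\<in>Z. bexp p (?S z) (\<lambda>B. of_bool (z \<in> W \<or> edge z ` R \<inter> B \<noteq> {})))"
      using finZ V dS by (intro bexp_prod) auto
    also have "\<dots> = (\<Prod>z\<in>Z. if z \<in> W then 1 else y)"
    proof (rule prod.cong[OF refl])
      fix z assume z: "z \<in> Z"
      show "bexp p (?S z) (\<lambda>B. of_bool (z \<in> W \<or> edge z ` R \<inter> B \<noteq> {})) = (if z \<in> W then 1 else y)"
      proof (cases "z \<in> W")
        case True
        then show ?thesis using V by simp
      next
        case False
        have inj: "inj_on (edge z) R" by (auto simp: inj_on_def edge_eq_iff)
        have "bexp p (?S z) (\<lambda>B. of_bool (z \<in> W \<or> edge z ` R \<inter> B \<noteq> {}))
            = bexp p (?S z) (\<lambda>B. 1 + (- 1) * (if B \<inter> edge z ` R = {} then 1 else 0))"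
          using False by (intro bexp_cong) (auto simp: Int_commute)
        also have "\<dots> = 1 - (1 - p) ^ card (edge z ` R)"
        proof -
          have "bexp p (?S z) (\<lambda>B. if B \<inter> edge z ` R = {} then 1 else 0) = (1 - p) ^ card (edge z ` R)"
            using V R by (intro bexp_disjoint) auto
          then show ?thesis using V unfolding bexp_add bexp_cmult by simp
        qed
        finally show ?thesis using False inj by (simp add: y_def card_image)
      qed
    qed
    also have "\<dots> = y ^ card (Z - W)"
      using finZ by (simp add: prod.If_cases Diff_eq)
    finally show ?thesis .
  qed
  have "\<delta> + (1 - \<delta>) * y = hit p \<delta> (card R)" by (simp add: y_def hit_def algebra_simps)
  then show ?thesis unfolding inner using bexp_power_compl[OF finZ, of \<delta> y] by simp
qed

lemma bexp_swap:
  "bexp p S (\<lambda>A. bexp q T (\<lambda>B. f A B)) = bexp q T (\<lambda>B. bexp p S (\<lambda>A. f A B))"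
  unfolding bexp_def sum_distrib_left by (subst sum.swap) (simp add: mult.left_commute)

lemma bexp_nonempty_le:
  assumes "finite S" "0 \<le> p" "p \<le> 1"
  shows "bexp p S (\<lambda>B. of_bool (B \<noteq> {})) \<le> real (card S) * p"
proof -
  have "bexp p S (\<lambda>B. of_bool (B \<noteq> {})) = bexp p S (\<lambda>B. 1 + (- 1) * (if B \<inter> S = {} then 1 else 0))"
    by (intro bexp_cong) (auto simp: Int_absorb2)
  also have "\<dots> = 1 - (1 - p) ^ card S"
    using assms bexp_disjoint[OF assms(1) order_refl, of p] unfolding bexp_add bexp_cmult by simp
  also have "\<dots> \<le> real (card S) * p"
    using Bernoulli_inequality[of "- p" "card S"] assms by simp
  finally show ?thesis .
qed

lemma reach_mono: "V \<subseteq> V' \<Longrightarrow> B \<subseteq> B' \<Longrightarrow> W \<subseteq> W' \<Longrightarrow> reach V B W \<subseteq> reach V' B' W'"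
  using conn_mono[of B B'] by (fastforce simp: reach_def)

definition seeded :: "real \<Rightarrow> real \<Rightarrow> nat set \<Rightarrow> (edge set \<Rightarrow> nat set \<Rightarrow> real) \<Rightarrow> real" where
  "seeded p \<delta> V f = bexp p (edges_on V) (\<lambda>B. bexp \<delta> V (f B))"

lemma card_edges_on_le: "finite Z \<Longrightarrow> card (edges_on Z) \<le> (card Z)\<^sup>2"
  using card_mono[OF _ edges_on_subset, of Z] by (simp add: card_cartesian_product power2_eq_square)

text \<open>If all of \<open>Z\<close> is reached, then an edge lies inside \<open>Z\<close> (first
  term), or two vertices of \<open>Z\<close> attach to a common unseeded component (second term, by
  \<open>unseeded_bound\<close>), or each vertex of \<open>Z\<close> is a seed or adjacent to the
  part reached within \<open>V - Z\<close>. The hits in the last case are independent, and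
  monotonicity replaces \<open>V - Z\<close> by \<open>V\<close>.\<close>

lemma cavity_bound:
  fixes p \<delta> :: real
  assumes V: "finite V" "Z \<subseteq> V" and p: "0 \<le> p" "p \<le> 1" and \<delta>: "0 < \<delta>" "\<delta> \<le> 1"
  defines "k \<equiv> real (card Z)"
  shows "seeded p \<delta> V (\<lambda>B W. of_bool (Z \<subseteq> reach V B W))
    \<le> k\<^sup>2 * p + k\<^sup>2 * p\<^sup>2 * (card V / \<delta>) + seeded p \<delta> V (\<lambda>B W. hit p \<delta> (card (reach V B W)) ^ card Z)"
proof -
  define E0 where "E0 = edges_on (V - Z)"
  define E1 where "E1 = (\<Union>z\<in>Z. edge z ` (V - Z))"
  define E2 where "E2 = edges_on Z"
  have finZ: "finite Z" using V finite_subset by blast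
  have fin: "finite E0" "finite E1" "finite E2" "finite (V - Z)"
    using V finZ by (auto simp: E0_def E1_def E2_def)
  have split: "seeded p \<delta> V f = bexp p E0 (\<lambda>B0. bexp p E1 (\<lambda>B1. bexp p E2 (\<lambda>B2.
      bexp \<delta> (V - Z) (\<lambda>W0. bexp \<delta> Z (\<lambda>W1. f (B0 \<union> (B1 \<union> B2)) (W0 \<union> W1))))))" for f
  proof -
    have W: "bexp \<delta> V g = bexp \<delta> (V - Z) (\<lambda>W0. bexp \<delta> Z (\<lambda>W1. g (W0 \<union> W1)))" for g
    proof -
      have "V = (V - Z) \<union> Z" using V by auto
      then have "bexp \<delta> V g = bexp \<delta> ((V - Z) \<union> Z) g" by simp
      also have "\<dots> = bexp \<delta> (V - Z) (\<lambda>W0. bexp \<delta> Z (\<lambda>W1. g (W0 \<union> W1)))"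
        using fin finZ by (intro bexp_union) auto
      finally show ?thesis .
    qed
    have "seeded p \<delta> V f = bexp p (E0 \<union> (E1 \<union> E2)) (\<lambda>B. bexp \<delta> V (f B))"
      unfolding seeded_def E0_def E1_def E2_def edges_on_split(1)[OF V(2)] ..
    also have "\<dots> = bexp p E0 (\<lambda>B0. bexp p (E1 \<union> E2) (\<lambda>B. bexp \<delta> V (f (B0 \<union> B))))"
      using fin edges_on_split(2)[OF V(2)] unfolding E0_def E1_def E2_def by (intro bexp_union) auto
    also have "\<dots> = bexp p E0 (\<lambda>B0. bexp p E1 (\<lambda>B1. bexp p E2 (\<lambda>B2. bexp \<delta> V (f (B0 \<union> (B1 \<union> B2))))))"
      using fin edges_on_split(3)[OF V(2)] unfolding E0_def E1_def E2_def
      by (intro bexp_cong bexp_union) auto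
    finally show ?thesis unfolding W .
  qed
  define U where "U = V - Z"
  \<comment> \<open>Summing over pairs of attaching edges makes each term a product of a function of
    the edges at \<open>Z\<close> and one of the graph on \<open>V - Z\<close>.\<close>
  define bad where "bad B0 B1 W0 = (\<Sum>z\<in>Z. \<Sum>z'\<in>Z - {z}. \<Sum>u\<in>U. \<Sum>u'\<in>U.
      of_bool ({edge z u, edge z' u'} \<subseteq> B1) * of_bool ((u, u') \<in> conn B0 \<and> component U B0 u \<inter> W0 = {}) :: real)"
    for B0 B1 W0
  define good where "good B0 B1 W0 W1 = (of_bool (\<forall>z\<in>Z. z \<in> W1 \<or> edge z ` reach U B0 W0 \<inter> B1 \<noteq> {}) :: real)"
    for B0 B1 W0 W1
  have bad0: "0 \<le> bad B0 B1 W0" for B0 B1 W0 by (auto simp: bad_def intro!: sum_nonneg)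
  have pt: "of_bool (Z \<subseteq> reach V (B0 \<union> (B1 \<union> B2)) (W0 \<union> W1))
      \<le> of_bool (B2 \<noteq> {}) + (bad B0 B1 W0 + good B0 B1 W0 W1)"
    if B: "B0 \<subseteq> E0" "B1 \<subseteq> E1" and W: "W0 \<subseteq> V - Z" "W1 \<subseteq> Z" for B0 B1 B2 W0 W1
  proof (cases "Z \<subseteq> reach V (B0 \<union> (B1 \<union> B2)) (W0 \<union> W1) \<and> B2 = {} \<and> good B0 B1 W0 W1 = 0")
    case True
    then obtain z where z: "z \<in> Z" "z \<notin> W1" "edge z ` reach (V - Z) B0 W0 \<inter> B1 = {}"
      by (auto simp: good_def U_def)
    have "z \<in> reach V (B0 \<union> B1) (W0 \<union> W1)" using True z(1) by auto
    from reach_cavity[OF V(2) B(1)[unfolded E0_def] B(2)[unfolded E1_def] W z(1) this z(2,3)]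
    obtain z' u u' where *: "z' \<in> Z - {z}" "u \<in> U" "u' \<in> U" "edge z u \<in> B1" "edge z' u' \<in> B1"
        "(u, u') \<in> conn B0" "component U B0 u \<inter> W0 = {}" unfolding U_def by blast
    let ?t = "\<lambda>z z' u u'. of_bool ({edge z u, edge z' u'} \<subseteq> B1) * of_bool ((u, u') \<in> conn B0 \<and> component U B0 u \<inter> W0 = {}) :: real"
    have finU: "finite U" using fin by (simp add: U_def)
    have "1 = ?t z z' u u'" using * by simp
    also have "\<dots> \<le> (\<Sum>u'\<in>U. ?t z z' u u')"
      using *(3) finU by (intro member_le_sum[of u' U "?t z z' u"]) auto
    also have "\<dots> \<le> (\<Sum>u\<in>U. \<Sum>u'\<in>U. ?t z z' u u')"
      using *(2) finU by (intro member_le_sum[of u U "\<lambda>u. \<Sum>u'\<in>U. ?t z z' u u'"]) (auto intro!: sum_nonneg)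
    also have "\<dots> \<le> (\<Sum>z'\<in>Z - {z}. \<Sum>u\<in>U. \<Sum>u'\<in>U. ?t z z' u u')"
      using *(1) finZ by (intro member_le_sum[of z' "Z - {z}" "\<lambda>z'. \<Sum>u\<in>U. \<Sum>u'\<in>U. ?t z z' u u'"])
        (auto intro!: sum_nonneg)
    also have "\<dots> \<le> bad B0 B1 W0"
      unfolding bad_def using z(1) finZ
      by (intro member_le_sum[of z Z "\<lambda>z. \<Sum>z'\<in>Z - {z}. \<Sum>u\<in>U. \<Sum>u'\<in>U. ?t z z' u u'"])
        (auto intro!: sum_nonneg)
    finally show ?thesis by (simp add: good_def)
  next
    case False
    have "good B0 B1 W0 W1 = 0 \<or> good B0 B1 W0 W1 = 1" unfolding good_def of_bool_def by meson
    then show ?thesis using False bad0[of B0 B1 W0] by (auto simp: of_bool_def split: if_splits)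
  qed
  have "seeded p \<delta> V (\<lambda>B W. of_bool (Z \<subseteq> reach V B W))
      \<le> bexp p E0 (\<lambda>B0. bexp p E1 (\<lambda>B1. bexp p E2 (\<lambda>B2. bexp \<delta> (V - Z) (\<lambda>W0. bexp \<delta> Z (\<lambda>W1.
          of_bool (B2 \<noteq> {}) + (bad B0 B1 W0 + good B0 B1 W0 W1))))))"
    unfolding split using p \<delta> by (intro bexp_mono pt) auto
  also have "\<dots> = bexp p E2 (\<lambda>B2. of_bool (B2 \<noteq> {}))
      + (bexp p E0 (\<lambda>B0. bexp p E1 (\<lambda>B1. bexp \<delta> (V - Z) (\<lambda>W0. bad B0 B1 W0)))
      + bexp p E0 (\<lambda>B0. bexp p E1 (\<lambda>B1. bexp \<delta> (V - Z) (\<lambda>W0. bexp \<delta> Z (\<lambda>W1. good B0 B1 W0 W1)))))"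
    using fin finZ by (simp add: bexp_add)
  also have "\<dots> \<le> k\<^sup>2 * p + (k\<^sup>2 * p\<^sup>2 * (card V / \<delta>)
      + seeded p \<delta> V (\<lambda>B W. hit p \<delta> (card (reach V B W)) ^ card Z))"
  proof (intro add_mono)
    have "bexp p E2 (\<lambda>B2. of_bool (B2 \<noteq> {})) \<le> real (card E2) * p"
      using fin p by (intro bexp_nonempty_le)
    also have "\<dots> \<le> real ((card Z)\<^sup>2) * p"
      using card_edges_on_le[OF finZ] p unfolding E2_def by (intro mult_right_mono of_nat_mono)
    finally show "bexp p E2 (\<lambda>B2. of_bool (B2 \<noteq> {})) \<le> k\<^sup>2 * p" by (simp add: k_def)
  next
    define c where "c u u' = bexp p E0 (\<lambda>B0. bexp \<delta> U (\<lambda>W0.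
        of_bool ((u, u') \<in> conn B0 \<and> component U B0 u \<inter> W0 = {})))" for u u'
    have c0: "0 \<le> c u u'" for u u'
      unfolding c_def using p \<delta> by (intro bexp_nonneg) auto
    have csum: "(\<Sum>u\<in>U. \<Sum>u'\<in>U. c u u') \<le> card V / \<delta>"
    proof -
      have "(\<Sum>u\<in>U. \<Sum>u'\<in>U. c u u') = bexp p E0 (\<lambda>B0. \<Sum>u\<in>U. \<Sum>u'\<in>U. bexp \<delta> U (\<lambda>W0.
          of_bool ((u, u') \<in> conn B0 \<and> component U B0 u \<inter> W0 = {})))"
        unfolding c_def bexp_sum ..
      also have "\<dots> \<le> bexp p E0 (\<lambda>_. card U / \<delta>)"
        using p \<delta> fin by (intro bexp_mono unseeded_bound) (auto simp: U_def)
      also have "\<dots> \<le> card V / \<delta>"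
        using fin V \<delta> by (simp add: U_def divide_right_mono card_mono)
      finally show ?thesis .
    qed
    have "bexp p E0 (\<lambda>B0. bexp p E1 (\<lambda>B1. bexp \<delta> (V - Z) (\<lambda>W0. bad B0 B1 W0)))
        = (\<Sum>z\<in>Z. \<Sum>z'\<in>Z - {z}. \<Sum>u\<in>U. \<Sum>u'\<in>U.
            bexp p E1 (\<lambda>B1. of_bool ({edge z u, edge z' u'} \<subseteq> B1)) * c u u')"
      unfolding bad_def c_def bexp_sum bexp_cmult bexp_cmult_right U_def ..
    also have "\<dots> \<le> (\<Sum>z\<in>Z. \<Sum>z'\<in>Z - {z}. \<Sum>u\<in>U. \<Sum>u'\<in>U. p\<^sup>2 * c u u')"
    proof (intro sum_mono mult_right_mono c0)
      fix z z' u u' assume *: "z \<in> Z" "z' \<in> Z - {z}" "u \<in> U" "u' \<in> U"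
      have "edge z u \<noteq> edge z' u'" using * by (auto simp: edge_eq_iff U_def)
      then have c2: "card {edge z u, edge z' u'} = 2" by simp
      have "bexp p E1 (\<lambda>B1. of_bool ({edge z u, edge z' u'} \<subseteq> B1)) \<le> p ^ card {edge z u, edge z' u'}"
        using fin p * by (intro bexp_superset) (auto simp: E1_def U_def)
      then show "bexp p E1 (\<lambda>B1. of_bool ({edge z u, edge z' u'} \<subseteq> B1)) \<le> p\<^sup>2"
        unfolding c2 .
    qed
    also have "\<dots> = (\<Sum>z\<in>Z. real (card (Z - {z}))) * (p\<^sup>2 * (\<Sum>u\<in>U. \<Sum>u'\<in>U. c u u'))"
    proof -
      have "(\<Sum>u\<in>U. \<Sum>u'\<in>U. p\<^sup>2 * c u u') = p\<^sup>2 * (\<Sum>u\<in>U. \<Sum>u'\<in>U. c u u')"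
        by (simp only: sum_distrib_left)
      then show ?thesis by (simp only: sum_constant sum_distrib_right)
    qed
    also have "\<dots> \<le> (k * k) * (p\<^sup>2 * (card V / \<delta>))"
    proof (intro mult_mono mult_left_mono csum)
      have "(\<Sum>z\<in>Z. real (card (Z - {z}))) \<le> (\<Sum>z\<in>Z. k)"
        unfolding k_def using finZ by (intro sum_mono of_nat_mono card_mono) auto
      then show "(\<Sum>z\<in>Z. real (card (Z - {z}))) \<le> k * k" by (simp add: k_def)
    qed (use c0 in \<open>auto simp: k_def intro!: mult_nonneg_nonneg sum_nonneg\<close>)
    finally show "bexp p E0 (\<lambda>B0. bexp p E1 (\<lambda>B1. bexp \<delta> (V - Z) (\<lambda>W0. bad B0 B1 W0)))
        \<le> k\<^sup>2 * p\<^sup>2 * (card V / \<delta>)" by (simp add: power2_eq_square mult.assoc)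
  next
    \<comment> \<open>The crossing edges are averaged first, with the part reached within
      \<open>V - Z\<close> held fixed.\<close>
    have "bexp p E0 (\<lambda>B0. bexp p E1 (\<lambda>B1. bexp \<delta> (V - Z) (\<lambda>W0. bexp \<delta> Z (\<lambda>W1. good B0 B1 W0 W1))))
        = bexp p E0 (\<lambda>B0. bexp \<delta> (V - Z) (\<lambda>W0. bexp \<delta> Z (\<lambda>W1. bexp p E1 (\<lambda>B1. good B0 B1 W0 W1))))"
      by (subst bexp_swap[where p = p and q = \<delta> and S = E1 and T = "V - Z"],
          subst bexp_swap[where p = p and q = \<delta> and S = E1 and T = Z]) (rule refl)
    also have "\<dots> = bexp p E0 (\<lambda>B0. bexp \<delta> (V - Z) (\<lambda>W0. hit p \<delta> (card (reach U B0 W0)) ^ card Z))"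
      unfolding good_def E1_def
      by (subst all_hit_probability[OF V p]) (auto simp: U_def reach_def)
    also have "\<dots> = bexp p E0 (\<lambda>B0. bexp p E1 (\<lambda>B1. bexp p E2 (\<lambda>B2. bexp \<delta> (V - Z) (\<lambda>W0. bexp \<delta> Z (\<lambda>W1.
        hit p \<delta> (card (reach U B0 W0)) ^ card Z)))))"
      using fin finZ by simp
    also have "\<dots> \<le> seeded p \<delta> V (\<lambda>B W. hit p \<delta> (card (reach V B W)) ^ card Z)"
      unfolding split
    proof (intro bexp_mono power_mono hit_mono card_mono)
      fix B0 B1 B2 W0 W1
      show "reach U B0 W0 \<subseteq> reach V (B0 \<union> (B1 \<union> B2)) (W0 \<union> W1)"
        by (rule reach_mono) (auto simp: U_def)
    qed (use V p \<delta> hit_bounds[of p \<delta>] in auto)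
    finally show "bexp p E0 (\<lambda>B0. bexp p E1 (\<lambda>B1. bexp \<delta> (V - Z) (\<lambda>W0. bexp \<delta> Z (\<lambda>W1. good B0 B1 W0 W1))))
        \<le> seeded p \<delta> V (\<lambda>B W. hit p \<delta> (card (reach V B W)) ^ card Z)" .
  qed
  finally show ?thesis by simp
qed

text \<open>Drawing \<open>k\<close> elements with or without replacement differs by at most
  \<open>k\<^sup>2 / n\<close>. This turns a power of a density into a probability for a random set
  of size \<open>k\<close>.\<close>

lemma binomial_ratio_bound:
  assumes "r \<le> n" "k \<le> n" "0 < n"
  shows "(real r / n) ^ k \<le> real (r choose k) / real (n choose k) + (real k)\<^sup>2 / n"
  using assms(2)
proof (induction k)
  case (Suc k)
  define a where "a = real (r choose k) / real (n choose k)"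
  define t where "t = real (r - k) / real (n - k)"
  have kn: "k < n" using Suc by simp
  have pos: "0 < real (n choose k)" using kn by simp
  have a01: "0 \<le> a" "a \<le> 1"
  proof -
    have Suc_le: "m choose k \<le> Suc m choose k" for m by (cases k) simp_all
    have "m choose k \<le> (m + d) choose k" for m d
      by (induction d) (auto intro: order_trans[OF _ Suc_le])
    from this[of r "n - r"] have "r choose k \<le> n choose k" using assms(1) by simp
    then show "0 \<le> a" "a \<le> 1" using pos by (simp_all add: a_def)
  qed
  have rec: "real (m choose Suc k) * real (Suc k) = real (m choose k) * real (m - k)" for m
    using binomial_absorb_comp[of m k] binomial_absorption[of k m]
    by (metis Suc_times_binomial_add mult.commute of_nat_mult binomial_absorb_comp times_binomial_minus1_eq)
  have next_a: "real (r choose Suc k) / real (n choose Suc k) = a * t"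
  proof -
    have "real (m choose Suc k) = real (m choose k) * real (m - k) / real (Suc k)" for m
      using rec[of m] by (simp add: field_simps)
    then show ?thesis by (simp add: a_def t_def)
  qed
  have t: "real r / n \<le> t + real k / n"
  proof -
    have "real r - real k \<le> real (r - k)" by simp
    then have "(real r - real k) / n \<le> real (r - k) / n" by (intro divide_right_mono) auto
    also have "\<dots> \<le> t" unfolding t_def using kn by (intro divide_left_mono) auto
    finally show ?thesis by (simp add: diff_divide_distrib)
  qed
  have rn: "0 \<le> real r / n" "real r / n \<le> 1" using assms by auto
  have "(real r / n) ^ Suc k \<le> (a + (real k)\<^sup>2 / n) * (real r / n)"
    unfolding power_Suc2 a_def using Suc rn by (intro mult_right_mono) auto
  also have "\<dots> = a * (real r / n) + (real k)\<^sup>2 / n * (real r / n)" by (simp only: distrib_right)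
  also have "\<dots> \<le> a * (t + real k / n) + (real k)\<^sup>2 / n * 1"
    using a01 t rn by (intro add_mono mult_left_mono) auto
  also have "\<dots> \<le> a * t + real k / n + (real k)\<^sup>2 / n"
    using a01 mult_right_mono[OF a01(2), of "real k / n"] by (simp add: distrib_left)
  also have "\<dots> \<le> a * t + (real (Suc k))\<^sup>2 / n"
    using assms(3) by (simp add: power2_eq_square add_divide_distrib[symmetric] divide_right_mono algebra_simps)
  finally show ?case unfolding next_a .
qed simp

section \<open>Moments of the density reached from the seeds\<close>

lemma seeded_mono:
  assumes "0 \<le> p" "p \<le> 1" "0 \<le> \<delta>" "\<delta> \<le> 1" "\<And>B W. f B W \<le> g B W"
  shows "seeded p \<delta> V f \<le> seeded p \<delta> V g"
  unfolding seeded_def using assms by (intro bexp_mono) auto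

lemma seeded_add: "seeded p \<delta> V (\<lambda>B W. f B W + g B W) = seeded p \<delta> V f + seeded p \<delta> V g"
  by (simp add: seeded_def bexp_add)

lemma seeded_cmult: "seeded p \<delta> V (\<lambda>B W. c * f B W) = c * seeded p \<delta> V f"
  by (simp add: seeded_def bexp_cmult)

lemma seeded_const: "finite V \<Longrightarrow> seeded p \<delta> V (\<lambda>B W. c) = c"
  by (simp add: seeded_def)

lemma seeded_sum: "seeded p \<delta> V (\<lambda>B W. \<Sum>i\<in>I. f i B W) = (\<Sum>i\<in>I. seeded p \<delta> V (f i))"
  by (simp add: seeded_def bexp_sum)

text \<open>The density \<open>X\<close> of the vertices reached satisfies \<open>E (X ^ k) \<le> E ((1 - exp (- c * X)) ^ k)\<close>
  approximately for every \<open>k\<close>. This forces \<open>X\<close> below the fixed point of \<open>1 - exp (- c * x)\<close>.\<close>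

lemma moment_recursion:
  fixes p \<delta> :: real
  assumes V: "finite V" and k: "k \<le> card V" "0 < card V" and p: "0 \<le> p" "p \<le> 1" and \<delta>: "0 < \<delta>" "\<delta> \<le> 1"
  shows "seeded p \<delta> V (\<lambda>B W. (card (reach V B W) / card V) ^ k)
    \<le> (real k)\<^sup>2 / card V + (real k)\<^sup>2 * p + (real k)\<^sup>2 * p\<^sup>2 * (card V / \<delta>)
      + seeded p \<delta> V (\<lambda>B W. hit p \<delta> (card (reach V B W)) ^ k)"
proof -
  let ?n = "card V"
  let ?ZZ = "{Z. Z \<subseteq> V \<and> card Z = k}"
  define H where "H = seeded p \<delta> V (\<lambda>B W. hit p \<delta> (card (reach V B W)) ^ k)"
  define err where "err = (real k)\<^sup>2 * p + (real k)\<^sup>2 * p\<^sup>2 * (?n / \<delta>)"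
  have finZ: "finite ?ZZ" using V by simp
  have N: "real (card ?ZZ) = real (?n choose k)" by (simp add: n_subsets V)
  have pos: "0 < real (?n choose k)" using k by simp
  have cnt: "real (card (reach V B W) choose k) = (\<Sum>Z\<in>?ZZ. of_bool (Z \<subseteq> reach V B W))" for B W
  proof -
    have "(\<Sum>Z\<in>?ZZ. of_bool (Z \<subseteq> reach V B W)) = real (card {Z \<in> ?ZZ. Z \<subseteq> reach V B W})"
      using finZ by (simp add: of_bool_def sum.If_cases Int_def)
    also have "{Z \<in> ?ZZ. Z \<subseteq> reach V B W} = {Z. Z \<subseteq> reach V B W \<and> card Z = k}"
      by (auto simp: reach_def)
    also have "card \<dots> = card (reach V B W) choose k"
      using V by (intro n_subsets) auto
    finally show ?thesis by simp
  qed
  have "seeded p \<delta> V (\<lambda>B W. (card (reach V B W) / ?n) ^ k)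
      \<le> seeded p \<delta> V (\<lambda>B W. 1 / (?n choose k) * (\<Sum>Z\<in>?ZZ. of_bool (Z \<subseteq> reach V B W)) + (real k)\<^sup>2 / ?n)"
  proof (rule seeded_mono)
    fix B W
    have "card (reach V B W) \<le> ?n" using V by (intro card_mono) (auto simp: reach_def)
    then show "(card (reach V B W) / ?n) ^ k
        \<le> 1 / (?n choose k) * (\<Sum>Z\<in>?ZZ. of_bool (Z \<subseteq> reach V B W)) + (real k)\<^sup>2 / ?n"
      using binomial_ratio_bound[of "card (reach V B W)" ?n k] k unfolding cnt[symmetric] by simp
  qed (use p \<delta> in auto)
  also have "\<dots> = 1 / (?n choose k) * (\<Sum>Z\<in>?ZZ. seeded p \<delta> V (\<lambda>B W. of_bool (Z \<subseteq> reach V B W))) + (real k)\<^sup>2 / ?n"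
    using V by (simp only: seeded_add seeded_cmult seeded_sum seeded_const)
  also have "\<dots> \<le> 1 / (?n choose k) * (\<Sum>Z\<in>?ZZ. err + H) + (real k)\<^sup>2 / ?n"
  proof (intro add_right_mono mult_left_mono sum_mono)
    fix Z assume Z: "Z \<in> ?ZZ"
    then show "seeded p \<delta> V (\<lambda>B W. of_bool (Z \<subseteq> reach V B W)) \<le> err + H"
      using cavity_bound[OF V _ p \<delta>, of Z] by (simp add: err_def H_def)
  qed simp
  also have "\<dots> = err + H + (real k)\<^sup>2 / ?n"
    using pos N by simp
  finally show ?thesis by (simp add: err_def H_def)
qed

text \<open>The difference of the two sides vanishes at 0 and has derivative
  \<open>- t\<^sup>2 / (1 - t)\<close>.\<close>

lemma ln_one_minus_quadratic:
  fixes y :: real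
  assumes "0 \<le> y" "y < 1"
  shows "ln (1 - y) \<le> - y - y\<^sup>2 / 2"
proof -
  define g where "g t = ln (1 - t) + t + t\<^sup>2 / 2" for t :: real
  have "g y \<le> g 0"
  proof (rule DERIV_nonpos_imp_nonincreasing[OF assms(1)])
    fix t :: real assume t: "0 \<le> t" "t \<le> y"
    then have t1: "t < 1" using assms by simp
    have "(g has_real_derivative (- 1 / (1 - t) + 1 + t)) (at t)"
      unfolding g_def[abs_def] using t1 by (auto intro!: derivative_eq_intros)
    moreover have "- 1 / (1 - t) + 1 + t = - (t\<^sup>2) / (1 - t)"
      using t1 by (simp add: field_simps power2_eq_square)
    moreover have "- (t\<^sup>2) / (1 - t) \<le> 0" using t1 by (simp add: divide_nonpos_pos)
    ultimately show "\<exists>d. (g has_real_derivative d) (at t) \<and> d \<le> 0" by auto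
  qed
  then show ?thesis by (simp add: g_def)
qed

text \<open>The solution of \<open>1 - exp (- c * x) = x\<close>, the density of the giant component, is at most
  \<open>2 * (c - 1)\<close>.\<close>

lemma giant_density_bound:
  fixes c C \<eta> \<beta> x :: real
  assumes c: "0 \<le> c" "c \<le> C" and \<eta>: "0 < \<eta>" "\<eta> \<le> 1" and \<beta>: "\<beta> = \<eta> / (6 * C + 4)"
    and x: "2 * max 0 (c - 1) + \<eta> \<le> x"
  shows "1 - exp (- (c * x)) \<le> (1 - \<beta>) * x"
proof (rule ccontr)
  define a where "a = max 0 (c - 1)"
  define y where "y = 1 - exp (- (c * x))"
  assume "\<not> ?thesis"
  then have y: "(1 - \<beta>) * x < y" by (simp add: y_def)
  have C: "0 \<le> C" using c by simp
  have \<beta>0: "0 < \<beta>" "\<beta> \<le> 1 / 2"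
    using \<eta> C by (auto simp: \<beta> field_simps)
  have a: "0 \<le> a" "c - 1 \<le> a" "a \<le> C" using c by (auto simp: a_def)
  have x0: "0 < x" using x a \<eta> unfolding a_def[symmetric] by linarith
  then have "0 < (1 - \<beta>) * x" using \<beta>0 by simp
  then have y0: "0 < y" using y by linarith
  have y1: "y < 1" by (simp add: y_def)
  have "ln (1 - y) = - (c * x)" by (simp add: y_def)
  \<comment> \<open>With \<open>(1 - \<beta>) * x < y\<close> this yields
    \<open>(1 + y / 2) * (1 - \<beta>) \<le> c\<close>, so \<open>y\<close> is at most about
    \<open>2 * (c - 1)\<close>, which conflicts with the lower bound on \<open>x\<close>.\<close>
  then have "y + y\<^sup>2 / 2 \<le> c * x" using ln_one_minus_quadratic[of y] y0 y1 by simp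
  then have "(y + y\<^sup>2 / 2) * (1 - \<beta>) \<le> c * x * (1 - \<beta>)" using \<beta>0 by (intro mult_right_mono) auto
  also have "\<dots> = c * ((1 - \<beta>) * x)" by simp
  also have "\<dots> \<le> c * y" using y c by (intro mult_left_mono) auto
  finally have "y * ((1 + y / 2) * (1 - \<beta>)) \<le> y * c" by (simp add: power2_eq_square algebra_simps)
  then have 1: "(1 + y / 2) * (1 - \<beta>) \<le> c" using y0 by simp
  have "(1 - \<beta>) * (2 * a + \<eta>) \<le> (1 - \<beta>) * x"
    using x \<beta>0 unfolding a_def by (intro mult_left_mono) auto
  then have 2: "(1 - \<beta>) * (2 * a + \<eta>) < y" using y by simp
  have "(1 - \<beta>) * ((1 - \<beta>) * (2 * a + \<eta>)) < (1 - \<beta>) * y" using 2 \<beta>0 by (intro mult_strict_left_mono) auto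
  also have "\<dots> \<le> 2 * c - 2 * (1 - \<beta>)"
  proof -
    have "2 * ((1 + y / 2) * (1 - \<beta>)) = 2 * (1 - \<beta>) + (1 - \<beta>) * y" by (simp add: field_simps)
    then show ?thesis using 1 by linarith
  qed
  also have "\<dots> \<le> 2 * a + 2 * \<beta>" using a by simp
  finally have 3: "(1 - \<beta>) * ((1 - \<beta>) * (2 * a + \<eta>)) < 2 * a + 2 * \<beta>" .
  have "(1 - 2 * \<beta>) * (2 * a + \<eta>) \<le> (1 - \<beta>) * ((1 - \<beta>) * (2 * a + \<eta>))"
  proof -
    have "(1 - 2 * \<beta>) \<le> (1 - \<beta>) * (1 - \<beta>)" by (simp add: algebra_simps)
    then have "(1 - 2 * \<beta>) * (2 * a + \<eta>) \<le> (1 - \<beta>) * (1 - \<beta>) * (2 * a + \<eta>)"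
      using a \<eta> by (intro mult_right_mono) auto
    then show ?thesis by (simp add: mult.assoc)
  qed
  with 3 have "\<eta> < 2 * \<beta> + 2 * \<beta> * (2 * a + \<eta>)" by (simp add: algebra_simps)
  also have "\<dots> \<le> 2 * \<beta> + 2 * \<beta> * (2 * C + 1)"
    using a \<eta> \<beta>0 by (intro add_left_mono mult_left_mono) auto
  also have "\<dots> = \<beta> * (4 * C + 4)" by (simp add: algebra_simps)
  finally have "\<eta> < \<beta> * (4 * C + 4)" .
  also have "\<dots> \<le> \<beta> * (6 * C + 4)" using C \<beta>0 by (intro mult_left_mono) auto
  also have "\<dots> = \<eta>" using C by (simp add: \<beta>)
  finally show False by simp
qed

text \<open>Above \<open>\<theta>0\<close> the map of \<open>giant_density_bound\<close> contracts
  by a fixed factor, so \<open>moment_recursion\<close> bounds the \<open>k\<close>-th moment by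
  \<open>\<theta>0 ^ k\<close> plus an error, up to the factor \<open>2 / \<beta>\<close>. A Markov
  argument at the level \<open>\<theta>1 = \<theta>0 + \<eta>\<close> converts this into a second
  moment.\<close>

lemma second_moment_bound:
  fixes p c C \<eta> \<beta> \<delta> :: real and k :: nat
  assumes V: "finite V" and k: "1 \<le> k" "k \<le> card V" and c: "0 \<le> c" "c \<le> C"
    and \<eta>: "0 < \<eta>" "\<eta> \<le> 1" and \<beta>: "\<beta> = \<eta> / (6 * C + 4)" and \<delta>: "\<delta> = \<beta> * \<eta> / 2"
    and p: "p = 1 - exp (- (c / card V))"
  shows "seeded p \<delta> V (\<lambda>B W. (card (reach V B W) / card V)\<^sup>2)
    \<le> (2 * max 0 (c - 1) + 2 * \<eta>)\<^sup>2
      + ((1 - \<eta> / (2 * C + 2)) ^ k + (real k)\<^sup>2 / card V * (1 + C + C\<^sup>2 / \<delta>) / \<eta> ^ k) * (2 / \<beta>)"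
proof -
  define n where "n = real (card V)"
  define a where "a = max 0 (c - 1)"
  define \<theta>0 where "\<theta>0 = 2 * a + \<eta>"
  define \<theta>1 where "\<theta>1 = \<theta>0 + \<eta>"
  define X where "X B W = card (reach V B W) / n" for B W
  define M where "M = seeded p \<delta> V (\<lambda>B W. X B W ^ k)"
  define err where "err = (real k)\<^sup>2 / n * (1 + C + C\<^sup>2 / \<delta>)"
  have C: "0 \<le> C" using c by simp
  have n: "1 \<le> n" using k by (simp add: n_def)
  have a: "0 \<le> a" "c - 1 \<le> a" "a \<le> C" using c by (auto simp: a_def)
  have \<beta>0: "0 < \<beta>" "\<beta> \<le> 1 / 2" using \<eta> C by (auto simp: \<beta> field_simps)
  have \<delta>0: "0 < \<delta>" "\<delta> \<le> 1"
  proof -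
    show "0 < \<delta>" using \<beta>0 \<eta> by (simp add: \<delta>)
    have "\<beta> * \<eta> \<le> 1 * 1" using \<beta>0 \<eta> by (intro mult_mono) auto
    then show "\<delta> \<le> 1" by (simp add: \<delta>)
  qed
  have p0: "0 \<le> p" "p \<le> 1" "p \<le> C / n"
  proof -
    show "0 \<le> p" "p \<le> 1" using c by (auto simp: p)
    have "p \<le> c / n" using exp_ge_add_one_self[of "- (c / n)"] by (simp add: p n_def)
    also have "\<dots> \<le> C / n" using c n by (intro divide_right_mono) auto
    finally show "p \<le> C / n" .
  qed
  have \<theta>: "0 < \<theta>0" "\<eta> \<le> \<theta>1" "\<theta>1 \<le> 2 * C + 2" using a \<eta> by (auto simp: \<theta>0_def \<theta>1_def)
  have X01: "0 \<le> X B W" "X B W \<le> 1" for B W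
  proof -
    have "card (reach V B W) \<le> card V" using V by (intro card_mono) (auto simp: reach_def)
    then show "0 \<le> X B W" "X B W \<le> 1" using n by (auto simp: X_def n_def divide_le_eq)
  qed
  \<comment> \<open>The choice \<open>\<delta> = \<beta> * \<eta> / 2\<close> lets the seeds use up
    only half of the contraction margin \<beta>.\<close>
  have hit_le: "hit p \<delta> (card (reach V B W)) \<le> max \<theta>0 ((1 - \<beta> / 2) * X B W)" for B W
  proof -
    have hit_eq: "hit p \<delta> (card (reach V B W)) = 1 - (1 - \<delta>) * exp (- (c * X B W))"
      by (simp add: hit_def p X_def n_def exp_of_nat_mult[symmetric] mult_ac)
    have key: "1 - (1 - \<delta>) * exp (- (c * x)) \<le> (1 - \<beta> / 2) * x" if x: "\<theta>0 \<le> x" for x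
    proof -
      have "(1 - \<delta>) * exp (- (c * x)) = exp (- (c * x)) - \<delta> * exp (- (c * x))" by (simp add: algebra_simps)
      moreover have "exp (- (c * x)) \<le> 1" using c x \<theta> by simp
      then have "\<delta> * exp (- (c * x)) \<le> \<delta> * 1" using \<delta>0 by (intro mult_left_mono) auto
      moreover have "1 - exp (- (c * x)) \<le> (1 - \<beta>) * x"
        using x unfolding \<theta>0_def a_def by (intro giant_density_bound[OF c \<eta> \<beta>])
      moreover have "\<beta> / 2 * \<eta> \<le> \<beta> / 2 * x"
        using x a \<beta>0 by (intro mult_left_mono) (auto simp: \<theta>0_def)
      ultimately show ?thesis by (simp add: \<delta> algebra_simps)
    qed
    show ?thesis
    proof (cases "\<theta>0 \<le> X B W")
      case True
      then show ?thesis using key hit_eq by (simp add: le_max_iff_disj)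
    next
      case False
      then have "exp (- (c * \<theta>0)) \<le> exp (- (c * X B W))" using c by (simp add: mult_left_mono)
      then have "(1 - \<delta>) * exp (- (c * \<theta>0)) \<le> (1 - \<delta>) * exp (- (c * X B W))"
        using \<delta>0 by (intro mult_left_mono) auto
      then have "hit p \<delta> (card (reach V B W)) \<le> (1 - \<beta> / 2) * \<theta>0" using key[of \<theta>0] hit_eq by simp
      also have "\<dots> \<le> 1 * \<theta>0" using \<beta>0 \<theta> by (intro mult_right_mono) auto
      finally show ?thesis by simp
    qed
  qed
  have hit_pow: "hit p \<delta> (card (reach V B W)) ^ k \<le> \<theta>0 ^ k + (1 - \<beta> / 2) * X B W ^ k" for B W
  proof -
    have r: "0 \<le> (1 - \<beta> / 2)" "(1 - \<beta> / 2) \<le> 1" using \<beta>0 by auto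
    have "hit p \<delta> (card (reach V B W)) ^ k \<le> max \<theta>0 ((1 - \<beta> / 2) * X B W) ^ k"
      using hit_bounds[of p \<delta>] p0 \<delta>0 by (intro power_mono hit_le) auto
    also have "\<dots> \<le> \<theta>0 ^ k + ((1 - \<beta> / 2) * X B W) ^ k"
      using \<theta> r X01[of B W] by (auto simp: max_def)
    also have "((1 - \<beta> / 2) * X B W) ^ k = (1 - \<beta> / 2) ^ k * X B W ^ k" by (rule power_mult_distrib)
    also have "(1 - \<beta> / 2) ^ k * X B W ^ k \<le> (1 - \<beta> / 2) ^ 1 * X B W ^ k"
      using r k X01[of B W] by (intro mult_right_mono power_decreasing) auto
    finally show ?thesis by simp
  qed
  have "M \<le> (real k)\<^sup>2 / n + (real k)\<^sup>2 * p + (real k)\<^sup>2 * p\<^sup>2 * (n / \<delta>)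
      + seeded p \<delta> V (\<lambda>B W. hit p \<delta> (card (reach V B W)) ^ k)"
    unfolding M_def X_def n_def using k by (intro moment_recursion V p0 \<delta>0) auto
  also have "seeded p \<delta> V (\<lambda>B W. hit p \<delta> (card (reach V B W)) ^ k)
      \<le> seeded p \<delta> V (\<lambda>B W. \<theta>0 ^ k + (1 - \<beta> / 2) * X B W ^ k)"
    using p0 \<delta>0 by (intro seeded_mono hit_pow) auto
  also have "\<dots> = \<theta>0 ^ k + (1 - \<beta> / 2) * M"
    using V by (simp only: seeded_add seeded_cmult seeded_const M_def)
  also have "(real k)\<^sup>2 / n + (real k)\<^sup>2 * p + (real k)\<^sup>2 * p\<^sup>2 * (n / \<delta>) \<le> err"
  proof -
    have "(real k)\<^sup>2 * p \<le> (real k)\<^sup>2 * (C / n)" using p0 by (intro mult_left_mono) auto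
    moreover have "(real k)\<^sup>2 * p\<^sup>2 * (n / \<delta>) \<le> (real k)\<^sup>2 * (C / n)\<^sup>2 * (n / \<delta>)"
      using p0 n \<delta>0 by (intro mult_right_mono mult_left_mono power_mono) auto
    moreover have "(real k)\<^sup>2 * (C / n)\<^sup>2 * (n / \<delta>) = (real k)\<^sup>2 / n * (C\<^sup>2 / \<delta>)"
      using n by (simp add: power2_eq_square)
    moreover have "err = (real k)\<^sup>2 / n + (real k)\<^sup>2 * (C / n) + (real k)\<^sup>2 / n * (C\<^sup>2 / \<delta>)"
      by (simp add: err_def distrib_left)
    ultimately show ?thesis by linarith
  qed
  finally have M: "M * (\<beta> / 2) \<le> err + \<theta>0 ^ k" by (simp add: algebra_simps)
  have "seeded p \<delta> V (\<lambda>B W. (X B W)\<^sup>2) \<le> seeded p \<delta> V (\<lambda>B W. \<theta>1\<^sup>2 + 1 / \<theta>1 ^ k * X B W ^ k)"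
  proof (rule seeded_mono)
    fix B W
    show "(X B W)\<^sup>2 \<le> \<theta>1\<^sup>2 + 1 / \<theta>1 ^ k * X B W ^ k"
    proof (cases "X B W \<le> \<theta>1")
      case True
      then have "(X B W)\<^sup>2 \<le> \<theta>1\<^sup>2" using X01 by (intro power_mono) auto
      moreover have "0 \<le> 1 / \<theta>1 ^ k * X B W ^ k" using X01 \<theta> \<eta> by simp
      ultimately show ?thesis by simp
    next
      case False
      have "(X B W)\<^sup>2 \<le> 1" using X01 by (simp add: power_le_one)
      also have "1 \<le> (X B W / \<theta>1) ^ k" using False \<theta> \<eta> by (intro one_le_power) simp
      also have "\<dots> = 1 / \<theta>1 ^ k * X B W ^ k" by (simp add: power_divide)
      finally show ?thesis using zero_le_power2[of \<theta>1] by linarith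
    qed
  qed (use p0 \<delta>0 in auto)
  also have "\<dots> = \<theta>1\<^sup>2 + 1 / \<theta>1 ^ k * M"
    using V by (simp only: seeded_add seeded_cmult seeded_const M_def)
  finally have "seeded p \<delta> V (\<lambda>B W. (X B W)\<^sup>2) \<le> \<theta>1\<^sup>2 + 1 / \<theta>1 ^ k * M" .
  moreover have "1 / \<theta>1 ^ k * M \<le> ((1 - \<eta> / (2 * C + 2)) ^ k + err / \<eta> ^ k) * (2 / \<beta>)"
  proof -
    have M': "M \<le> (err + \<theta>0 ^ k) * (2 / \<beta>)" using M \<beta>0 by (simp add: field_simps)
    have pos: "0 < \<theta>1 ^ k" using \<theta> \<eta> by simp
    have "1 / \<theta>1 ^ k * M \<le> 1 / \<theta>1 ^ k * ((err + \<theta>0 ^ k) * (2 / \<beta>))"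
      using M' pos by (intro mult_left_mono) auto
    also have "\<dots> = (err / \<theta>1 ^ k + (\<theta>0 / \<theta>1) ^ k) * (2 / \<beta>)"
    proof -
      have "1 / t * (u * v) = u / t * v" for t u v :: real by simp
      then show ?thesis by (simp only: power_divide add_divide_distrib)
    qed
    also have "\<dots> \<le> (err / \<eta> ^ k + (1 - \<eta> / (2 * C + 2)) ^ k) * (2 / \<beta>)"
    proof (intro mult_right_mono add_mono power_mono divide_left_mono)
      have "\<eta> / (2 * C + 2) \<le> \<eta> / \<theta>1" using \<theta> \<eta> by (intro divide_left_mono) auto
      moreover have "\<theta>0 / \<theta>1 = 1 - \<eta> / \<theta>1" using \<theta> \<eta> by (simp add: \<theta>1_def field_simps)
      ultimately show "\<theta>0 / \<theta>1 \<le> 1 - \<eta> / (2 * C + 2)" by simp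
      show "0 \<le> err" using C n \<delta>0 by (simp add: err_def)
    qed (use \<theta> \<eta> \<beta>0 in auto)
    finally show ?thesis by (simp add: add.commute)
  qed
  ultimately have "seeded p \<delta> V (\<lambda>B W. (X B W)\<^sup>2)
      \<le> \<theta>1\<^sup>2 + ((1 - \<eta> / (2 * C + 2)) ^ k + err / \<eta> ^ k) * (2 / \<beta>)" by (rule order_trans[OF _ add_left_mono])
  moreover have "\<theta>1 = 2 * max 0 (c - 1) + 2 * \<eta>" by (simp add: \<theta>1_def \<theta>0_def a_def)
  ultimately show ?thesis
    unfolding X_def n_def err_def by (simp only:)
qed

lemma sum_edges_on:
  assumes V: "finite V"
    and f: "\<And>x y. f (x, y) = f (y, x)" "\<And>e. 0 \<le> f e"
  shows "2 * (\<Sum>e\<in>edges_on V. f e) \<le> (\<Sum>x\<in>V. \<Sum>y\<in>V. f (x, y) :: real)"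
proof -
  let ?E = "edges_on V"
  let ?sw = "\<lambda>e :: edge. (snd e, fst e)"
  have fin: "finite ?E" using V by simp
  have inj: "inj_on ?sw ?E" by (auto simp: inj_on_def)
  have disj: "?E \<inter> ?sw ` ?E = {}" by (auto simp: edges_on_def)
  have "(\<Sum>e\<in>?sw ` ?E. f e) = (\<Sum>e\<in>?E. f (?sw e))" by (simp add: sum.reindex[OF inj])
  also have "\<dots> = (\<Sum>e\<in>?E. f e)" by (intro sum.cong refl) (metis f(1) prod.collapse)
  finally have "2 * (\<Sum>e\<in>?E. f e) = (\<Sum>e\<in>?E \<union> ?sw ` ?E. f e)"
    using fin disj by (simp add: sum.union_disjoint)
  also have "\<dots> \<le> (\<Sum>e\<in>V \<times> V. f e)"
    using V f(2) by (intro sum_mono2) (auto simp: edges_on_def)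
  also have "\<dots> = (\<Sum>x\<in>V. \<Sum>y\<in>V. f (x, y))" by (simp add: sum.cartesian_product)
  finally show ?thesis .
qed

lemma card_edges_on: "2 * real (card (edges_on {1..n})) = real n * (real n - 1)"
proof -
  have "card (clauses_on {1..n}) = card (edges_on {1..n} \<times> (UNIV :: signs set))"
    using bij_betw_same_card[OF bij_betw_clause_of] by metis
  also have "\<dots> = card (edges_on {1..n}) * 4" by (simp only: card_cartesian_product card_signs)
  finally have "real (card (clauses_on {1..n})) = 4 * real (card (edges_on {1..n}))" by simp
  then show ?thesis unfolding card_clauses_on_atLeastAtMost by simp
qed

text \<open>Connected vertices share an unseeded component or are both reached. The first kind is
  rare by \<open>unseeded_bound\<close>; the second is counted by the square of the number of
  reached vertices.\<close>

lemma conn_fraction_bound: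
  assumes p: "0 \<le> p" "p \<le> 1" and \<delta>: "0 < \<delta>" "\<delta> \<le> 1" and n: "n \<ge> 2"
  shows "bexp p (edges_on {1..n}) (\<lambda>B. (\<Sum>e\<in>edges_on {1..n}. of_bool (e \<in> conn B)) / card (edges_on {1..n}))
    \<le> (1 / \<delta> + real n * seeded p \<delta> {1..n} (\<lambda>B W. (card (reach {1..n} B W) / n)\<^sup>2)) / (real n - 1)"
proof -
  let ?V = "{1..n}"
  let ?E = "edges_on ?V"
  have cE: "real (card ?E) = real n * (real n - 1) / 2" using card_edges_on[of n] by simp
  have pt: "(\<Sum>e\<in>?E. of_bool (e \<in> conn B)) \<le> (n / \<delta> + bexp \<delta> ?V (\<lambda>W. (real (card (reach ?V B W)))\<^sup>2)) / 2" for B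
  proof -
    have "2 * (\<Sum>e\<in>?E. of_bool (e \<in> conn B)) \<le> (\<Sum>x\<in>?V. \<Sum>y\<in>?V. of_bool ((x, y) \<in> conn B) :: real)"
      by (rule sum_edges_on) (use conn_sym[of _ _ B] in \<open>auto simp: of_bool_def\<close>)
    also have "\<dots> \<le> (\<Sum>x\<in>?V. \<Sum>y\<in>?V. bexp \<delta> ?V (\<lambda>W. of_bool ((x, y) \<in> conn B \<and> component ?V B x \<inter> W = {})
        + of_bool (x \<in> reach ?V B W) * of_bool (y \<in> reach ?V B W)))"
    proof (intro sum_mono)
      fix x y assume xy: "x \<in> ?V" "y \<in> ?V"
      have "of_bool ((x, y) \<in> conn B) = bexp \<delta> ?V (\<lambda>_. of_bool ((x, y) \<in> conn B))" by simp
      also have "\<dots> \<le> bexp \<delta> ?V (\<lambda>W. of_bool ((x, y) \<in> conn B \<and> component ?V B x \<inter> W = {})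
        + of_bool (x \<in> reach ?V B W) * of_bool (y \<in> reach ?V B W))"
      proof (rule bexp_mono)
        fix W assume W: "W \<subseteq> ?V"
        have "y \<in> reach ?V B W" if "(x, y) \<in> conn B" "x \<in> reach ?V B W"
          using that xy(2) conn_trans[of _ x B y] unfolding reach_def by blast
        then show "(of_bool ((x, y) \<in> conn B) :: real) \<le> of_bool ((x, y) \<in> conn B \<and> component ?V B x \<inter> W = {})
          + of_bool (x \<in> reach ?V B W) * of_bool (y \<in> reach ?V B W)"
          using reach_iff_component[OF W xy(1), of B] by (auto simp: of_bool_def)
      qed (use \<delta> in auto)
      finally show "of_bool ((x, y) \<in> conn B) \<le> bexp \<delta> ?V (\<lambda>W. of_bool ((x, y) \<in> conn B \<and> component ?V B x \<inter> W = {})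
        + of_bool (x \<in> reach ?V B W) * of_bool (y \<in> reach ?V B W) :: real)" .
    qed
    also have "\<dots> = (\<Sum>x\<in>?V. \<Sum>y\<in>?V. bexp \<delta> ?V (\<lambda>W. of_bool ((x, y) \<in> conn B \<and> component ?V B x \<inter> W = {})))
        + bexp \<delta> ?V (\<lambda>W. \<Sum>x\<in>?V. \<Sum>y\<in>?V. of_bool (x \<in> reach ?V B W) * of_bool (y \<in> reach ?V B W))"
      by (simp only: bexp_add bexp_sum sum.distrib)
    also have "(\<lambda>W. \<Sum>x\<in>?V. \<Sum>y\<in>?V. of_bool (x \<in> reach ?V B W) * of_bool (y \<in> reach ?V B W))
        = (\<lambda>W. (real (card (reach ?V B W)))\<^sup>2)"
    proof
      fix W
      have "(\<Sum>x\<in>?V. of_bool (x \<in> reach ?V B W)) = real (card {x \<in> ?V. x \<in> reach ?V B W})"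
        by (simp add: of_bool_def sum.If_cases Int_def)
      also have "{x \<in> ?V. x \<in> reach ?V B W} = reach ?V B W" by (auto simp: reach_def)
      finally have "(\<Sum>x\<in>?V. of_bool (x \<in> reach ?V B W)) = real (card (reach ?V B W))" .
      then show "(\<Sum>x\<in>?V. \<Sum>y\<in>?V. of_bool (x \<in> reach ?V B W) * of_bool (y \<in> reach ?V B W))
        = (real (card (reach ?V B W)))\<^sup>2"
        by (simp only: sum_distrib_left[symmetric] sum_distrib_right[symmetric] power2_eq_square)
    qed
    also have "(\<Sum>x\<in>?V. \<Sum>y\<in>?V. bexp \<delta> ?V (\<lambda>W. of_bool ((x, y) \<in> conn B \<and> component ?V B x \<inter> W = {})))
        \<le> n / \<delta>"
      using unseeded_bound[of ?V \<delta> B] \<delta> by simp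
    finally show ?thesis by simp
  qed
  have "bexp p ?E (\<lambda>B. (\<Sum>e\<in>?E. of_bool (e \<in> conn B)) / card ?E)
      \<le> bexp p ?E (\<lambda>B. (n / \<delta> + bexp \<delta> ?V (\<lambda>W. (real (card (reach ?V B W)))\<^sup>2)) * (1 / 2 / card ?E))"
  proof (rule bexp_mono)
    have "a / c \<le> T * (1 / 2 / c)" if "a \<le> T / 2" "0 \<le> c" for a c T :: real
      using divide_right_mono[OF that] by simp
    from this[OF pt of_nat_0_le_iff]
    show "(\<Sum>e\<in>?E. of_bool (e \<in> conn B)) / card ?E
      \<le> (n / \<delta> + bexp \<delta> ?V (\<lambda>W. (real (card (reach ?V B W)))\<^sup>2)) * (1 / 2 / card ?E)" for B .
  qed (use p in auto)
  also have "\<dots> = (n / \<delta> + seeded p \<delta> ?V (\<lambda>B W. (real (card (reach ?V B W)))\<^sup>2)) * (1 / 2 / card ?E)"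
    by (simp only: bexp_cmult_right bexp_add seeded_def) simp
  also have "seeded p \<delta> ?V (\<lambda>B W. (real (card (reach ?V B W)))\<^sup>2)
      = (real n)\<^sup>2 * seeded p \<delta> ?V (\<lambda>B W. (card (reach ?V B W) / n)\<^sup>2)"
    unfolding seeded_cmult[symmetric] using n by (simp add: power_divide)
  also have "(n / \<delta> + (real n)\<^sup>2 * s) * (1 / 2 / card ?E) = (1 / \<delta> + real n * s) / (real n - 1)" for s
  proof -
    have "(N / d + N\<^sup>2 * s) * (1 / 2 / (N * (N - 1) / 2)) = (1 / d + N * s) / (N - 1)" if "0 < N" for N d :: real
    proof -
      have 1: "N / d + N\<^sup>2 * s = N * (1 / d + N * s)"
        by (simp add: power2_eq_square distrib_left mult.assoc)
      have 2: "1 / 2 / (N * (N - 1) / 2) = 1 / (N * (N - 1))" by simp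
      show ?thesis unfolding 1 2 using that by simp
    qed
    from this[of "real n" \<delta>] show ?thesis unfolding cE using n by simp
  qed
  finally show ?thesis .
qed

section \<open>The lower bound\<close>

lemma conn_prob_le_1:
  assumes "n \<ge> 2"
  shows "conn_prob n i \<le> 1"
proof -
  let ?E = "edges_on {1..n}"
  have E: "finite ?E" "?E \<noteq> {}" using edges_on_nonempty[OF assms] by auto
  have "conn_prob n i \<le> lexp i (?E \<times> (UNIV :: bool set)) (\<lambda>_. 1)"
    unfolding conn_prob_def
  proof (rule lexp_mono)
    fix L :: "(edge \<times> bool) list"
    have "(\<Sum>e\<in>?E. of_bool (e \<in> conn (kept L))) \<le> (\<Sum>e\<in>?E. 1 :: real)"
      by (rule sum_mono) simp
    then show "(\<Sum>e\<in>?E. of_bool (e \<in> conn (kept L))) / real (card ?E) \<le> 1"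
      using E by (simp add: divide_le_eq_1 card_gt_0_iff)
  qed
  also have "\<dots> = 1" using E by simp
  finally show ?thesis .
qed

text \<open>Connectivity increases with the edges, so a mean \<open>l\<close> slightly above
  \<open>i\<close> suffices. Pairs marked \<open>False\<close> occur independently of those marked
  \<open>True\<close> and average out, leaving a random graph with independent edges.\<close>

lemma conn_prob_le_bexp:
  fixes l z :: real
  assumes n: "n \<ge> 2" and l: "0 \<le> l" and z: "0 < z" "z \<le> 1"
  shows "conn_prob n i \<le> bexp (1 - exp (- (l / (real n - 1) / n))) (edges_on {1..n})
      (\<lambda>B. (\<Sum>e\<in>edges_on {1..n}. of_bool (e \<in> conn B)) / card (edges_on {1..n}))
    + exp (l * (z - 1)) / z ^ i"
proof -
  let ?E = "edges_on {1..n}"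
  define F where "F B = (\<Sum>e\<in>?E. of_bool (e \<in> conn B)) / real (card ?E)" for B
  define f where "f D = F {e. (e, True) \<in> D}" for D :: "(edge \<times> bool) set"
  let ?p = "1 - exp (- (l / (real n - 1) / n))"
  let ?T = "(\<lambda>e :: edge. (e, True)) ` ?E" and ?N = "(\<lambda>e :: edge. (e, False)) ` ?E"
  have E: "finite ?E" "?E \<noteq> {}" using edges_on_nonempty[OF n] by auto
  have Fmono: "F B \<le> F D" if "B \<subseteq> D" for B D
    unfolding F_def using conn_mono[OF that]
    by (intro divide_right_mono sum_mono) (auto simp: of_bool_def)
  have F0: "0 \<le> F B" for B unfolding F_def by (intro divide_nonneg_nonneg sum_nonneg) auto
  have cA: "real (card (?E \<times> (UNIV :: bool set))) = (real n - 1) * n"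
    using card_edges_on[of n] by (simp add: card_cartesian_product mult.commute)
  have "lexp i (?E \<times> UNIV) (\<lambda>L. f (set L)) * (1 - exp (l * (z - 1)) / z ^ i)
      \<le> bexp (1 - exp (- (l / card (?E \<times> (UNIV :: bool set))))) (?E \<times> UNIV) f"
  proof (rule lexp_le_bexp_mono)
    show "f B \<le> f D" if "B \<subseteq> D" for B D unfolding f_def by (rule Fmono) (use that in blast)
  qed (use E l z F0 in \<open>auto simp: f_def\<close>)
  also have "lexp i (?E \<times> UNIV) (\<lambda>L. f (set L)) = conn_prob n i"
    unfolding conn_prob_def f_def F_def kept_def ..
  also have "l / card (?E \<times> (UNIV :: bool set)) = l / (real n - 1) / n"
    unfolding cA by simp
  also have "?E \<times> (UNIV :: bool set) = ?T \<union> ?N" by (auto simp: UNIV_bool)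
  also have "bexp ?p (?T \<union> ?N) f = bexp ?p ?T (\<lambda>A. bexp ?p ?N (\<lambda>B. f (A \<union> B)))"
    by (rule bexp_union) (use E in auto)
  also have "\<dots> = bexp ?p ?E (\<lambda>A. bexp ?p ?E (\<lambda>B. f ((\<lambda>e. (e, True)) ` A \<union> (\<lambda>e. (e, False)) ` B)))"
    using E by (simp add: bexp_image inj_on_def)
  also have "(\<lambda>A B. f ((\<lambda>e. (e, True)) ` A \<union> (\<lambda>e. (e, False)) ` B)) = (\<lambda>A B. F A)"
    unfolding f_def by (intro HOL.ext arg_cong[of _ _ F]) auto
  also have "bexp ?p ?E (\<lambda>A. bexp ?p ?E (\<lambda>B. F A)) = bexp ?p ?E F"
    using E by simp
  finally have main: "conn_prob n i * (1 - exp (l * (z - 1)) / z ^ i) \<le> bexp ?p ?E F" .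
  define t where "t = exp (l * (z - 1)) / z ^ i"
  have "0 \<le> t" using z by (simp add: t_def)
  then have "conn_prob n i * t \<le> 1 * t"
    by (intro mult_right_mono conn_prob_le_1 n)
  then have "conn_prob n i \<le> bexp ?p ?E F + t"
    using main unfolding t_def[symmetric] by (simp add: right_diff_distrib)
  then show ?thesis unfolding F_def[abs_def] t_def .
qed

text \<open>With \<open>y = \<eta> / (4 * C)\<close> and
  \<open>ln (1 - y) \<ge> - y - 2 * y\<^sup>2\<close>, the linear gain \<open>\<eta> * y * n\<close>
  is twice the quadratic loss \<open>2 * C * y\<^sup>2 * n\<close>.\<close>

lemma poisson_tail:
  fixes C \<eta> :: real
  assumes C: "1 \<le> C" and \<eta>: "0 < \<eta>" "\<eta> \<le> 1" and i: "real i \<le> C * real n"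
  shows "exp ((real i + \<eta> * real n) * (1 - \<eta> / (4 * C) - 1)) / (1 - \<eta> / (4 * C)) ^ i
    \<le> exp (- (real n * (\<eta>\<^sup>2 / (8 * C))))"
proof -
  define y where "y = \<eta> / (4 * C)"
  have y: "0 \<le> y" "y \<le> 1 / 2" using assms by (auto simp: y_def field_simps)
  have "exp (real i * (- y - 2 * y\<^sup>2)) \<le> exp (real i * ln (1 - y))"
    using ln_one_minus_pos_lower_bound[OF y] by (simp add: mult_left_mono)
  also have "\<dots> = (1 - y) ^ i" using y by (simp add: exp_of_nat_mult)
  finally have "exp ((real i + \<eta> * real n) * (1 - y - 1)) / (1 - y) ^ i
      \<le> exp ((real i + \<eta> * real n) * (1 - y - 1)) / exp (real i * (- y - 2 * y\<^sup>2))"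
    using y by (intro divide_left_mono) auto
  also have "\<dots> = exp (real i * (2 * y\<^sup>2) - real n * (\<eta> * y))"
    by (simp add: exp_diff[symmetric] algebra_simps)
  also have "\<dots> \<le> exp ((C * real n) * (2 * y\<^sup>2) - real n * (\<eta> * y))"
    using i by (simp add: mult_right_mono)
  also have "(C * real n) * (2 * y\<^sup>2) - real n * (\<eta> * y) = - (real n * (\<eta>\<^sup>2 / (8 * C)))"
    using C by (simp add: y_def power2_eq_square field_simps)
  finally show ?thesis unfolding y_def .
qed

text \<open>Uniform in \<open>i\<close> because the bound is summed over all clauses. The order of
  choices matters: \<eta>, then \<delta>, then the moment \<open>k\<close>, and only then
  \<open>n\<close>, since the error of the moment recursion is divided by
  \<open>\<eta> ^ k\<close>.\<close>

lemma conn_prob_bound: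
  fixes C \<eta> :: real
  assumes C: "1 \<le> C" and \<eta>: "0 < \<eta>" "\<eta> \<le> 1 / 2"
  shows "\<forall>\<^sub>F n in sequentially. \<forall>i. real i \<le> C * real n \<longrightarrow>
    conn_prob n i \<le> (2 * max 0 (i / n - 1) + 6 * \<eta>)\<^sup>2 + 3 * \<eta>"
proof -
  define C' where "C' = C + 1"
  define \<beta> where "\<beta> = \<eta> / (6 * C' + 4)"
  define \<delta> where "\<delta> = \<beta> * \<eta> / 2"
  have \<beta>: "0 < \<beta>" "\<beta> \<le> 1" using C \<eta> by (auto simp: \<beta>_def C'_def field_simps)
  have "\<beta> * \<eta> \<le> 1 * 1" using \<beta> \<eta> by (intro mult_mono) auto
  then have \<delta>: "0 < \<delta>" "\<delta> \<le> 1" using \<beta> \<eta> by (auto simp: \<delta>_def)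
  define r where "r = 1 - \<eta> / (2 * C' + 2)"
  have r: "0 \<le> r" "r < 1" using C \<eta> by (auto simp: r_def C'_def field_simps)
  obtain k0 where k0: "r ^ k0 < \<eta> * \<beta> / 2"
    using real_arch_pow_inv[of "\<eta> * \<beta> / 2" r] r \<eta> \<beta> by auto
  define k where "k = Suc k0"
  have "r ^ k \<le> r ^ k0" unfolding k_def using r by (intro power_decreasing) auto
  then have "r ^ k \<le> \<eta> * \<beta> / 2" using k0 by linarith
  then have rk: "r ^ k * (2 / \<beta>) \<le> \<eta>" using \<beta> by (simp add: field_simps)
  define K where "K = (real k)\<^sup>2 * (1 + C' + C'\<^sup>2 / \<delta>) / \<eta> ^ k * (2 / \<beta>)"
  have K: "0 \<le> K" using C \<eta> \<beta> \<delta> by (simp add: K_def C'_def)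
  define D where "D = 1 / \<delta> + K + (2 * C + 3)\<^sup>2 + 1"
  have ev1: "\<forall>\<^sub>F n in sequentially. D / (real n - 1) < \<eta>"
  proof (rule order_tendstoD(2))
    show "(\<lambda>n. D / (real n - 1)) \<longlonglongrightarrow> 0" by real_asymp
  qed fact
  have ev2: "\<forall>\<^sub>F n in sequentially. exp (- (real n * (\<eta>\<^sup>2 / (8 * C)))) < \<eta>"
  proof (rule order_tendstoD(2))
    define a where "a = \<eta>\<^sup>2 / (8 * C)"
    have "0 < a" using \<eta> C by (simp add: a_def)
    then have "(\<lambda>n. exp (- (real n * a))) \<longlonglongrightarrow> 0" by real_asymp
    then show "(\<lambda>n. exp (- (real n * (\<eta>\<^sup>2 / (8 * C))))) \<longlonglongrightarrow> 0" unfolding a_def .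
  qed fact
  have ev3: "\<forall>\<^sub>F n in sequentially. (C + 2 * \<eta>) / real n < \<eta>"
  proof (rule order_tendstoD(2))
    show "(\<lambda>n. (C + 2 * \<eta>) / real n) \<longlonglongrightarrow> 0" by real_asymp
  qed fact
  show ?thesis
    using ev1 ev2 ev3 eventually_ge_at_top[of "max 2 k"]
  proof eventually_elim
    case (elim n)
    then have n: "n \<ge> 2" "k \<le> n" by auto
    then have N: "0 < real n" "0 < real n - 1" by auto
    show ?case
    proof (intro allI impI)
      fix i assume i: "real i \<le> C * real n"
      define x where "x = real i / n"
      define a where "a = max 0 (x - 1)"
      have x: "0 \<le> x" "x \<le> C" using i N by (auto simp: x_def divide_le_eq)
      have a: "0 \<le> a" "a \<le> C" using x C by (auto simp: a_def)
      define l where "l = real i + \<eta> * n"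
      \<comment> \<open>About \<open>i / n + \<eta>\<close>, the mean degree: \<open>i\<close>
        edges, each kept with probability 1/2, give mean degree \<open>i / n\<close>, and \<eta> is
        the excess needed for Poissonization.\<close>
      define c where "c = l / (real n - 1)"
      have lx: "l = (x + \<eta>) * n" using N by (simp add: l_def x_def distrib_right)
      have l: "0 \<le> l" using \<eta> by (simp add: l_def)
      have "C + 2 * \<eta> < \<eta> * n" using elim(3) N by (simp add: divide_less_eq)
      then have "l \<le> (x + 2 * \<eta>) * (real n - 1)"
        unfolding lx using x by (simp add: algebra_simps)
      then have c: "0 \<le> c" "c \<le> x + 2 * \<eta>" using l N by (auto simp: c_def divide_le_eq)
      define z where "z = 1 - \<eta> / (4 * C)"
      have z: "0 < z" "z \<le> 1" using \<eta> C by (auto simp: z_def field_simps)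
      define p where "p = 1 - exp (- (c / n))"
      have p: "0 \<le> p" "p \<le> 1" using c by (auto simp: p_def)
      define s where "s = seeded p \<delta> {1..n} (\<lambda>B W. (card (reach {1..n} B W) / n)\<^sup>2)"
      define Q where "Q = (2 * a + 6 * \<eta>)\<^sup>2"
      have "exp (l * (z - 1)) / z ^ i \<le> exp (- (real n * (\<eta>\<^sup>2 / (8 * C))))"
        unfolding l_def z_def using C \<eta> i by (intro poisson_tail) auto
      then have tail: "exp (l * (z - 1)) / z ^ i \<le> \<eta>" using elim(2) by linarith
      have "s \<le> (2 * max 0 (c - 1) + 2 * \<eta>)\<^sup>2
          + (r ^ k + (real k)\<^sup>2 / n * (1 + C' + C'\<^sup>2 / \<delta>) / \<eta> ^ k) * (2 / \<beta>)"
        using second_moment_bound[of "{1..n}" k c C' \<eta> \<beta> \<delta> p] n x c \<eta>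
        unfolding s_def r_def by (simp add: k_def C'_def \<beta>_def \<delta>_def p_def)
      also have "\<dots> = (2 * max 0 (c - 1) + 2 * \<eta>)\<^sup>2 + (r ^ k * (2 / \<beta>) + K / n)"
        by (simp add: K_def distrib_right add_divide_distrib)
      also have "\<dots> \<le> Q + (\<eta> + K / n)"
      proof -
        define u where "u = max 0 (c - 1)"
        have u: "0 \<le> u" "u \<le> a + 2 * \<eta>" using c \<eta> by (auto simp: u_def a_def)
        have "(2 * u + 2 * \<eta>)\<^sup>2 \<le> Q"
          unfolding Q_def using u \<eta> by (intro power_mono) linarith+
        then show ?thesis using rk by (simp add: u_def)
      qed
      finally have s: "s \<le> Q + (\<eta> + K / n)" .
      have "n * s \<le> n * (Q + (\<eta> + K / n))" using s N by (intro mult_left_mono) auto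
      also have "\<dots> = n * (Q + \<eta>) + K" using N by (simp add: distrib_left)
      finally have ns: "n * s \<le> n * (Q + \<eta>) + K" .
      have "Q \<le> (2 * C + 3)\<^sup>2" unfolding Q_def using a \<eta> by (intro power_mono) auto
      then have "1 / \<delta> + n * s \<le> (real n - 1) * (Q + \<eta>) + D"
        using ns \<eta> by (simp add: D_def algebra_simps)
      then have "(1 / \<delta> + n * s) / (real n - 1) \<le> ((real n - 1) * (Q + \<eta>) + D) / (real n - 1)"
        using N by (intro divide_right_mono) auto
      also have "\<dots> = Q + \<eta> + D / (real n - 1)" using N by (simp add: add_divide_distrib)
      also have "\<dots> \<le> Q + 2 * \<eta>" using elim(1) by simp
      finally have "(1 / \<delta> + n * s) / (real n - 1) \<le> Q + 2 * \<eta>" .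
      moreover have "conn_prob n i \<le> (1 / \<delta> + n * s) / (real n - 1) + exp (l * (z - 1)) / z ^ i"
        using conn_prob_le_bexp[OF n(1) l z, of i] conn_fraction_bound[OF p \<delta> n(1)]
        unfolding c_def[symmetric] p_def[symmetric] s_def[symmetric] by linarith
      ultimately show "conn_prob n i \<le> (2 * max 0 (i / n - 1) + 6 * \<eta>)\<^sup>2 + 3 * \<eta>"
        using tail unfolding Q_def a_def x_def by linarith
    qed
  qed
qed

text \<open>A lower Riemann sum for the integral of the squared excess; one step is
  \<open>3 * h * a\<^sup>2 \<le> (a + h) ^ 3 - a ^ 3\<close> with \<open>h = 1 / n\<close>.\<close>

lemma sum_square_excess_le:
  fixes n :: nat
  assumes "0 < n"
  shows "(\<Sum>i<m. (max 0 (real i / n - 1))\<^sup>2) \<le> real n / 3 * (max 0 (real m / n - 1)) ^ 3"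
proof (induction m)
  case (Suc m)
  define a where "a = max 0 (real m / n - 1)"
  define b where "b = max 0 (real (Suc m) / n - 1)"
  define h where "h = 1 / real n"
  have h: "0 < h" using assms by (simp add: h_def)
  have step: "a\<^sup>2 \<le> 1 / h / 3 * (b ^ 3 - a ^ 3)"
  proof (cases "a = 0")
    case True
    then show ?thesis using h by (simp add: b_def)
  next
    case False
    then have "0 < real m / n - 1" unfolding a_def by (metis max_absorb1 not_le)
    moreover have "real (Suc m) / n - 1 = (real m / n - 1) + h"
      by (simp add: h_def add_divide_distrib)
    ultimately have b: "b = a + h" using h unfolding a_def b_def by linarith
    have a: "0 \<le> a" by (simp add: a_def)
    have "b ^ 3 - a ^ 3 = 3 * h * a\<^sup>2 + (3 * a * h\<^sup>2 + h ^ 3)"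
      unfolding b by (simp add: power2_eq_square power3_eq_cube algebra_simps)
    moreover have "0 \<le> 3 * a * h\<^sup>2 + h ^ 3" using a h by simp
    ultimately have "3 * h * a\<^sup>2 \<le> b ^ 3 - a ^ 3" by linarith
    then show ?thesis using h by (simp add: field_simps)
  qed
  have hn: "1 / h = real n" by (simp add: h_def)
  have "(\<Sum>i<Suc m. (max 0 (real i / n - 1))\<^sup>2) \<le> real n / 3 * a ^ 3 + a\<^sup>2"
    using Suc by (simp add: a_def)
  also have "\<dots> \<le> real n / 3 * b ^ 3"
    using step unfolding hn by (simp add: right_diff_distrib)
  finally show ?case unfolding b_def .
qed simp

text \<open>With \<open>a\<close> the excess of \<open>i / n\<close> over 1, a quarter of
  \<open>conn_prob\<close> is at most \<open>a\<^sup>2\<close> plus a multiple of \<eta>. The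
  squares sum to at most \<open>\<epsilon> ^ 3 / 3 * n\<close>.\<close>

lemma lower_bound_slack:
  fixes \<epsilon> \<eta> :: real
  assumes \<epsilon>: "0 < \<epsilon>" and \<eta>: "0 < \<eta>" "\<eta> \<le> 1 / 2"
  shows "\<forall>\<^sub>F n in sequentially. ((1 + \<epsilon> - \<epsilon> ^ 3 / 3) - 6 * (1 + \<epsilon>)\<^sup>2 * \<eta>) * real n - 1
    \<le> expected_max_sat n (nat \<lfloor>(1 + \<epsilon>) * real n\<rfloor>)"
proof -
  have "1 \<le> 1 + \<epsilon>" using \<epsilon> by simp
  from conn_prob_bound[OF this \<eta>] eventually_ge_at_top[of 2] show ?thesis
  proof eventually_elim
    case (elim n)
    let ?m = "nat \<lfloor>(1 + \<epsilon>) * real n\<rfloor>"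
    define R where "R = 6 * (1 + \<epsilon>) * \<eta>"
    have N: "0 < real n" using elim by simp
    have "0 \<le> (1 + \<epsilon>) * real n" using \<epsilon> by simp
    then have m: "real ?m \<le> (1 + \<epsilon>) * real n" "(1 + \<epsilon>) * real n - 1 \<le> real ?m" by linarith+
    have each: "conn_prob n i / 4 \<le> (max 0 (real i / n - 1))\<^sup>2 + R" if i: "i < ?m" for i
    proof -
      define a where "a = max 0 (real i / n - 1)"
      have i': "real i \<le> (1 + \<epsilon>) * real n" using i m(1) by linarith
      then have "real i / n \<le> 1 + \<epsilon>" using N by (simp add: divide_le_eq)
      then have a: "0 \<le> a" "a \<le> \<epsilon>" using \<epsilon> by (auto simp: a_def)
      have "conn_prob n i \<le> (2 * a + 6 * \<eta>)\<^sup>2 + 3 * \<eta>"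
        using elim(1) i' unfolding a_def by blast
      also have "\<dots> = 4 * a\<^sup>2 + 24 * (a * \<eta>) + 36 * (\<eta> * \<eta>) + 3 * \<eta>"
        by (simp add: power2_eq_square algebra_simps)
      also have "\<dots> \<le> 4 * a\<^sup>2 + 24 * (\<epsilon> * \<eta>) + 36 * (1 / 2 * \<eta>) + 3 * \<eta>"
        using a \<eta> by (intro add_mono mult_left_mono mult_right_mono) auto
      also have "\<dots> \<le> 4 * (a\<^sup>2 + R)" using \<eta> by (simp add: R_def algebra_simps)
      finally show ?thesis unfolding a_def by simp
    qed
    have R: "0 \<le> R" using \<epsilon> \<eta> by (simp add: R_def)
    have "(\<Sum>i<?m. conn_prob n i) / 4 \<le> (\<Sum>i<?m. (max 0 (real i / n - 1))\<^sup>2 + R)"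
      unfolding sum_divide_distrib using each by (intro sum_mono) auto
    also have "\<dots> = (\<Sum>i<?m. (max 0 (real i / n - 1))\<^sup>2) + ?m * R"
      by (simp add: sum.distrib)
    also have "\<dots> \<le> real n / 3 * (max 0 (real ?m / n - 1)) ^ 3 + ?m * R"
      using sum_square_excess_le[of n ?m] N by simp
    also have "\<dots> \<le> real n / 3 * \<epsilon> ^ 3 + ((1 + \<epsilon>) * real n) * R"
    proof (intro add_mono mult_left_mono mult_right_mono power_mono m R)
      have "real ?m / n \<le> 1 + \<epsilon>" using m N by (simp add: divide_le_eq)
      then show "max 0 (real ?m / n - 1) \<le> \<epsilon>" using \<epsilon> by simp
    qed auto
    finally have "(\<Sum>i<?m. conn_prob n i) / 4 \<le> real n / 3 * \<epsilon> ^ 3 + ((1 + \<epsilon>) * real n) * R" .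
    moreover have "real ?m - (\<Sum>i<?m. conn_prob n i) / 4 \<le> expected_max_sat n ?m"
      by (rule expected_max_sat_lower[OF elim(2)])
    moreover have "((1 + \<epsilon> - \<epsilon> ^ 3 / 3) - 6 * (1 + \<epsilon>)\<^sup>2 * \<eta>) * real n - 1
        = (1 + \<epsilon>) * real n - 1 - (real n / 3 * \<epsilon> ^ 3 + ((1 + \<epsilon>) * real n) * R)"
      by (simp add: R_def power2_eq_square algebra_simps)
    ultimately show ?case using m(2) by linarith
  qed
qed

lemma lower_bound:
  fixes \<epsilon> :: real
  assumes \<epsilon>: "0 < \<epsilon>"
  shows "asymp_le (\<lambda>n. (1 + \<epsilon> - \<epsilon> ^ 3 / 3) * real n)
    (\<lambda>n. expected_max_sat n (nat \<lfloor>(1 + \<epsilon>) * real n\<rfloor>))"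
proof -
  define q where "q = 1 + \<epsilon> - \<epsilon> ^ 3 / 3"
  define f where "f n = expected_max_sat n (nat \<lfloor>(1 + \<epsilon>) * real n\<rfloor>)" for n
  have f0: "0 \<le> f n" for n
    unfolding f_def expected_max_sat_def by (intro Bochner_Integration.integral_nonneg) simp
  have ev: "\<forall>\<^sub>F n in sequentially. q * real n / f n \<le> r" if r: "1 < r" for r :: real
  \<comment> \<open>For large \<epsilon> the coefficient is not positive and the ratio is at most 0,
    also if \<open>f n\<close> vanishes, where division yields 0.\<close>
  proof (cases "q \<le> 0")
    case True
    then have "q * real n / f n \<le> r" for n
    proof -
      have "q * real n / f n \<le> 0"
        using True f0[of n] by (simp add: divide_nonpos_nonneg mult_nonpos_nonneg)
      then show ?thesis using r by simp
    qed
    then show ?thesis by simp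
  next
    case False
    \<comment> \<open>The amount that \<open>q\<close> may lose while the ratio stays below
      \<open>r\<close>; half of it covers the error in \<eta>, half the constant 1.\<close>
    define d where "d = q - q / r"
    have d: "0 < d" using False r by (simp add: d_def field_simps)
    define D where "D = 6 * (1 + \<epsilon>)\<^sup>2"
    have D: "0 < D" using \<epsilon> by (simp add: D_def)
    define \<eta> where "\<eta> = min (1 / 2) (d / (2 * D))"
    have \<eta>: "0 < \<eta>" "\<eta> \<le> 1 / 2" using d D by (auto simp: \<eta>_def)
    have "\<eta> \<le> d / (2 * D)" by (simp add: \<eta>_def)
    then have D\<eta>: "D * \<eta> \<le> d / 2" using D by (simp add: field_simps)
    have "\<forall>\<^sub>F n in sequentially. 2 / d < real n"
      using filterlim_real_sequentially by (simp add: filterlim_at_top_dense)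
    then show ?thesis
      using lower_bound_slack[OF \<epsilon> \<eta>] eventually_gt_at_top[of 0]
    proof eventually_elim
      case (elim n)
      have N: "0 < real n" using elim by simp
      have "1 \<le> d / 2 * real n" using elim(1) d by (simp add: field_simps)
      moreover have "D * \<eta> * real n \<le> d / 2 * real n" using D\<eta> N by (intro mult_right_mono) auto
      moreover have "(q - D * \<eta>) * real n - 1 \<le> f n"
        using elim(2) unfolding q_def D_def f_def .
      ultimately have "(q - d) * real n \<le> f n" by (simp add: left_diff_distrib)
      then have fq: "q / r * real n \<le> f n" by (simp add: d_def)
      moreover have pos: "0 < q / r * real n" using False r N by simp
      ultimately have "0 < f n" by linarith
      moreover have "q * real n \<le> r * f n" using fq r by (simp add: field_simps)
      ultimately show ?case by (simp add: divide_le_eq)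
    qed
  qed
  have "limsup (\<lambda>n. ereal (q * real n / f n)) \<le> 1"
    unfolding Limsup_le_iff
  proof (intro allI impI)
    fix y :: ereal assume "1 < y"
    then obtain r where r: "1 < ereal r" "ereal r < y" using ereal_dense2 by blast
    then have "1 < r" by (simp add: one_ereal_def)
    from ev[OF this] show "\<forall>\<^sub>F n in sequentially. ereal (q * real n / f n) < y"
    proof eventually_elim
      case (elim n)
      then have "ereal (q * real n / f n) \<le> ereal r" by simp
      also have "\<dots> < y" by fact
      finally show ?case .
    qed
  qed
  then show ?thesis unfolding asymp_le_def q_def f_def .
qed

theorem theorem5:
  shows "(\<forall>\<epsilon>::real. 0 < \<epsilon> \<longrightarrow>
            asymp_le (\<lambda>n. (1 + \<epsilon> - \<epsilon> ^ 3 / 3) * real n)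
                     (\<lambda>n. expected_max_sat n (nat \<lfloor>(1 + \<epsilon>) * real n\<rfloor>)))
       \<and> (\<exists>\<alpha>\<^sub>0::real. \<exists>\<epsilon>\<^sub>0::real. 0 < \<alpha>\<^sub>0 \<and> 0 < \<epsilon>\<^sub>0 \<and>
            (\<forall>\<epsilon>. 0 < \<epsilon> \<and> \<epsilon> < \<epsilon>\<^sub>0 \<longrightarrow>
               asymp_le (\<lambda>n. expected_max_sat n (nat \<lfloor>(1 + \<epsilon>) * real n\<rfloor>))
                        (\<lambda>n. (1 + \<epsilon> - 1 / 3 * (\<alpha>\<^sub>0 * \<epsilon> ^ 3 / ln (1 / \<epsilon>))) * real n)))"
proof (intro conjI allI impI)
  show "asymp_le (\<lambda>n. (1 + \<epsilon> - \<epsilon> ^ 3 / 3) * real n)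
    (\<lambda>n. expected_max_sat n (nat \<lfloor>(1 + \<epsilon>) * real n\<rfloor>))" if "0 < \<epsilon>" for \<epsilon> :: real
    by (rule lower_bound[OF that])
  have "asymp_le (\<lambda>n. expected_max_sat n (nat \<lfloor>(1 + \<epsilon>) * real n\<rfloor>))
      (\<lambda>n. (1 + \<epsilon> - 1 / 3 * (3 / (4 * 10 ^ 8) * \<epsilon> ^ 3 / ln (1 / \<epsilon>))) * real n)"
    if "0 < \<epsilon> \<and> \<epsilon> < 1 / 1000" for \<epsilon> :: real
  proof -
    \<comment> \<open>The witness \<open>\<alpha>\<^sub>0 = 3 / (4 * 10 ^ 8)\<close> absorbs the
      factor 1/3 of the statement.\<close>
    have eq: "1 / 3 * (3 / (4 * 10 ^ 8) * \<epsilon> ^ 3 / ln (1 / \<epsilon>)) = \<epsilon> ^ 3 / (4 * 10 ^ 8 * ln (1 / \<epsilon>))"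
      by simp
    show ?thesis unfolding eq using that by (intro upper_bound) auto
  qed
  then show "\<exists>\<alpha>\<^sub>0::real. \<exists>\<epsilon>\<^sub>0::real. 0 < \<alpha>\<^sub>0 \<and> 0 < \<epsilon>\<^sub>0 \<and>
      (\<forall>\<epsilon>. 0 < \<epsilon> \<and> \<epsilon> < \<epsilon>\<^sub>0 \<longrightarrow>
         asymp_le (\<lambda>n. expected_max_sat n (nat \<lfloor>(1 + \<epsilon>) * real n\<rfloor>))
                  (\<lambda>n. (1 + \<epsilon> - 1 / 3 * (\<alpha>\<^sub>0 * \<epsilon> ^ 3 / ln (1 / \<epsilon>))) * real n))"
    by (intro exI[of _ "3 / (4 * 10 ^ 8)"] exI[of _ "1 / 1000"]) simp
qed

end
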